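(* Let $\omega$ be such that two $n\times n$ matrices can be multiplied in time $O(n^\omega)$. For every fixed pattern $P$ of merge-width $p$, the $P$-Detection problem on ordered graphs with $n$ vertices can be solved in time $O(n^{\omega p/2})$.
   Context: A pattern $P$ consists of a finite totally ordered vertex set $V(P)$ with a partition of the unordered pairs of distinct vertices into mandatory edges $M(P)$, forbidden edges $F(P)$ and undecided pairs $U(P)$; write $E(P)=M(P)\cup F(P)$ (each element keeping its type) and call its elements edges. An ordered graph $(G,\tau)$ contains $P$ if there is $X\subseteq V(G)$, $|X|=|V(P)|$, such that under the order-preserving bijection $X\to V(P)$ all mandatory pairs are edges and all forbidden pairs are non-edges of $G$. $P$-Detection: given $(G,\tau)$ (adjacency lists), decide whether it contains $P$. An anchored pattern is a pattern with a distinguished subset of vertices called anchors. An anchored pattern $P=(V,E)$ is a merge of anchored patterns $P_1=(V_1,E_1)$, $P_2=(V_2,E_2)$ (with $V_1,V_2\subseteq V$ carrying the induced order, edges keeping their type) if: (a) $(E_1,E_2)$ is a partition of $E$ and every edge of $E_i$ has both endpoints in $V_i$; (b) $V_1\cup V_2=V$; (c) every vertex of $V_1\cap V_2$ is an anchor in both $P_1$ and $P_2$; (d) every anchor of $P$ is an anchor in each $P_i$ containing it; (e) there are no two consecutive vertices of $V$ (in its order) such that one belongs only to $V_1$ and the other only to $V_2$. An anchored pattern $P$ is obtained from $P'$ by a vertex creation if $P$ is $P'$ with one additional isolated vertex inserted into the order, where in $P'$ the vertices immediately before and immediately after the insertion position (when they exist) are anchors. An edge-creation pattern is an anchored pattern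 with two vertices whose pair is a single mandatory or forbidden edge. A merge tree for $P$ is a rooted tree whose nodes are labeled by anchored patterns, the root being labeled by $P$ with some set of anchors, every leaf by an edge-creation pattern, every node with one child by a pattern obtained by a vertex creation from its child's label, and every node with two children by a merge of its children's labels. The width of a merge tree is the maximum number of anchors of a label; the merge-width of $P$ is the minimum width of a merge tree for $P$.
   Formalization: Vertices are named by rank in the order and adjacency lists are given sorted by it, with start positions and total length; for p ≥ 2 sorting fits in O(n²), while for p ≤ 1 (edges whose ends need not be anchors) the bound fails for unsorted lists. *)

theory Defs
  imports Complex_Main "HOL-Library.Landau_Symbols"
begin

section \<open>Patterns and ordered graphs\<close>

definition pairs :: "'a set \<Rightarrow> 'a set set" where
  "pairs V = {{u, v} | u v. u \<in> V \<and> v \<in> V \<and> u \<noteq> v}"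

text \<open>The vertex order of a pattern is the order of the ambient type. Undecided pairs are
  those that are neither mandatory nor forbidden.\<close>

record 'a pattern =
  verts :: "'a set"
  mand :: "'a set set"
  forb :: "'a set set"

definition edges :: "('a, 'b) pattern_scheme \<Rightarrow> 'a set set" where
  "edges P = mand P \<union> forb P"

definition undecided :: "('a, 'b) pattern_scheme \<Rightarrow> 'a set set" where
  "undecided P = pairs (verts P) - edges P"

definition wf_pattern :: "('a, 'b) pattern_scheme \<Rightarrow> bool" where
  "wf_pattern P \<longleftrightarrow>
     finite (verts P) \<and> edges P \<subseteq> pairs (verts P) \<and> mand P \<inter> forb P = {}"

text \<open>An ordered graph with \<open>n\<close> vertices: the vertex of rank \<open>i\<close> in the order is named \<open>i\<close>.\<close>

definition ordered_graph :: "nat \<Rightarrow> nat set set \<Rightarrow> bool" where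
  "ordered_graph n E \<longleftrightarrow> E \<subseteq> pairs {..<n}"

definition contains_pattern ::
    "nat \<Rightarrow> nat set set \<Rightarrow> ('a::linorder, 'b) pattern_scheme \<Rightarrow> bool" where
  "contains_pattern n E P \<longleftrightarrow>
     (\<exists>X f. X \<subseteq> {..<n} \<and> card X = card (verts P) \<and>
        bij_betw f X (verts P) \<and> strict_mono_on X f \<and>
        (\<forall>x\<in>X. \<forall>y\<in>X. {f x, f y} \<in> mand P \<longrightarrow> {x, y} \<in> E) \<and>
        (\<forall>x\<in>X. \<forall>y\<in>X. {f x, f y} \<in> forb P \<longrightarrow> {x, y} \<notin> E))"


section \<open>Merge-width\<close>

record 'a apattern = "'a pattern" +
  anchors :: "'a set"

definition wf_apattern :: "'a apattern \<Rightarrow> bool" where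
  "wf_apattern P \<longleftrightarrow> wf_pattern P \<and> anchors P \<subseteq> verts P"

definition consecutive :: "'a::linorder set \<Rightarrow> 'a \<Rightarrow> 'a \<Rightarrow> bool" where
  "consecutive V u v \<longleftrightarrow> u \<in> V \<and> v \<in> V \<and> u < v \<and> \<not> (\<exists>w\<in>V. u < w \<and> w < v)"

definition is_merge ::
    "'a::linorder apattern \<Rightarrow> 'a apattern \<Rightarrow> 'a apattern \<Rightarrow> bool" where
  "is_merge P P1 P2 \<longleftrightarrow>
     edges P1 \<union> edges P2 = edges P \<and> edges P1 \<inter> edges P2 = {} \<and>
     (\<forall>Q\<in>{P1, P2}. mand Q \<subseteq> mand P \<and> forb Q \<subseteq> forb P \<and> (\<forall>e\<in>edges Q. e \<subseteq> verts Q)) \<and>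
     verts P1 \<union> verts P2 = verts P \<and>
     (\<forall>v\<in>verts P1 \<inter> verts P2. v \<in> anchors P1 \<and> v \<in> anchors P2) \<and>
     (\<forall>v\<in>anchors P. \<forall>Q\<in>{P1, P2}. v \<in> verts Q \<longrightarrow> v \<in> anchors Q) \<and>
     \<not> (\<exists>u v. (consecutive (verts P) u v \<or> consecutive (verts P) v u) \<and>
              u \<in> verts P1 - verts P2 \<and> v \<in> verts P2 - verts P1)"

text \<open>The vertices of the old pattern keep their anchor status; the new vertex may or may not
  be an anchor.\<close>

definition is_vertex_creation :: "'a::linorder apattern \<Rightarrow> 'a apattern \<Rightarrow> bool" where
  "is_vertex_creation P P' \<longleftrightarrow>
     (\<exists>x. x \<notin> verts P' \<and> verts P = insert x (verts P') \<and>
          mand P = mand P' \<and> forb P = forb P' \<and> anchors P - {x} = anchors P' \<and>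
          (\<forall>u. consecutive (verts P) u x \<or> consecutive (verts P) x u \<longrightarrow> u \<in> anchors P'))"

definition is_edge_creation :: "'a apattern \<Rightarrow> bool" where
  "is_edge_creation P \<longleftrightarrow>
     (\<exists>u v. u \<noteq> v \<and> verts P = {u, v} \<and>
        (mand P = {{u, v}} \<and> forb P = {} \<or> mand P = {} \<and> forb P = {{u, v}}))"

datatype 'a mtree =
    Leaf "'a apattern"
  | Create "'a apattern" "'a mtree"
  | Merge "'a apattern" "'a mtree" "'a mtree"

fun label :: "'a mtree \<Rightarrow> 'a apattern" where
  "label (Leaf P) = P"
| "label (Create P t) = P"
| "label (Merge P t1 t2) = P"

fun labels :: "'a mtree \<Rightarrow> 'a apattern set" where
  "labels (Leaf P) = {P}"
| "labels (Create P t) = insert P (labels t)"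
| "labels (Merge P t1 t2) = insert P (labels t1 \<union> labels t2)"

fun wf_mtree :: "'a::linorder mtree \<Rightarrow> bool" where
  "wf_mtree (Leaf P) \<longleftrightarrow> wf_apattern P \<and> is_edge_creation P"
| "wf_mtree (Create P t) \<longleftrightarrow> wf_apattern P \<and> is_vertex_creation P (label t) \<and> wf_mtree t"
| "wf_mtree (Merge P t1 t2) \<longleftrightarrow>
     wf_apattern P \<and> is_merge P (label t1) (label t2) \<and> wf_mtree t1 \<and> wf_mtree t2"

definition merge_tree_for :: "'a::linorder pattern \<Rightarrow> 'a mtree \<Rightarrow> bool" where
  "merge_tree_for P t \<longleftrightarrow> wf_mtree t \<and> pattern.truncate (label t) = P"

definition width :: "'a mtree \<Rightarrow> nat" where
  "width t = Max ((\<lambda>Q. card (anchors Q)) ` labels t)"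

text \<open>A pattern without edges has no merge tree, hence no merge-width; this is why the notion
  is a relation.\<close>

definition has_merge_width :: "'a::linorder pattern \<Rightarrow> nat \<Rightarrow> bool" where
  "has_merge_width P p \<longleftrightarrow>
     (\<exists>t. merge_tree_for P t \<and> width t = p) \<and> (\<forall>t. merge_tree_for P t \<longrightarrow> p \<le> width t)"


section \<open>Word RAM\<close>

text \<open>Unit-cost word RAM with word size \<open>w\<close>: registers and memory cells hold numbers below
  \<open>2 ^ w\<close>. A program uses finitely many registers and finitely many random-access arrays,
  addressed by words. Conditions test a register for being nonzero.\<close>

datatype binop = Add | Sub | Mul | Div | Mod | And | Or | Xor | Shl | Shr | Less | Eq

fun binop_val :: "nat \<Rightarrow> binop \<Rightarrow> nat \<Rightarrow> nat \<Rightarrow> nat" where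
  "binop_val w Add x y = (x + y) mod 2 ^ w"
| "binop_val w Sub x y = (x + (2 ^ w - y)) mod 2 ^ w"
| "binop_val w Mul x y = (x * y) mod 2 ^ w"
| "binop_val w Div x y = (x div y) mod 2 ^ w"
| "binop_val w Mod x y = (x mod y) mod 2 ^ w"
| "binop_val w And x y = (and x y) mod 2 ^ w"
| "binop_val w Or x y = (or x y) mod 2 ^ w"
| "binop_val w Xor x y = (xor x y) mod 2 ^ w"
| "binop_val w Shl x y = (x * 2 ^ y) mod 2 ^ w"
| "binop_val w Shr x y = (x div 2 ^ y) mod 2 ^ w"
| "binop_val w Less x y = (if x < y then 1 else 0) mod 2 ^ w"
| "binop_val w Eq x y = (if x = y then 1 else 0) mod 2 ^ w"

datatype com =
    Skip
  | Const nat nat          \<comment> \<open>register, constant\<close>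
  | Op binop nat nat nat   \<comment> \<open>target register, operand registers\<close>
  | Load nat nat nat       \<comment> \<open>target register, array, address register\<close>
  | Store nat nat nat      \<comment> \<open>array, address register, source register\<close>
  | Seq com com
  | If nat com com
  | While nat com

record state =
  regs :: "nat \<Rightarrow> nat"
  mem :: "nat \<Rightarrow> nat \<Rightarrow> nat"

text \<open>\<open>exec w c s t s'\<close>: started in \<open>s\<close>, the program \<open>c\<close> halts in \<open>s'\<close> after \<open>t\<close> steps.\<close>

inductive exec :: "nat \<Rightarrow> com \<Rightarrow> state \<Rightarrow> nat \<Rightarrow> state \<Rightarrow> bool" for w :: nat where
  exec_Skip: "exec w Skip s 1 s"
| exec_Const: "exec w (Const r k) s 1 (s\<lparr>regs := (regs s)(r := k mod 2 ^ w)\<rparr>)"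
| exec_Op: "exec w (Op b r r1 r2) s 1
    (s\<lparr>regs := (regs s)(r := binop_val w b (regs s r1) (regs s r2))\<rparr>)"
| exec_Load: "exec w (Load r a i) s 1 (s\<lparr>regs := (regs s)(r := mem s a (regs s i))\<rparr>)"
| exec_Store: "exec w (Store a i r) s 1
    (s\<lparr>mem := (mem s)(a := (mem s a)(regs s i := regs s r))\<rparr>)"
| exec_Seq: "exec w c1 s t1 s1 \<Longrightarrow> exec w c2 s1 t2 s2 \<Longrightarrow> exec w (Seq c1 c2) s (t1 + t2) s2"
| exec_If_nonzero: "regs s r \<noteq> 0 \<Longrightarrow> exec w c1 s t s' \<Longrightarrow> exec w (If r c1 c2) s (t + 1) s'"
| exec_If_zero: "regs s r = 0 \<Longrightarrow> exec w c2 s t s' \<Longrightarrow> exec w (If r c1 c2) s (t + 1) s'"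
| exec_While_zero: "regs s r = 0 \<Longrightarrow> exec w (While r c) s 1 s"
| exec_While_nonzero: "regs s r \<noteq> 0 \<Longrightarrow> exec w c s t1 s1 \<Longrightarrow> exec w (While r c) s1 t2 s2 \<Longrightarrow>
    exec w (While r c) s (t1 + t2 + 1) s2"

definition word_state :: "nat \<Rightarrow> state \<Rightarrow> bool" where
  "word_state w s \<longleftrightarrow> (\<forall>r. regs s r < 2 ^ w) \<and> (\<forall>a i. mem s a i < 2 ^ w)"

text \<open>A problem is given by relations \<open>inp n w x s\<close> (the state \<open>s\<close> holds the instance \<open>x\<close> of size
  \<open>n\<close>) and \<open>out n x s'\<close> (the state \<open>s'\<close> holds a correct answer). One program has to work for all
  sizes and for all word sizes \<open>w \<ge> k * log 2 (n + 2)\<close>, for some constant \<open>k\<close>, and with a time bound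
  that does not depend on \<open>w\<close>. Registers and cells not fixed by \<open>inp\<close> have arbitrary
  initial contents.\<close>

definition solvable_in_time ::
    "(nat \<Rightarrow> nat \<Rightarrow> 'i \<Rightarrow> state \<Rightarrow> bool) \<Rightarrow> (nat \<Rightarrow> 'i \<Rightarrow> state \<Rightarrow> bool) \<Rightarrow> (nat \<Rightarrow> real) \<Rightarrow> bool" where
  "solvable_in_time inp out f \<longleftrightarrow>
     (\<exists>(c :: com) (k :: nat) (T :: nat \<Rightarrow> nat).
        (\<lambda>n. real (T n)) \<in> O(f) \<and>
        (\<forall>n w x s. (n + 2) ^ k \<le> 2 ^ w \<longrightarrow> word_state w s \<longrightarrow> inp n w x s \<longrightarrow>
           (\<exists>t s'. exec w c s t s' \<and> t \<le> T n \<and> out n x s')))"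


section \<open>The two problems\<close>

text \<open>Matrices have natural number entries and are stored row by row; the entries of the
  factors and of the product have to fit into machine words.\<close>

definition matrix_prod :: "nat \<Rightarrow> (nat \<Rightarrow> nat \<Rightarrow> nat) \<Rightarrow> (nat \<Rightarrow> nat \<Rightarrow> nat) \<Rightarrow> nat \<Rightarrow> nat \<Rightarrow> nat" where
  "matrix_prod n A B i j = (\<Sum>k<n. A i k * B k j)"

definition holds_matrix :: "nat \<Rightarrow> (nat \<Rightarrow> nat \<Rightarrow> nat) \<Rightarrow> (nat \<Rightarrow> nat) \<Rightarrow> bool" where
  "holds_matrix n A m \<longleftrightarrow> (\<forall>i<n. \<forall>j<n. m (i * n + j) = A i j)"

definition matrix_mult_in_time :: "(nat \<Rightarrow> real) \<Rightarrow> bool" where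
  "matrix_mult_in_time = solvable_in_time
     (\<lambda>n w (A, B) s. regs s 0 = n \<and> holds_matrix n A (mem s 0) \<and> holds_matrix n B (mem s 1) \<and>
        (\<forall>i<n. \<forall>j<n. A i j < 2 ^ w \<and> B i j < 2 ^ w \<and> matrix_prod n A B i j < 2 ^ w))
     (\<lambda>n (A, B) s'. holds_matrix n (matrix_prod n A B) (mem s' 2))"

text \<open>Adjacency lists, each in increasing order of the vertices, are stored one after the other
  in array 1; array 0 holds their starting positions and, at index \<open>n\<close>, their total length.\<close>

definition neighbours :: "nat set set \<Rightarrow> nat \<Rightarrow> nat set" where
  "neighbours E v = {u. {u, v} \<in> E}"

definition list_start :: "nat set set \<Rightarrow> nat \<Rightarrow> nat" where
  "list_start E i = (\<Sum>v<i. card (neighbours E v))"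

definition holds_adjacency_lists :: "nat \<Rightarrow> nat set set \<Rightarrow> state \<Rightarrow> bool" where
  "holds_adjacency_lists n E s \<longleftrightarrow>
     regs s 0 = n \<and> (\<forall>i\<le>n. mem s 0 i = list_start E i) \<and>
     (\<forall>v<n. \<forall>j<card (neighbours E v).
        mem s 1 (list_start E v + j) = sorted_list_of_set (neighbours E v) ! j)"

definition pattern_detection_in_time :: "'a::linorder pattern \<Rightarrow> (nat \<Rightarrow> real) \<Rightarrow> bool" where
  "pattern_detection_in_time P = solvable_in_time
     (\<lambda>n w E s. ordered_graph n E \<and> holds_adjacency_lists n E s)
     (\<lambda>n E s'. regs s' 0 = (if contains_pattern n E P then 1 else 0))"

end

theory Submission
  imports Defs "HOL-Library.Multiset"
begin

text \<open>For every node of a merge tree one computes the table that tells, for each placement of the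
  anchors, whether it extends to an embedding of the label. At a merge, the shared vertices are
  exactly the shared anchors, and condition (e) makes compatible embeddings of both sides glue. So
  once the private anchors that are dropped have been projected away, the table of a merge is the
  Boolean product, over the dropped shared anchors, of the tables of the children. With the kept
  shared anchors fixed, this is a product of matrices of dimensions \<open>n ^ x\<close>, \<open>n ^ z\<close>, \<open>n ^ y\<close>; it is
  cut into square products of size \<open>n ^ min x (min y z)\<close>, and since any two of \<open>x\<close>, \<open>y\<close>, \<open>z\<close>
  together with the number of fixed anchors are at most \<open>p\<close>, the total time is
  \<open>O(n powr (\<omega> * p / 2))\<close>. This uses \<open>\<omega> \<ge> 2\<close>, which holds because \<open>n\<^sup>2\<close> output cells have to be
  written. For \<open>p \<le> 1\<close> there is no time to build the adjacency matrix. For \<open>p = 1\<close> every leaf has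
  exactly one anchor, and sorted adjacency lists tell in constant time whether a vertex has a
  (non-)neighbour on a given side; for \<open>p = 0\<close> the tree is a single leaf and the total length of the
  lists decides.\<close>


section \<open>Programs\<close>

text \<open>Only square products are available, and the program that computes them is a black box
  using unknown registers and arrays. All other data therefore lives above a bound \<open>D\<close>
  on these, and the coordinates by which the three dimensions exceed their minimum are enumerated by
  ordinary loops. The exponent inequality has three inputs: together with the fixed anchors, rows
  and summation indices are anchors of one child, summation indices and columns are anchors of the
  other, and rows and columns are anchors of the merge. Products are taken over the natural numbers:
  an entry counts common extensions, fits into a word, and is nonzero iff the Boolean product is
  true. As memory is initially arbitrary, a table is cleared first and afterwards receives only
  ones, so that a loop computes an existential quantifier. For p = 1 the exponent may be as small as
  1 while the lists may have quadratic total length, so not even the whole input may be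
  read.\<close>

fun wregs :: "com \<Rightarrow> nat set" where
  "wregs (Const r k) = {r}"
| "wregs (Op b r r1 r2) = {r}"
| "wregs (Load r a i) = {r}"
| "wregs (Seq c1 c2) = wregs c1 \<union> wregs c2"
| "wregs (If r c1 c2) = wregs c1 \<union> wregs c2"
| "wregs (While r c) = wregs c"
| "wregs _ = {}"

fun warrs :: "com \<Rightarrow> nat set" where
  "warrs (Store a i r) = {a}"
| "warrs (Seq c1 c2) = warrs c1 \<union> warrs c2"
| "warrs (If r c1 c2) = warrs c1 \<union> warrs c2"
| "warrs (While r c) = warrs c"
| "warrs _ = {}"

lemma finite_wregs: "finite (wregs c)" and finite_warrs: "finite (warrs c)"
  by (induction c) auto

text \<open>Nothing is known about the given multiplication program except what it computes, so the
  syntactic sets of written registers and arrays are the only source for what survives a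
  call.\<close>

lemma exec_frame:
  "exec w c s t s' \<Longrightarrow>
     (\<forall>r. r \<notin> wregs c \<longrightarrow> regs s' r = regs s r) \<and> (\<forall>a. a \<notin> warrs c \<longrightarrow> mem s' a = mem s a)"
  by (induction rule: exec.induct) auto

lemma binop_val_less: "binop_val w b x y < 2 ^ w"
  by (cases b) auto

lemma exec_word_state: "exec w c s t s' \<Longrightarrow> word_state w s \<Longrightarrow> word_state w s'"
  by (induction rule: exec.induct) (auto simp: word_state_def binop_val_less)

text \<open>A total-correctness triple with a fixed start state. The time is an upper bound, so that
  branches of different cost share one \<open>t\<close> and bounds add up along
  \<open>Seq\<close>.\<close>

definition runs :: "nat \<Rightarrow> com \<Rightarrow> state \<Rightarrow> nat \<Rightarrow> (state \<Rightarrow> bool) \<Rightarrow> bool" where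
  "runs w c s t Q \<longleftrightarrow> (\<exists>t' s'. exec w c s t' s' \<and> t' \<le> t \<and> Q s')"

lemma runs_Seq:
  assumes "runs w c1 s t1 (\<lambda>s1. runs w c2 s1 t2 Q)"
  shows "runs w (Seq c1 c2) s (t1 + t2) Q"
proof -
  obtain t1' s1 t2' s2 where "exec w c1 s t1' s1" "t1' \<le> t1" "exec w c2 s1 t2' s2" "t2' \<le> t2" "Q s2"
    using assms unfolding runs_def by blast
  then show ?thesis
    unfolding runs_def using exec_Seq[of w c1 s t1' s1 c2 t2' s2] add_mono by blast
qed

lemma runs_mono:
  assumes "runs w c s t Q" "t \<le> t'" "\<And>s'. Q s' \<Longrightarrow> Q' s'"
  shows "runs w c s t' Q'"
  using assms unfolding runs_def by (meson le_trans)

lemma runs_frame: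
  assumes "runs w c s t Q" "word_state w s"
    and "\<And>s'. Q s' \<Longrightarrow> word_state w s' \<Longrightarrow> (\<And>r. r \<notin> wregs c \<Longrightarrow> regs s' r = regs s r) \<Longrightarrow>
      (\<And>a. a \<notin> warrs c \<Longrightarrow> mem s' a = mem s a) \<Longrightarrow> Q' s'"
  shows "runs w c s t Q'"
proof -
  obtain t' s' where e: "exec w c s t' s'" "t' \<le> t" "Q s'"
    using assms(1) unfolding runs_def by blast
  then have "Q' s'"
    using assms(3)[OF e(3) exec_word_state[OF e(1) assms(2)]] exec_frame[OF e(1)] by blast
  then show ?thesis
    using e unfolding runs_def by blast
qed

text \<open>The frame and the word bound of the first program are handed to the second, so that
  postconditions need to mention only the cells that matter.\<close>

lemma runs_SeqI:
  assumes "runs w c1 s t1 Q1" "word_state w s"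
    and "\<And>s'. Q1 s' \<Longrightarrow> word_state w s' \<Longrightarrow> (\<And>r. r \<notin> wregs c1 \<Longrightarrow> regs s' r = regs s r) \<Longrightarrow>
      (\<And>a. a \<notin> warrs c1 \<Longrightarrow> mem s' a = mem s a) \<Longrightarrow> runs w c2 s' t2 Q"
  shows "runs w (Seq c1 c2) s (t1 + t2) Q"
  by (rule runs_Seq, rule runs_frame[OF assms(1,2)]) (rule assms(3))


subsection \<open>Loop-free programs\<close>

fun loopfree :: "com \<Rightarrow> bool" where
  "loopfree (Seq c1 c2) \<longleftrightarrow> loopfree c1 \<and> loopfree c2"
| "loopfree (If r c1 c2) \<longleftrightarrow> loopfree c1 \<and> loopfree c2"
| "loopfree (While r c) \<longleftrightarrow> False"
| "loopfree _ \<longleftrightarrow> True"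

fun cost :: "com \<Rightarrow> nat" where
  "cost (Seq c1 c2) = cost c1 + cost c2"
| "cost (If r c1 c2) = max (cost c1) (cost c2) + 1"
| "cost _ = 1"

text \<open>Loop-free programs are evaluated as functions, which lets the simplifier run them
  symbolically. The default equation also catches \<open>While\<close>, which
  \<open>loopfree\<close> excludes.\<close>

fun sl :: "nat \<Rightarrow> com \<Rightarrow> state \<Rightarrow> state" where
  "sl w (Const r k) s = s\<lparr>regs := (regs s)(r := k mod 2 ^ w)\<rparr>"
| "sl w (Op b r r1 r2) s = s\<lparr>regs := (regs s)(r := binop_val w b (regs s r1) (regs s r2))\<rparr>"
| "sl w (Load r a i) s = s\<lparr>regs := (regs s)(r := mem s a (regs s i))\<rparr>"
| "sl w (Store a i r) s = s\<lparr>mem := (mem s)(a := (mem s a)(regs s i := regs s r))\<rparr>"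
| "sl w (Seq c1 c2) s = sl w c2 (sl w c1 s)"
| "sl w (If r c1 c2) s = (if regs s r \<noteq> 0 then sl w c1 s else sl w c2 s)"
| "sl w _ s = s"

lemma exec_sl: "loopfree c \<Longrightarrow> \<exists>t. exec w c s t (sl w c s) \<and> t \<le> cost c"
proof (induction c arbitrary: s)
  case (Seq c1 c2)
  obtain t1 t2 where "exec w c1 s t1 (sl w c1 s)" "t1 \<le> cost c1"
    "exec w c2 (sl w c1 s) t2 (sl w c2 (sl w c1 s))" "t2 \<le> cost c2"
    using Seq.IH(1)[of s] Seq.IH(2)[of "sl w c1 s"] Seq.prems by auto
  then show ?case
    by (intro exI[of _ "t1 + t2"]) (simp add: exec_Seq)
next
  case (If r c1 c2)
  show ?case
  proof (cases "regs s r = 0")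
    case True
    obtain t where "exec w c2 s t (sl w c2 s)" "t \<le> cost c2"
      using If.IH(2)[of s] If.prems by auto
    then show ?thesis
      using True exec_If_zero[OF True] by (intro exI[of _ "t + 1"]) simp
  next
    case False
    obtain t where "exec w c1 s t (sl w c1 s)" "t \<le> cost c1"
      using If.IH(1)[of s] If.prems by auto
    then show ?thesis
      using False exec_If_nonzero[OF False] by (intro exI[of _ "t + 1"]) simp
  qed
qed (use exec.intros(1-5) in \<open>force intro!: exI[of _ 1]\<close>)+

lemma runs_sl: "loopfree c \<Longrightarrow> Q (sl w c s) \<Longrightarrow> runs w c s (cost c) Q"
  unfolding runs_def using exec_sl by blast

lemma sl_regs: "loopfree c \<Longrightarrow> r \<notin> wregs c \<Longrightarrow> regs (sl w c s) r = regs s r"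
  and sl_mem: "loopfree c \<Longrightarrow> a \<notin> warrs c \<Longrightarrow> mem (sl w c s) a = mem s a"
  using exec_frame exec_sl by metis+


subsection \<open>Matrix multiplication needs quadratic time\<close>

text \<open>Every step changes at most one memory cell, and the output cells may all hold wrong values
  initially.\<close>

lemma exec_changed_cells:
  "exec w c s t s' \<Longrightarrow>
     finite {(a, i). mem s' a i \<noteq> mem s a i} \<and> card {(a, i). mem s' a i \<noteq> mem s a i} \<le> t"
proof (induction rule: exec.induct)
  case (exec_Store a i r s)
  have "{(a', i'). mem (s\<lparr>mem := (mem s)(a := (mem s a)(regs s i := regs s r))\<rparr>) a' i' \<noteq> mem s a' i'}
      \<subseteq> {(a, regs s i)}"
    by (auto split: if_splits)
  from finite_subset[OF this] card_mono[OF _ this] show ?case by simp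
next
  case (exec_Seq c1 s t1 s1 c2 t2 s2)
  have "{(a, i). mem s2 a i \<noteq> mem s a i} \<subseteq>
      {(a, i). mem s1 a i \<noteq> mem s a i} \<union> {(a, i). mem s2 a i \<noteq> mem s1 a i}" (is "?A \<subseteq> ?B \<union> ?C")
    by auto
  moreover have "finite (?B \<union> ?C)" using exec_Seq by auto
  ultimately have "finite ?A" "card ?A \<le> card (?B \<union> ?C)"
    by (auto intro: finite_subset card_mono)
  then show ?case
    using card_Un_le[of ?B ?C] exec_Seq by linarith
next
  case (exec_While_nonzero s r c t1 s1 t2 s2)
  have "{(a, i). mem s2 a i \<noteq> mem s a i} \<subseteq>
      {(a, i). mem s1 a i \<noteq> mem s a i} \<union> {(a, i). mem s2 a i \<noteq> mem s1 a i}" (is "?A \<subseteq> ?B \<union> ?C")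
    by auto
  moreover have "finite (?B \<union> ?C)" using exec_While_nonzero by auto
  ultimately have "finite ?A" "card ?A \<le> card (?B \<union> ?C)"
    by (auto intro: finite_subset card_mono)
  then show ?case
    using card_Un_le[of ?B ?C] exec_While_nonzero by linarith
qed auto

definition multiplies :: "com \<Rightarrow> nat \<Rightarrow> (nat \<Rightarrow> nat) \<Rightarrow> bool" where
  "multiplies c k T \<longleftrightarrow> (\<forall>n w A B s. (n + 2) ^ k \<le> 2 ^ w \<longrightarrow> word_state w s \<longrightarrow> regs s 0 = n \<longrightarrow>
     holds_matrix n A (mem s 0) \<longrightarrow> holds_matrix n B (mem s 1) \<longrightarrow>
     (\<forall>i<n. \<forall>j<n. A i j < 2 ^ w \<and> B i j < 2 ^ w \<and> matrix_prod n A B i j < 2 ^ w) \<longrightarrow>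
     runs w c s (T n) (\<lambda>s'. holds_matrix n (matrix_prod n A B) (mem s' 2)))"

lemma multipliesD:
  assumes "multiplies c k T" "(n + 2) ^ k \<le> 2 ^ w" "word_state w s" "regs s 0 = n"
    and "holds_matrix n A (mem s 0)" "holds_matrix n B (mem s 1)"
    and "\<forall>i<n. \<forall>j<n. A i j < 2 ^ w \<and> B i j < 2 ^ w \<and> matrix_prod n A B i j < 2 ^ w"
  shows "runs w c s (T n) (\<lambda>s'. holds_matrix n (matrix_prod n A B) (mem s' 2))"
  using assms(1)[unfolded multiplies_def, THEN spec[of _ n], THEN spec[of _ w], THEN spec[of _ A],
      THEN spec[of _ B], THEN spec[of _ s]] assms(2-) by (elim impE)

lemma matrix_mult_program:
  assumes "matrix_mult_in_time f"
  obtains c k T where "(\<lambda>n. real (T n)) \<in> O(f)" "multiplies c k T"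
proof -
  obtain c k T where T: "(\<lambda>n. real (T n)) \<in> O(f)"
    and run: "\<forall>n w x s. (n + 2) ^ k \<le> 2 ^ w \<longrightarrow> word_state w s \<longrightarrow>
      (case x of (A, B) \<Rightarrow> \<lambda>s. regs s 0 = n \<and> holds_matrix n A (mem s 0) \<and> holds_matrix n B (mem s 1) \<and>
        (\<forall>i<n. \<forall>j<n. A i j < 2 ^ w \<and> B i j < 2 ^ w \<and> matrix_prod n A B i j < 2 ^ w)) s \<longrightarrow>
      (\<exists>t s'. exec w c s t s' \<and> t \<le> T n \<and> (case x of (A, B) \<Rightarrow> \<lambda>s'. holds_matrix n (matrix_prod n A B) (mem s' 2)) s')"
    using assms unfolding matrix_mult_in_time_def solvable_in_time_def by blast
  have "multiplies c k T"
    unfolding multiplies_def runs_def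
  proof (intro allI impI)
    fix n w A B s
    assume "(n + 2) ^ k \<le> 2 ^ w" "word_state w s" "regs s 0 = n"
      "holds_matrix n A (mem s 0)" "holds_matrix n B (mem s 1)"
      "\<forall>i<n. \<forall>j<n. A i j < 2 ^ w \<and> B i j < 2 ^ w \<and> matrix_prod n A B i j < 2 ^ w"
    then show "\<exists>t s'. exec w c s t s' \<and> t \<le> T n \<and> holds_matrix n (matrix_prod n A B) (mem s' 2)"
      using run[THEN spec[of _ n], THEN spec[of _ w], THEN spec[of _ "(A, B)"], THEN spec[of _ s]]
      by (simp only: prod.case)
  qed
  with T show thesis by (rule that)
qed

lemma matrix_mult_exponent_ge_2:
  assumes "matrix_mult_in_time (\<lambda>n. real n powr \<omega>)"
  shows "\<omega> \<ge> 2"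
proof -
  obtain c k T where T: "(\<lambda>n. real (T n)) \<in> O(\<lambda>n. real n powr \<omega>)"
    and run: "multiplies c k T"
    by (rule matrix_mult_program[OF assms])
  have T_ge: "n ^ 2 \<le> T n" for n
  proof -
    \<comment> \<open>As x < 2 ^ x, this word size meets all size conditions at once.\<close>
    define w where "w = (n + 2) ^ k + n + 1"
    have w: "w < 2 ^ w" by (rule less_exp)
    then have w': "(n + 2) ^ k \<le> 2 ^ w" "n < 2 ^ w" "(1::nat) < 2 ^ w"
      unfolding w_def by linarith+
    \<comment> \<open>Both factors are zero while array 2 is full of ones, so each of the n * n
      output cells has to be changed.\<close>
    define s where "s = \<lparr>regs = (\<lambda>r. if r = 0 then n else 0), mem = (\<lambda>a i. if a = 2 then 1 else (0::nat))\<rparr>"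
    have "word_state w s" using w' by (auto simp: s_def word_state_def)
    moreover have "regs s 0 = n" by (simp add: s_def)
    ultimately obtain t s' where t: "exec w c s t s'" "t \<le> T n"
      and out: "holds_matrix n (matrix_prod n (\<lambda>_ _. 0) (\<lambda>_ _. 0)) (mem s' 2)"
      using multipliesD[OF run w'(1), of s "\<lambda>_ _. 0" "\<lambda>_ _. 0"]
      unfolding runs_def by (auto simp: holds_matrix_def s_def matrix_prod_def)
    have "Pair 2 ` {..<n ^ 2} \<subseteq> {(a, i). mem s' a i \<noteq> mem s a i}"
    proof clarsimp
      fix i assume i: "i < n\<^sup>2" "mem s' 2 i = mem s 2 i"
      then have n: "n > 0" by (cases n) auto
      have "i div n < n" using i by (simp add: less_mult_imp_div_less power2_eq_square)
      moreover have "i mod n < n" using n by simp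
      ultimately have "mem s' 2 (i div n * n + i mod n) =
          matrix_prod n (\<lambda>_ _. 0) (\<lambda>_ _. 0) (i div n) (i mod n)"
        using out unfolding holds_matrix_def by blast
      then show False using i(2) by (simp add: s_def matrix_prod_def)
    qed
    from card_mono[OF _ this] exec_changed_cells[OF t(1)]
    have "card (Pair (2::nat) ` {..<n ^ 2}) \<le> t" by auto
    then show ?thesis using t(2) by (simp add: card_image inj_on_def)
  qed
  have "(\<lambda>n. real n powr 2) \<in> O(\<lambda>n. real (T n))"
    using T_ge by (intro landau_o.bigI[of 1] always_eventually)
      (auto simp flip: of_nat_power simp: powr_numeral)
  from landau_o.big_trans[OF this T] have *: "(\<lambda>n. real n powr 2) \<in> O(\<lambda>n. real n powr \<omega>)" .
  show ?thesis
  proof (rule ccontr)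
    assume "\<not> 2 \<le> \<omega>"
    \<comment> \<open>With a smaller exponent the square would be of smaller order than itself,
      hence eventually zero.\<close>
    then have "(\<lambda>n. real n powr \<omega>) \<in> o(\<lambda>n. real n powr 2)"
      by (intro powr_smallo_iff[THEN iffD2]) (auto intro: filterlim_real_sequentially)
    from landau_o.big_small_trans[OF * this] have "(\<lambda>n. real n powr 2) \<in> o(\<lambda>n. real n powr 2)" .
    then have "eventually (\<lambda>n. real n powr 2 = 0) at_top"
      by (simp add: landau_o.small_refl_iff)
    then obtain N where "\<And>n. n \<ge> N \<Longrightarrow> real n powr 2 = 0"
      unfolding eventually_at_top_linorder by blast
    from this[of "Suc N"] show False by simp
  qed
qed


subsection \<open>Indices of assignments\<close>

text \<open>Digits in base \<open>n\<close>, the most significant first. With this order the table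
  of \<open>X @ Z\<close> is, as it stands, the row-major layout of a matrix with rows indexed by
  \<open>X\<close> and columns by \<open>Z\<close>, by \<open>idx_append\<close>.\<close>

primrec idx :: "nat \<Rightarrow> ('v \<Rightarrow> nat) \<Rightarrow> 'v list \<Rightarrow> nat" where
  "idx n \<sigma> [] = 0"
| "idx n \<sigma> (v # L) = \<sigma> v * n ^ length L + idx n \<sigma> L"

lemma idx_append: "idx n \<sigma> (L @ L') = idx n \<sigma> L * n ^ length L' + idx n \<sigma> L'"
  by (induction L) (auto simp: power_add algebra_simps)

lemma idx_cong: "(\<And>v. v \<in> set L \<Longrightarrow> \<sigma> v = \<tau> v) \<Longrightarrow> idx n \<sigma> L = idx n \<tau> L"
  by (induction L) auto

lemma idx_less: "(\<And>v. v \<in> set L \<Longrightarrow> \<sigma> v < n) \<Longrightarrow> idx n \<sigma> L < n ^ length L"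
proof (induction L)
  case (Cons v L)
  then have "idx n \<sigma> L < n ^ length L" "\<sigma> v + 1 \<le> n" by (auto simp: Suc_le_eq)
  moreover from this(2) have "(\<sigma> v + 1) * n ^ length L \<le> n * n ^ length L" by (rule mult_le_mono1)
  ultimately show ?case by (simp add: algebra_simps)
qed simp

lemma digits_inject:
  assumes "x * m + i = y * m + j" "i < m" "j < (m::nat)"
  shows "x = y" "i = j"
proof -
  have "(x * m + i) div m = x" using assms(2) by simp
  moreover have "(y * m + j) div m = y" using assms(3) by simp
  ultimately show "x = y" using assms(1) by simp
  then show "i = j" using assms by simp
qed

lemma idx_inject:
  assumes "idx n \<sigma> L = idx n \<tau> L" "\<And>v. v \<in> set L \<Longrightarrow> \<sigma> v < n" "\<And>v. v \<in> set L \<Longrightarrow> \<tau> v < n"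
    and "v \<in> set L"
  shows "\<sigma> v = \<tau> v"
  using assms
proof (induction L)
  case (Cons u L)
  have *: "idx n \<sigma> L < n ^ length L" "idx n \<tau> L < n ^ length L"
    using Cons.prems by (auto intro!: idx_less)
  have "\<sigma> u = \<tau> u" "idx n \<sigma> L = idx n \<tau> L"
    using digits_inject[OF _ *] Cons.prems(1) by auto
  then show ?case using Cons by auto
qed simp

text \<open>Division by the weight of the leading digit. The free background \<open>\<rho>\<close>
  allows assignments to disjoint lists to be built one on top of the other.\<close>

lemma idx_surj:
  assumes "distinct L" "i < n ^ length L"
  obtains \<sigma> where "\<And>v. v \<in> set L \<Longrightarrow> \<sigma> v < n" "\<And>v. v \<notin> set L \<Longrightarrow> \<sigma> v = \<rho> v" "idx n \<sigma> L = i"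
  using assms
proof (induction L arbitrary: i thesis)
  case (Cons u L)
  let ?m = "n ^ length L"
  have "?m > 0" using Cons.prems by (cases "n = 0") auto
  then have "i mod ?m < ?m" by simp
  then obtain \<sigma> where \<sigma>: "\<And>v. v \<in> set L \<Longrightarrow> \<sigma> v < n" "\<And>v. v \<notin> set L \<Longrightarrow> \<sigma> v = \<rho> v"
    "idx n \<sigma> L = i mod ?m"
    using Cons.IH[of "i mod ?m"] Cons.prems by auto
  have "idx n (\<sigma>(u := i div ?m)) L = idx n \<sigma> L"
    using Cons.prems(2) by (intro idx_cong) auto
  then have "idx n (\<sigma>(u := i div ?m)) (u # L) = i"
    by (simp only: idx.simps fun_upd_same \<sigma>(3) div_mult_mod_eq)
  moreover have "i div ?m < n"
    using Cons.prems(3) by (simp add: less_mult_imp_div_less)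
  ultimately show ?case
    using \<sigma>(1,2) by (intro Cons.prems(1)[of "\<sigma>(u := i div ?m)"]) (auto simp flip: fun_upd_def)
qed auto

text \<open>The assignments that a nest of loops over \<open>L\<close> runs through when the other
  registers are given by \<open>\<sigma>\<close>.\<close>

definition ext :: "nat \<Rightarrow> 'v list \<Rightarrow> ('v \<Rightarrow> nat) \<Rightarrow> ('v \<Rightarrow> nat) set" where
  "ext n L \<sigma> = {\<tau>. (\<forall>v\<in>set L. \<tau> v < n) \<and> (\<forall>v. v \<notin> set L \<longrightarrow> \<tau> v = \<sigma> v)}"

lemma ext_Nil: "ext n [] \<sigma> = {\<sigma>}"
  by (auto simp: ext_def)

lemma ext_Cons:
  assumes "v \<notin> set L"
  shows "ext n (v # L) \<sigma> = (\<Union>x<n. ext n L (\<sigma>(v := x)))"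
proof (intro equalityI subsetI)
  fix \<tau> assume "\<tau> \<in> ext n (v # L) \<sigma>"
  then show "\<tau> \<in> (\<Union>x<n. ext n L (\<sigma>(v := x)))"
    using assms by (intro UN_I[of "\<tau> v"]) (auto simp: ext_def)
next
  fix \<tau> assume "\<tau> \<in> (\<Union>x<n. ext n L (\<sigma>(v := x)))"
  then show "\<tau> \<in> ext n (v # L) \<sigma>"
    using assms by (auto simp: ext_def split: if_splits)
qed


subsection \<open>Loops over all assignments\<close>

text \<open>The registers below \<open>D\<close> belong to the matrix multiplication program. Register \<open>D\<close> holds
  the number of vertices, the next ones are auxiliary, and those from \<open>D + 8\<close> on hold the
  values of assignments.\<close>

locale free_registers =
  fixes D :: nat
begin

abbreviation rn where "rn \<equiv> D"
abbreviation rl where "rl \<equiv> D + 1"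
abbreviation ro where "ro \<equiv> D + 2"
abbreviation ri where "ri \<equiv> D + 3"
abbreviation rc where "rc \<equiv> D + 4"
abbreviation rt where "rt \<equiv> D + 5"
abbreviation ru where "ru \<equiv> D + 6"

definition For :: "nat \<Rightarrow> com \<Rightarrow> com" where
  "For v c = Seq (Seq (Const v 0) (Op Less rl v rn))
     (While rl (Seq c (Seq (Const ro 1) (Seq (Op Add v v ro) (Op Less rl v rn)))))"

lemma wregs_For: "wregs (For v c) = {v, rl, ro} \<union> wregs c"
  and warrs_For: "warrs (For v c) = warrs c"
  by (auto simp: For_def)

text \<open>\<open>S \<sigma>\<close> is the set of cells of array \<open>b\<close> that are overwritten with \<open>d\<close> when the
  registers in \<open>U\<close>, the variables of enclosing loops, are given by \<open>\<sigma>\<close>. The arrays in \<open>K\<close> are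
  read-only, with contents \<open>M\<close>.\<close>

definition acc :: "nat \<Rightarrow> nat \<Rightarrow> nat set \<Rightarrow> (nat \<Rightarrow> nat \<Rightarrow> nat) \<Rightarrow> nat \<Rightarrow> nat \<Rightarrow> nat set \<Rightarrow> com \<Rightarrow>
    ((nat \<Rightarrow> nat) \<Rightarrow> nat set) \<Rightarrow> nat \<Rightarrow> bool" where
  "acc w n K M b d U c S t \<longleftrightarrow>
     (\<forall>\<sigma> s. word_state w s \<longrightarrow> regs s rn = n \<longrightarrow> (\<forall>a\<in>K. mem s a = M a) \<longrightarrow>
        (\<forall>u\<in>U. regs s u = \<sigma> u \<and> \<sigma> u < n) \<longrightarrow>
        runs w c s t (\<lambda>s'. mem s' b = (\<lambda>i. if i \<in> S \<sigma> then d else mem s b i)))"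

text \<open>Induction on the number \<open>j\<close> of values of the loop variable still to come.
  Because every overwritten cell receives the same constant \<open>d\<close>, the effects of the
  rounds combine to a union, regardless of order and repetition.\<close>

lemma runs_For_aux:
  assumes c: "acc w n K M b d (insert v U) c S t"
    and v: "v \<notin> wregs c" "v \<notin> {rn, rl, ro}" "v \<notin> U"
    and rn: "rn \<notin> wregs c"
    and U: "U \<inter> wregs c = {}" "U \<inter> {rn, rl, ro} = {}"
    and K: "K \<inter> warrs c = {}"
    and n: "n < 2 ^ w" "1 < (2 :: nat) ^ w"
  shows "k + j = n \<Longrightarrow> word_state w s \<Longrightarrow> regs s rn = n \<Longrightarrow> regs s v = k \<Longrightarrow>
    regs s rl = (if k < n then 1 else 0) \<Longrightarrow> (\<forall>a\<in>K. mem s a = M a) \<Longrightarrow>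
    (\<forall>u\<in>U. regs s u = \<sigma> u \<and> \<sigma> u < n) \<Longrightarrow>
    runs w (While rl (Seq c (Seq (Const ro 1) (Seq (Op Add v v ro) (Op Less rl v rn))))) s
      (j * (t + 4) + 1)
      (\<lambda>s'. mem s' b = (\<lambda>i. if i \<in> (\<Union>x\<in>{k..<n}. S (\<sigma>(v := x))) then d else mem s b i))"
proof (induction j arbitrary: k s)
  case 0
  then show ?case
    unfolding runs_def using exec_While_zero[of s rl w] by (intro exI[of _ 1] exI[of _ s]) auto
next
  case (Suc j)
  let ?W = "Seq c (Seq (Const ro 1) (Seq (Op Add v v ro) (Op Less rl v rn)))"
  have k: "k < n" using Suc.prems by linarith
  have "\<forall>u\<in>insert v U. regs s u = (\<sigma>(v := k)) u \<and> (\<sigma>(v := k)) u < n"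
    using Suc.prems(4,7) k v(3) by auto
  then have "runs w c s t (\<lambda>s'. mem s' b = (\<lambda>i. if i \<in> S (\<sigma>(v := k)) then d else mem s b i))"
    using c Suc.prems unfolding acc_def by blast
  then obtain t1 s1 where e1: "exec w c s t1 s1" "t1 \<le> t"
    and m1: "mem s1 b = (\<lambda>i. if i \<in> S (\<sigma>(v := k)) then d else mem s b i)"
    unfolding runs_def by blast
  note f1 = exec_frame[OF e1(1)] exec_word_state[OF e1(1) Suc.prems(2)]
  define s2 where "s2 = sl w (Seq (Const ro 1) (Seq (Op Add v v ro) (Op Less rl v rn))) s1"
  obtain t2 where e2: "exec w (Seq (Const ro 1) (Seq (Op Add v v ro) (Op Less rl v rn))) s1 t2 s2" "t2 \<le> 3"
    using exec_sl[of "Seq (Const ro 1) (Seq (Op Add v v ro) (Op Less rl v rn))" w s1]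
    unfolding s2_def by auto
  have r: "regs s1 v = k" "regs s1 rn = n" "\<forall>u\<in>U. regs s1 u = \<sigma> u"
    using f1(1) v(1) rn U(1) Suc.prems by auto
  \<comment> \<open>The incremented value is at most \<open>n\<close>, which is below 2 ^ w, so
    there is no wrap-around.\<close>
  have r2: "regs s2 v = Suc k" "regs s2 rn = n" "\<forall>u\<in>U. regs s2 u = \<sigma> u"
    "regs s2 rl = (if Suc k < n then 1 else 0)" "mem s2 = mem s1"
    using r v k U n by (auto simp: s2_def)
  have "word_state w s2" using exec_word_state[OF e2(1)] f1(2) by blast
  moreover have "\<forall>a\<in>K. mem s2 a = M a" using r2(5) f1(1) K Suc.prems(6) by auto
  ultimately have "runs w (While rl ?W) s2 (j * (t + 4) + 1)
      (\<lambda>s'. mem s' b = (\<lambda>i. if i \<in> (\<Union>x\<in>{Suc k..<n}. S (\<sigma>(v := x))) then d else mem s2 b i))"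
    using Suc.prems(1,7) r2 by (intro Suc.IH) auto
  then obtain t3 s3 where e3: "exec w (While rl ?W) s2 t3 s3" "t3 \<le> j * (t + 4) + 1"
    and m3: "mem s3 b = (\<lambda>i. if i \<in> (\<Union>x\<in>{Suc k..<n}. S (\<sigma>(v := x))) then d else mem s2 b i)"
    unfolding runs_def by blast
  have "exec w (While rl ?W) s ((t1 + t2) + t3 + 1) s3"
    using Suc.prems(5) k e1 e2 e3 by (intro exec_While_nonzero exec_Seq) auto
  \<comment> \<open>Each round adds three steps for increment and comparison and one for the test of
    \<open>While\<close>; the last summand 1 is the failing test.\<close>
  moreover have "(t1 + t2) + t3 + 1 \<le> Suc j * (t + 4) + 1" using e1 e2 e3 by auto
  moreover have "{k..<n} = insert k {Suc k..<n}" using k by auto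
  then have "mem s3 b = (\<lambda>i. if i \<in> (\<Union>x\<in>{k..<n}. S (\<sigma>(v := x))) then d else mem s b i)"
    using m3 m1 r2(5) by auto
  ultimately show ?case unfolding runs_def by blast
qed

lemma acc_For:
  assumes c: "acc w n K M b d (insert v U) c S t"
    and v: "v \<notin> wregs c" "v \<notin> {rn, rl, ro}" "v \<notin> U"
    and rn: "rn \<notin> wregs c"
    and U: "U \<inter> wregs c = {}" "U \<inter> {rn, rl, ro} = {}"
    and K: "K \<inter> warrs c = {}"
    and n: "n < 2 ^ w" "1 < (2 :: nat) ^ w"
  shows "acc w n K M b d U (For v c) (\<lambda>\<sigma>. \<Union>x<n. S (\<sigma>(v := x))) (n * (t + 4) + 3)"
  unfolding acc_def
proof (intro allI impI)
  fix \<sigma> s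
  assume s: "word_state w s" "regs s rn = n" "\<forall>a\<in>K. mem s a = M a" "\<forall>u\<in>U. regs s u = \<sigma> u \<and> \<sigma> u < n"
  let ?I = "Seq (Const v 0) (Op Less rl v rn)"
  let ?W = "While rl (Seq c (Seq (Const ro 1) (Seq (Op Add v v ro) (Op Less rl v rn))))"
  let ?s = "sl w ?I s"
  have m: "mem ?s = mem s" by simp
  have "word_state w ?s" using exec_word_state exec_sl[of ?I] s(1) by fastforce
  then have "runs w ?W ?s (n * (t + 4) + 1)
      (\<lambda>s'. mem s' b = (\<lambda>i. if i \<in> (\<Union>x\<in>{0..<n}. S (\<sigma>(v := x))) then d else mem ?s b i))"
    using s v U n by (intro runs_For_aux[OF assms]) (auto simp: m)
  then have "runs w ?W ?s (n * (t + 4) + 1)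
      (\<lambda>s'. mem s' b = (\<lambda>i. if i \<in> (\<Union>x<n. S (\<sigma>(v := x))) then d else mem s b i))"
    unfolding m atLeast0LessThan .
  then have "runs w (For v c) s (cost ?I + (n * (t + 4) + 1))
     (\<lambda>s'. mem s' b = (\<lambda>i. if i \<in> (\<Union>x<n. S (\<sigma>(v := x))) then d else mem s b i))"
    unfolding For_def by (intro runs_Seq runs_sl) simp_all
  then show "runs w (For v c) s (n * (t + 4) + 3)
     (\<lambda>s'. mem s' b = (\<lambda>i. if i \<in> (\<Union>x<n. S (\<sigma>(v := x))) then d else mem s b i))"
    by (rule runs_mono) auto
qed

primrec loops :: "nat list \<Rightarrow> com \<Rightarrow> com" where
  "loops [] c = c"
| "loops (v # L) c = For v (loops L c)"

primrec loops_time :: "nat \<Rightarrow> nat \<Rightarrow> nat \<Rightarrow> nat" where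
  "loops_time n 0 t = t"
| "loops_time n (Suc k) t = n * (loops_time n k t + 4) + 3"

lemma wregs_loops: "wregs (loops L c) \<subseteq> set L \<union> {rl, ro} \<union> wregs c"
  by (induction L) (auto simp: wregs_For)

lemma warrs_loops: "warrs (loops L c) = warrs c"
  by (induction L) (auto simp: warrs_For)

lemma acc_loops:
  assumes "acc w n K M b d (set L \<union> U) c S t"
    and "distinct L" "set L \<inter> U = {}"
    and "(set L \<union> U) \<inter> ({rn, rl, ro} \<union> wregs c) = {}" "rn \<notin> wregs c"
    and "K \<inter> warrs c = {}"
    and "n < 2 ^ w" "1 < (2 :: nat) ^ w"
  shows "acc w n K M b d U (loops L c) (\<lambda>\<sigma>. \<Union>\<tau>\<in>ext n L \<sigma>. S \<tau>) (loops_time n (length L) t)"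
  using assms
\<comment> \<open>For the inner loops the outermost variable is one of the fixed registers, so
  \<open>U\<close> grows along the induction.\<close>
proof (induction L arbitrary: U)
  case Nil
  then show ?case by (simp add: ext_Nil)
next
  case (Cons v L)
  have "acc w n K M b d (insert v U) (loops L c) (\<lambda>\<sigma>. \<Union>\<tau>\<in>ext n L \<sigma>. S \<tau>) (loops_time n (length L) t)"
    using Cons.prems by (intro Cons.IH) auto
  then have "acc w n K M b d U (For v (loops L c)) (\<lambda>\<sigma>. \<Union>x<n. (\<Union>\<tau>\<in>ext n L (\<sigma>(v := x)). S \<tau>))
      (n * (loops_time n (length L) t + 4) + 3)"
  proof (rule acc_For)
    show "v \<notin> wregs (loops L c)" "rn \<notin> wregs (loops L c)" "U \<inter> wregs (loops L c) = {}"
      using wregs_loops[of L c] Cons.prems by auto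
  qed (use Cons.prems in \<open>auto simp: warrs_loops\<close>)
  then show ?case using Cons.prems by (simp add: ext_Cons)
qed

lemma acc_sl:
  assumes "loopfree c" "cost c \<le> t"
    and "\<And>\<sigma> s. word_state w s \<Longrightarrow> regs s rn = n \<Longrightarrow> (\<forall>a\<in>K. mem s a = M a) \<Longrightarrow>
      (\<forall>u\<in>U. regs s u = \<sigma> u \<and> \<sigma> u < n) \<Longrightarrow>
      mem (sl w c s) b = (\<lambda>i. if i \<in> S \<sigma> then d else mem s b i)"
  shows "acc w n K M b d U c S t"
  unfolding acc_def
proof (intro allI impI, rule runs_mono[OF runs_sl[OF assms(1)] assms(2)])
  fix \<sigma> s
  assume "word_state w s" "regs s rn = n" "\<forall>a\<in>K. mem s a = M a" "\<forall>u\<in>U. regs s u = \<sigma> u \<and> \<sigma> u < n"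
  then show "mem (sl w c s) b = (\<lambda>i. if i \<in> S \<sigma> then d else mem s b i)" by (rule assms(3))
qed


section \<open>Addressing and filling tables\<close>

primrec horner :: "nat list \<Rightarrow> com" where
  "horner [] = Skip"
| "horner (v # L) = Seq (Op Mul ri ri rn) (Seq (Op Add ri ri v) (horner L))"

definition index :: "nat list \<Rightarrow> com" where
  "index L = Seq (Const ri 0) (horner L)"

text \<open>No intermediate value of the Horner scheme exceeds the final one, so the bound on the
  final value excludes overflow everywhere.\<close>

lemma sl_horner:
  assumes "\<And>v. v \<in> set L \<Longrightarrow> regs s v = \<sigma> v \<and> \<sigma> v < n" "ri \<notin> set L" "regs s rn = n"
    and "regs s ri * n ^ length L + idx n \<sigma> L < 2 ^ w"
  shows "sl w (horner L) s = s\<lparr>regs := (regs s)(ri := regs s ri * n ^ length L + idx n \<sigma> L)\<rparr>"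
  using assms
proof (induction L arbitrary: s)
  case Nil
  then show ?case by simp
next
  case (Cons v L)
  define m where "m = n ^ length L"
  have "n > 0" using Cons.prems(1)[of v] by auto
  then have m: "m \<ge> 1" by (simp add: m_def)
  let ?x = "regs s ri * n + \<sigma> v"
  have b: "?x * m + idx n \<sigma> L < 2 ^ w"
    using Cons.prems(4) by (simp add: m_def algebra_simps)
  moreover have "?x \<le> ?x * m" using m by simp
  ultimately have x: "?x < 2 ^ w" by (meson le_add1 le_less_trans le_trans)
  let ?s = "s\<lparr>regs := (regs s)(ri := ?x)\<rparr>"
  have "sl w (horner (v # L)) s = sl w (horner L) ?s"
    using Cons.prems(1)[of v] Cons.prems(2,3) x by (auto simp: mod_add_left_eq)
  also have "\<dots> = ?s\<lparr>regs := (regs ?s)(ri := regs ?s ri * n ^ length L + idx n \<sigma> L)\<rparr>"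
    using Cons.prems b by (intro Cons.IH) (auto simp: m_def)
  finally show ?case by (simp add: algebra_simps flip: fun_upd_def)
qed

lemma sl_index:
  assumes "\<And>v. v \<in> set L \<Longrightarrow> regs s v = \<sigma> v \<and> \<sigma> v < n" "ri \<notin> set L" "regs s rn = n"
    and "n ^ length L \<le> 2 ^ w"
  shows "sl w (index L) s = s\<lparr>regs := (regs s)(ri := idx n \<sigma> L)\<rparr>"
proof -
  have "idx n \<sigma> L < 2 ^ w"
    using idx_less[of L \<sigma> n] assms by fastforce
  moreover have "regs (s\<lparr>regs := (regs s)(ri := 0)\<rparr>) v = \<sigma> v \<and> \<sigma> v < n" if "v \<in> set L" for v
    using assms(1)[OF that] assms(2) that by (cases "v = ri") simp_all
  ultimately show ?thesis
    using assms(2,3) sl_horner[of L "s\<lparr>regs := (regs s)(ri := 0)\<rparr>" \<sigma> n w]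
    by (simp add: index_def)
qed

lemma index_simps [simp]:
    "loopfree (index L)" "warrs (index L) = {}" "cost (index L) = 2 + 2 * length L"
  and wregs_index: "wregs (index L) \<subseteq> {ri}"
proof -
  have "loopfree (horner L) \<and> wregs (horner L) \<subseteq> {ri} \<and> warrs (horner L) = {} \<and>
      cost (horner L) = 1 + 2 * length L"
    by (induction L) auto
  then show "loopfree (index L)" "warrs (index L) = {}" "cost (index L) = 2 + 2 * length L"
    "wregs (index L) \<subseteq> {ri}"
    by (auto simp: index_def)
qed

definition set_if :: "com \<Rightarrow> nat list \<Rightarrow> nat \<Rightarrow> nat \<Rightarrow> com" where
  "set_if test L b d = Seq test (If rc (Seq (index L) (Seq (Const ro d) (Store b ri ro))) Skip)"

lemma wregs_set_if: "wregs (set_if test L b d) \<subseteq> wregs test \<union> {ri, ro}"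
  and warrs_set_if: "warrs (set_if test L b d) = warrs test \<union> {b}"
  using wregs_index[of L] by (auto simp: set_if_def)

text \<open>The verdict is left in \<open>rc\<close> as zero or nonzero. That a test preserves the
  loop registers and the arrays is not part of this notion; it is read off from \<open>wregs\<close>
  and \<open>warrs\<close>.\<close>

definition tests :: "nat \<Rightarrow> nat \<Rightarrow> nat set \<Rightarrow> (nat \<Rightarrow> nat \<Rightarrow> nat) \<Rightarrow> nat set \<Rightarrow> com \<Rightarrow>
    ((nat \<Rightarrow> nat) \<Rightarrow> bool) \<Rightarrow> bool" where
  "tests w n K M U test C \<longleftrightarrow>
     (\<forall>\<sigma> s. word_state w s \<longrightarrow> regs s rn = n \<longrightarrow> (\<forall>a\<in>K. mem s a = M a) \<longrightarrow>
        (\<forall>u\<in>U. regs s u = \<sigma> u \<and> \<sigma> u < n) \<longrightarrow> (regs (sl w test s) rc \<noteq> 0 \<longleftrightarrow> C \<sigma>))"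

lemma acc_set_if:
  assumes test: "tests w n K M U test C" "loopfree test" "warrs test = {}"
      "wregs test \<inter> ({rn} \<union> set L) = {}"
    and L: "set L \<subseteq> U" "ri \<notin> set L" "n ^ length L \<le> 2 ^ w"
    and d: "d < 2 ^ w"
  shows "acc w n K M b d U (set_if test L b d) (\<lambda>\<sigma>. if C \<sigma> then {idx n \<sigma> L} else {})
    (cost test + 2 * length L + 5)"
proof (rule acc_sl)
  show "loopfree (set_if test L b d)" "cost (set_if test L b d) \<le> cost test + 2 * length L + 5"
    using test by (simp_all add: set_if_def)
next
  fix \<sigma> s
  assume s: "word_state w s" "regs s rn = n" "\<forall>a\<in>K. mem s a = M a" "\<forall>u\<in>U. regs s u = \<sigma> u \<and> \<sigma> u < n"
  let ?s = "sl w test s"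
  have C: "regs ?s rc \<noteq> 0 \<longleftrightarrow> C \<sigma>"
    using test(1) s unfolding tests_def by blast
  have f: "regs ?s v = regs s v" if "v \<in> insert rn (set L)" for v
    using sl_regs[OF test(2)] test(4) that by blast
  have m: "mem ?s a = mem s a" for a
    using sl_mem[OF test(2)] test(3) by auto
  have "sl w (index L) ?s = ?s\<lparr>regs := (regs ?s)(ri := idx n \<sigma> L)\<rparr>"
    using f s L by (intro sl_index) auto
  then show "mem (sl w (set_if test L b d) s) b =
      (\<lambda>i. if i \<in> (if C \<sigma> then {idx n \<sigma> L} else {}) then d else mem s b i)"
    using C d m by (auto simp: set_if_def)
qed

definition for_all_set :: "nat list \<Rightarrow> com \<Rightarrow> nat list \<Rightarrow> nat \<Rightarrow> nat \<Rightarrow> com" where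
  "for_all_set L test L' b d = loops L (set_if test L' b d)"

text \<open>The first pass removes the arbitrary initial contents. The second one runs over the
  longer list \<open>L\<close> and writes only ones, so a cell becomes the disjunction over all
  assignments that restrict to it: this is projection.\<close>

definition fill :: "nat list \<Rightarrow> com \<Rightarrow> nat list \<Rightarrow> nat \<Rightarrow> com" where
  "fill L test L' b = Seq (for_all_set L' (Const rc 1) L' b 0) (for_all_set L test L' b 1)"

lemma wregs_for_all_set: "wregs (for_all_set L test L' b d) \<subseteq> set L \<union> {rl, ro, ri} \<union> wregs test"
  and warrs_for_all_set: "warrs (for_all_set L test L' b d) = warrs test \<union> {b}"
  using wregs_loops[of L "set_if test L' b d"] wregs_set_if[of test L' b d]
  by (auto simp: for_all_set_def warrs_loops warrs_set_if)

lemma wregs_fill: "wregs (fill L test L' b) \<subseteq> set L \<union> set L' \<union> {rl, ro, ri, rc} \<union> wregs test"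
  and warrs_fill: "warrs (fill L test L' b) = warrs test \<union> {b}"
  using wregs_for_all_set[of L test L' b 1] wregs_for_all_set[of L' "Const rc 1" L' b 0]
  by (auto simp: fill_def warrs_for_all_set)

lemma acc_for_all_set:
  assumes test: "tests w n K M (set L \<union> U) test C" "loopfree test" "warrs test = {}"
      "wregs test \<inter> ({rn} \<union> set L \<union> U) = {}"
    and L: "set L' \<subseteq> set L \<union> U" "n ^ length L' \<le> 2 ^ w" "distinct L" "set L \<inter> U = {}"
      "(set L \<union> U) \<inter> {rn, rl, ro, ri} = {}"
    and d: "d < 2 ^ w" and b: "b \<notin> K" and n: "n < 2 ^ w" "1 < (2 :: nat) ^ w"
  shows "acc w n K M b d U (for_all_set L test L' b d)
    (\<lambda>\<sigma>. {idx n \<tau> L' |\<tau>. \<tau> \<in> ext n L \<sigma> \<and> C \<tau>})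
    (loops_time n (length L) (cost test + 2 * length L' + 5))"
proof -
  have "acc w n K M b d U (loops L (set_if test L' b d))
    (\<lambda>\<sigma>. \<Union>\<tau>\<in>ext n L \<sigma>. if C \<tau> then {idx n \<tau> L'} else {})
    (loops_time n (length L) (cost test + 2 * length L' + 5))"
    using assms wregs_set_if[of test L' b d]
    by (intro acc_loops acc_set_if) (auto simp: warrs_set_if)
  moreover have "(\<Union>\<tau>\<in>ext n L \<sigma>. if C \<tau> then {idx n \<tau> L'} else {}) = {idx n \<tau> L' |\<tau>. \<tau> \<in> ext n L \<sigma> \<and> C \<tau>}" for \<sigma>
    by auto
  ultimately show ?thesis by (simp add: for_all_set_def)
qed

definition fill_time :: "nat \<Rightarrow> nat \<Rightarrow> nat \<Rightarrow> nat \<Rightarrow> nat" where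
  "fill_time n k k' t = loops_time n k' (2 * k' + 6) + loops_time n k (t + 2 * k' + 5)"

lemma runs_fill:
  assumes test: "tests w n K M (set L \<union> U) test C" "loopfree test" "warrs test = {}"
      "wregs test \<inter> ({rn} \<union> set L \<union> U) = {}"
    and L: "set L' \<subseteq> set L" "n ^ length L' \<le> 2 ^ w" "distinct L" "distinct L'" "set L \<inter> U = {}"
      "(set L \<union> U) \<inter> {rn, rl, ro, ri, rc} = {}"
    and b: "b \<notin> K" and n: "n < 2 ^ w" "1 < (2 :: nat) ^ w"
    and s: "word_state w s" "regs s rn = n" "\<forall>a\<in>K. mem s a = M a" "\<forall>u\<in>U. regs s u = \<sigma> u \<and> \<sigma> u < n"
  shows "runs w (fill L test L' b) s (fill_time n (length L) (length L') (cost test))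
    (\<lambda>s'. \<forall>\<rho>. (\<forall>v\<in>set L'. \<rho> v < n) \<longrightarrow>
       mem s' b (idx n \<rho> L') = of_bool (\<exists>\<tau>\<in>ext n L \<sigma>. C \<tau> \<and> (\<forall>v\<in>set L'. \<tau> v = \<rho> v)))"
proof -
  have a0: "acc w n K M b 0 U (for_all_set L' (Const rc 1) L' b 0)
    (\<lambda>\<sigma>. {idx n \<tau> L' |\<tau>. \<tau> \<in> ext n L' \<sigma> \<and> True})
    (loops_time n (length L') (cost (Const rc 1) + 2 * length L' + 5))"
    using L b n by (intro acc_for_all_set) (auto simp: tests_def)
  have a1: "acc w n K M b 1 U (for_all_set L test L' b 1)
    (\<lambda>\<sigma>. {idx n \<tau> L' |\<tau>. \<tau> \<in> ext n L \<sigma> \<and> C \<tau>})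
    (loops_time n (length L) (cost test + 2 * length L' + 5))"
    using assms by (intro acc_for_all_set) auto
  have "runs w (fill L test L' b) s
      (loops_time n (length L') (cost (Const rc 1) + 2 * length L' + 5) +
       loops_time n (length L) (cost test + 2 * length L' + 5))
    (\<lambda>s'. \<forall>\<rho>. (\<forall>v\<in>set L'. \<rho> v < n) \<longrightarrow>
       mem s' b (idx n \<rho> L') = of_bool (\<exists>\<tau>\<in>ext n L \<sigma>. C \<tau> \<and> (\<forall>v\<in>set L'. \<tau> v = \<rho> v)))"
    unfolding fill_def
  proof (rule runs_SeqI[OF a0[unfolded acc_def, rule_format, OF s(1,2) _ s(4)[rule_format]]])
    fix s1
    assume m1: "mem s1 b = (\<lambda>i. if i \<in> {idx n \<tau> L' |\<tau>. \<tau> \<in> ext n L' \<sigma> \<and> True} then 0 else mem s b i)"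
      and w1: "word_state w s1"
      and f: "\<And>r. r \<notin> wregs (for_all_set L' (Const rc 1) L' b 0) \<Longrightarrow> regs s1 r = regs s r"
        "\<And>a. a \<notin> warrs (for_all_set L' (Const rc 1) L' b 0) \<Longrightarrow> mem s1 a = mem s a"
    have r1: "regs s1 r = regs s r" if "r \<in> insert rn U" for r
      using that L wregs_for_all_set[of L' "Const rc 1" L' b 0] by (intro f) fastforce
    have "\<forall>a\<in>K. mem s1 a = M a"
    proof
      fix a assume "a \<in> K"
      then show "mem s1 a = M a" using f(2)[of a] s(3) b by (auto simp: warrs_for_all_set)
    qed
    then have "runs w (for_all_set L test L' b 1) s1 (loops_time n (length L) (cost test + 2 * length L' + 5))
      (\<lambda>s'. mem s' b = (\<lambda>i. if i \<in> {idx n \<tau> L' |\<tau>. \<tau> \<in> ext n L \<sigma> \<and> C \<tau>} then 1 else mem s1 b i))"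
      using a1 w1 r1 s unfolding acc_def by auto
    then show "runs w (for_all_set L test L' b 1) s1 (loops_time n (length L) (cost test + 2 * length L' + 5))
      (\<lambda>s'. \<forall>\<rho>. (\<forall>v\<in>set L'. \<rho> v < n) \<longrightarrow>
         mem s' b (idx n \<rho> L') = of_bool (\<exists>\<tau>\<in>ext n L \<sigma>. C \<tau> \<and> (\<forall>v\<in>set L'. \<tau> v = \<rho> v)))"
    proof (rule runs_mono[OF _ order_refl], intro allI impI)
      fix s' \<rho>
      assume m': "mem s' b = (\<lambda>i. if i \<in> {idx n \<tau> L' |\<tau>. \<tau> \<in> ext n L \<sigma> \<and> C \<tau>} then 1 else mem s1 b i)"
        and \<rho>: "\<forall>v\<in>set L'. \<rho> v < n"
      \<comment> \<open>Outside \<open>L'\<close> the assignment \<open>\<rho>\<close> is arbitrary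
        whereas \<open>ext\<close> prescribes \<open>\<sigma>\<close>; the index does not see the
        difference.\<close>
      let ?\<rho> = "\<lambda>v. if v \<in> set L' then \<rho> v else \<sigma> v"
      have "?\<rho> \<in> ext n L' \<sigma>" using \<rho> by (auto simp: ext_def)
      moreover have "idx n \<rho> L' = idx n ?\<rho> L'" by (rule idx_cong) auto
      ultimately have "mem s1 b (idx n \<rho> L') = 0" unfolding m1 by auto
      moreover have "(idx n \<rho> L' \<in> {idx n \<tau> L' |\<tau>. \<tau> \<in> ext n L \<sigma> \<and> C \<tau>}) \<longleftrightarrow>
          (\<exists>\<tau>\<in>ext n L \<sigma>. C \<tau> \<and> (\<forall>v\<in>set L'. \<tau> v = \<rho> v))" (is "?A \<longleftrightarrow> ?B")
      proof
        assume ?A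
        then obtain \<tau> where \<tau>: "\<tau> \<in> ext n L \<sigma>" "C \<tau>" "idx n \<tau> L' = idx n \<rho> L'" by auto
        \<comment> \<open>Distinct placements have distinct cells, so a one found in this cell stems
          from a placement that restricts to \<open>\<rho>\<close>.\<close>
        have "\<tau> v = \<rho> v" if "v \<in> set L'" for v
          using \<tau>(1) L(1) \<rho> that by (intro idx_inject[OF \<tau>(3)]) (auto simp: ext_def)
        then show ?B using \<tau> by blast
      next
        assume ?B
        then obtain \<tau> where \<tau>: "\<tau> \<in> ext n L \<sigma>" "C \<tau>" "\<forall>v\<in>set L'. \<tau> v = \<rho> v" by auto
        then have "idx n \<rho> L' = idx n \<tau> L'" by (intro idx_cong) auto
        then show ?A using \<tau> by auto
      qed
      ultimately show "mem s' b (idx n \<rho> L') = of_bool (\<exists>\<tau>\<in>ext n L \<sigma>. C \<tau> \<and> (\<forall>v\<in>set L'. \<tau> v = \<rho> v))"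
        unfolding m' by simp
    qed
  qed (use s in auto)
  then show ?thesis by (rule runs_mono) (simp_all add: fill_time_def ac_simps)
qed

section \<open>Tests by table look-up\<close>

definition lookup :: "nat \<Rightarrow> nat list \<Rightarrow> com" where
  "lookup a L = Seq (index L) (Load rc a ri)"

lemma lookup_simps [simp]:
  "loopfree (lookup a L)" "warrs (lookup a L) = {}" "cost (lookup a L) = 3 + 2 * length L"
  by (simp_all add: lookup_def)

lemma wregs_lookup: "wregs (lookup a L) \<subseteq> {ri, rc}"
  using wregs_index[of L] by (auto simp: lookup_def)

lemma tests_lookup:
  assumes "set L \<subseteq> U" "ri \<notin> U" "n ^ length L \<le> 2 ^ w" "a \<in> K"
  shows "tests w n K M U (lookup a L) (\<lambda>\<sigma>. M a (idx n \<sigma> L) \<noteq> 0)"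
  unfolding tests_def
proof (intro allI impI)
  fix \<sigma> and s :: state
  assume s: "regs s rn = n" "\<forall>a\<in>K. mem s a = M a" "\<forall>u\<in>U. regs s u = \<sigma> u \<and> \<sigma> u < n"
  have "sl w (index L) s = s\<lparr>regs := (regs s)(ri := idx n \<sigma> L)\<rparr>"
    using s assms by (intro sl_index) auto
  then show "(regs (sl w (lookup a L) s) rc \<noteq> 0) = (M a (idx n \<sigma> L) \<noteq> 0)"
    using s(2) assms(4) by (simp add: lookup_def)
qed

definition test_and :: "com \<Rightarrow> com \<Rightarrow> com" where
  "test_and c1 c2 = Seq c1 (If rc c2 Skip)"

lemma test_and_simps [simp]:
  "loopfree (test_and c1 c2) \<longleftrightarrow> loopfree c1 \<and> loopfree c2"
  "wregs (test_and c1 c2) = wregs c1 \<union> wregs c2" "warrs (test_and c1 c2) = warrs c1 \<union> warrs c2"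
  by (simp_all add: test_and_def)

lemma tests_and:
  assumes "tests w n K M U c1 C1" "loopfree c1" "wregs c1 \<inter> ({rn} \<union> U) = {}" "warrs c1 = {}"
    and "tests w n K M U c2 C2"
  shows "tests w n K M U (test_and c1 c2) (\<lambda>\<sigma>. C1 \<sigma> \<and> C2 \<sigma>)"
  unfolding tests_def
proof (intro allI impI)
  fix \<sigma> s
  assume s: "word_state w s" "regs s rn = n" "\<forall>a\<in>K. mem s a = M a" "\<forall>u\<in>U. regs s u = \<sigma> u \<and> \<sigma> u < n"
  have "regs (sl w c1 s) rc \<noteq> 0 \<longleftrightarrow> C1 \<sigma>" using assms(1) s unfolding tests_def by blast
  moreover have "regs (sl w c2 (sl w c1 s)) rc \<noteq> 0 \<longleftrightarrow> C2 \<sigma>"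
  proof -
    have "word_state w (sl w c1 s)" using exec_word_state exec_sl[OF assms(2)] s(1) by blast
    moreover have "\<And>r. r \<in> insert rn U \<Longrightarrow> regs (sl w c1 s) r = regs s r"
      using sl_regs[OF assms(2)] assms(3) by blast
    moreover have "mem (sl w c1 s) a = mem s a" for a using sl_mem[OF assms(2)] assms(4) by auto
    ultimately show ?thesis
      using s by (intro assms(5)[unfolded tests_def, rule_format]) auto
  qed
  ultimately show "(regs (sl w (test_and c1 c2) s) rc \<noteq> 0) = (C1 \<sigma> \<and> C2 \<sigma>)"
    by (auto simp: test_and_def)
qed

end


section \<open>Partial embeddings\<close>

definition emb :: "nat \<Rightarrow> nat set set \<Rightarrow> ('a::linorder, 'b) pattern_scheme \<Rightarrow> ('a \<Rightarrow> nat) \<Rightarrow> bool" where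
  "emb n E Q f \<longleftrightarrow> f ` verts Q \<subseteq> {..<n} \<and> strict_mono_on (verts Q) f \<and>
     (\<forall>u\<in>verts Q. \<forall>v\<in>verts Q. ({u, v} \<in> mand Q \<longrightarrow> {f u, f v} \<in> E) \<and>
        ({u, v} \<in> forb Q \<longrightarrow> {f u, f v} \<notin> E))"

text \<open>The set \<open>B\<close> is a parameter, not the anchor set of \<open>Q\<close>: at a
  merge the children are tabulated on fewer vertices, and for the final answer on none.\<close>

definition tab :: "nat \<Rightarrow> nat set set \<Rightarrow> 'a::linorder set \<Rightarrow> 'a apattern \<Rightarrow> ('a \<Rightarrow> nat) \<Rightarrow> bool" where
  "tab n E B Q \<sigma> \<longleftrightarrow> (\<exists>f. emb n E Q f \<and> (\<forall>v\<in>B. f v = \<sigma> v))"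

lemma tab_cong: "(\<And>v. v \<in> B \<Longrightarrow> \<sigma> v = \<tau> v) \<Longrightarrow> tab n E B Q \<sigma> = tab n E B Q \<tau>"
  by (simp add: tab_def)

lemma tab_less: "tab n E B Q \<sigma> \<Longrightarrow> B \<subseteq> verts Q \<Longrightarrow> v \<in> B \<Longrightarrow> \<sigma> v < n"
  by (force simp: tab_def emb_def)

lemma tab_forget:
  "B \<subseteq> A \<Longrightarrow> tab n E B Q \<sigma> \<longleftrightarrow> (\<exists>\<tau>. tab n E A Q \<tau> \<and> (\<forall>v\<in>B. \<tau> v = \<sigma> v))"
  unfolding tab_def by (metis subset_iff)

text \<open>The two notions use maps in opposite directions, from a set of graph vertices to the
  pattern and from the pattern into the graph; inverses translate between them.\<close>

lemma contains_pattern_iff_emb: "contains_pattern n E P \<longleftrightarrow> (\<exists>f. emb n E P f)"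
proof
  assume "contains_pattern n E P"
  then obtain X f where X: "X \<subseteq> {..<n}" and f: "bij_betw f X (verts P)" "strict_mono_on X f"
    and e: "\<And>x y. x \<in> X \<Longrightarrow> y \<in> X \<Longrightarrow> {f x, f y} \<in> mand P \<Longrightarrow> {x, y} \<in> E"
      "\<And>x y. x \<in> X \<Longrightarrow> y \<in> X \<Longrightarrow> {f x, f y} \<in> forb P \<Longrightarrow> {x, y} \<notin> E"
    unfolding contains_pattern_def by blast
  define g where "g = inv_into X f"
  have g: "g u \<in> X" "f (g u) = u" if "u \<in> verts P" for u
    using that f(1) unfolding g_def bij_betw_def by (metis inv_into_into, metis f_inv_into_f)
  have "strict_mono_on (verts P) g"
  proof (rule strict_mono_onI)
    fix u v assume uv: "u \<in> verts P" "v \<in> verts P" "u < v"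
    then show "g u < g v"
      using g[OF uv(1)] g[OF uv(2)] strict_mono_on_less[OF f(2), of "g u" "g v"] by simp
  qed
  then have "emb n E P g"
    unfolding emb_def using X g e by (auto simp: subset_iff)
  then show "\<exists>f. emb n E P f" by blast
next
  assume "\<exists>f. emb n E P f"
  then obtain f where f: "f ` verts P \<subseteq> {..<n}" "strict_mono_on (verts P) f"
    and e: "\<And>u v. u \<in> verts P \<Longrightarrow> v \<in> verts P \<Longrightarrow> {u, v} \<in> mand P \<Longrightarrow> {f u, f v} \<in> E"
      "\<And>u v. u \<in> verts P \<Longrightarrow> v \<in> verts P \<Longrightarrow> {u, v} \<in> forb P \<Longrightarrow> {f u, f v} \<notin> E"
    unfolding emb_def by blast
  have inj: "inj_on f (verts P)" using f(2) by (rule strict_mono_on_imp_inj_on)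
  define g where "g = inv_into (verts P) f"
  have g: "g (f u) = u" if "u \<in> verts P" for u
    using that inj by (simp add: g_def)
  have "bij_betw g (f ` verts P) (verts P)"
    unfolding g_def using inj by (intro bij_betw_inv_into) (simp add: bij_betw_def)
  moreover have "strict_mono_on (f ` verts P) g"
    using g strict_mono_on_less[OF f(2)] by (auto intro!: strict_mono_onI)
  ultimately show "contains_pattern n E P"
    unfolding contains_pattern_def using f(1) e g inj
    by (intro exI[of _ "f ` verts P"] exI[of _ g]) (auto simp: card_image)
qed


subsection \<open>Merges\<close>

lemma is_mergeD:
  assumes "is_merge P P1 P2"
  shows "edges P1 \<union> edges P2 = edges P" "verts P1 \<union> verts P2 = verts P"
    "\<forall>Q\<in>{P1, P2}. mand Q \<subseteq> mand P \<and> forb Q \<subseteq> forb P \<and> (\<forall>e\<in>edges Q. e \<subseteq> verts Q)"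
    "\<forall>v\<in>verts P1 \<inter> verts P2. v \<in> anchors P1 \<and> v \<in> anchors P2"
    "\<forall>v\<in>anchors P. \<forall>Q\<in>{P1, P2}. v \<in> verts Q \<longrightarrow> v \<in> anchors Q"
    "\<not> (\<exists>u v. (consecutive (verts P) u v \<or> consecutive (verts P) v u) \<and>
       u \<in> verts P1 - verts P2 \<and> v \<in> verts P2 - verts P1)"
  using assms unfolding is_merge_def by - (elim conjE, assumption)+

text \<open>Let w be the largest vertex of \<open>V1\<close> up to v. If w were not in
  \<open>V2\<close>, its successor in \<open>V\<close> would be at most v, hence outside
  \<open>V1\<close>, and these two consecutive vertices would violate condition (e).\<close>

lemma exists_shared_vertex_between:
  assumes "finite V" "V1 \<union> V2 = V"
    and sep: "\<not> (\<exists>u v. (consecutive V u v \<or> consecutive V v u) \<and> u \<in> V1 - V2 \<and> v \<in> V2 - V1)"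
    and uv: "u \<in> V1" "v \<in> V2" "u < v"
  shows "\<exists>w\<in>V1 \<inter> V2. u \<le> w \<and> w \<le> v"
proof -
  let ?S = "{x\<in>V1. x \<le> v}"
  define w where "w = Max ?S"
  have fin: "finite V1" "finite V2" using assms(1,2) by auto
  then have S: "finite ?S" "?S \<noteq> {}" using uv by auto
  have "w \<in> ?S" "\<And>x. x \<in> ?S \<Longrightarrow> x \<le> w"
    unfolding w_def by (fact Max_in[OF S], fact Max_ge[OF S(1)])
  then have w: "w \<in> V1" "w \<le> v" "\<And>x. x \<in> V1 \<Longrightarrow> x \<le> v \<Longrightarrow> x \<le> w" by auto
  have "w \<in> V2"
  proof (rule ccontr)
    assume w2: "w \<notin> V2"
    then have wv: "w < v" using uv(2) w(2) by (cases "w = v") auto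
    let ?R = "{x\<in>V. w < x}"
    define y where "y = Min ?R"
    have "?R \<noteq> {}" "finite ?R" using wv uv(2) assms(1,2) by auto
    then have y: "y \<in> V" "w < y" "\<And>x. x \<in> V \<Longrightarrow> w < x \<Longrightarrow> y \<le> x"
      using Min_in[of ?R] unfolding y_def by auto
    have "y \<le> v" using y(3)[of v] wv uv(2) assms(2) by auto
    then have "y \<notin> V1" using w(3)[of y] y(2) by auto
    moreover have "consecutive V w y"
      unfolding consecutive_def using y w(1) assms(2) by (auto simp: not_less[symmetric])
    ultimately show False using sep w2 w(1) y(1) assms(2) by blast
  qed
  then show ?thesis using w(1,2) w(3)[OF uv(1)] uv(3) by (intro bexI[of _ w]) auto
qed

text \<open>Two partial embeddings that agree on the shared vertices glue to an order-preserving map: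
  between a vertex private to one side and a larger one private to the other lies a shared one.\<close>

lemma tab_merge:
  assumes m: "is_merge P P1 P2" and wf: "wf_apattern P"
    and B: "verts P1 \<inter> verts P2 \<subseteq> B1 \<inter> B2" "anchors P \<inter> verts P1 \<subseteq> B1" "anchors P \<inter> verts P2 \<subseteq> B2"
  shows "tab n E (anchors P) P \<sigma> \<longleftrightarrow>
    (\<exists>\<tau>. (\<forall>v\<in>anchors P. \<tau> v = \<sigma> v) \<and> tab n E B1 P1 \<tau> \<and> tab n E B2 P2 \<tau>)"
proof
  assume "tab n E (anchors P) P \<sigma>"
  then obtain f where f: "emb n E P f" "\<forall>v\<in>anchors P. f v = \<sigma> v" unfolding tab_def by blast
  have "emb n E Q f" if "Q \<in> {P1, P2}" for Q
  proof -
    have "verts Q \<subseteq> verts P" "mand Q \<subseteq> mand P" "forb Q \<subseteq> forb P"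
      using is_mergeD(2,3)[OF m] that by auto
    then show ?thesis
      using f(1) monotone_on_subset[of "verts P" _ _ f "verts Q"] unfolding emb_def
      by (meson image_mono subset_iff subset_trans)
  qed
  then show "\<exists>\<tau>. (\<forall>v\<in>anchors P. \<tau> v = \<sigma> v) \<and> tab n E B1 P1 \<tau> \<and> tab n E B2 P2 \<tau>"
    using f(2) by (intro exI[of _ f]) (auto simp: tab_def)
next
  assume "\<exists>\<tau>. (\<forall>v\<in>anchors P. \<tau> v = \<sigma> v) \<and> tab n E B1 P1 \<tau> \<and> tab n E B2 P2 \<tau>"
  then obtain \<tau> f1 f2 where \<tau>: "\<And>v. v \<in> anchors P \<Longrightarrow> \<tau> v = \<sigma> v"
    and f1: "emb n E P1 f1" "\<And>v. v \<in> B1 \<Longrightarrow> f1 v = \<tau> v"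
    and f2: "emb n E P2 f2" "\<And>v. v \<in> B2 \<Longrightarrow> f2 v = \<tau> v"
    unfolding tab_def by blast
  let ?V1 = "verts P1" and ?V2 = "verts P2"
  have V: "?V1 \<union> ?V2 = verts P" "finite (verts P)"
    using is_mergeD(2)[OF m] wf unfolding wf_apattern_def wf_pattern_def by auto
  define f where "f v = (if v \<in> ?V1 then f1 v else f2 v)" for v
  \<comment> \<open>Shared vertices lie in \<open>B1\<close> and in \<open>B2\<close>, where both
    embeddings follow \<open>\<tau>\<close>; so preferring \<open>f1\<close> in the definition of
    \<open>f\<close> is harmless.\<close>
  have "f1 v = f2 v" if "v \<in> ?V1" "v \<in> ?V2" for v
  proof -
    have "v \<in> B1" "v \<in> B2" using B(1) that by blast+
    then show ?thesis using f1(2) f2(2) by simp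
  qed
  then have fV: "v \<in> ?V1 \<Longrightarrow> f v = f1 v" "v \<in> ?V2 \<Longrightarrow> f v = f2 v" for v
    by (auto simp: f_def)
  have mono: "strict_mono_on ?V1 f" "strict_mono_on ?V2 f"
    using f1(1) f2(1) fV unfolding emb_def strict_mono_on_def by auto
  have sep: "\<not> (\<exists>u v. (consecutive (verts P) u v \<or> consecutive (verts P) v u) \<and>
      u \<in> ?V1 - ?V2 \<and> v \<in> ?V2 - ?V1)"
    by (rule is_mergeD(6)[OF m])
  \<comment> \<open>The shared vertex \<open>w\<close> may coincide with \<open>u\<close> or with
    \<open>v\<close>, but not with both, so one of the two comparisons is strict.\<close>
  have glue: "f u < f v" if "w \<in> ?V1 \<inter> ?V2" "u \<le> w" "w \<le> v" "u < v"
    "u \<in> ?V1 \<and> v \<in> ?V2 \<or> u \<in> ?V2 \<and> v \<in> ?V1" for u v w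
  proof -
    have "f u \<le> f w" "f w \<le> f v" "u < w \<Longrightarrow> f u < f w" "w < v \<Longrightarrow> f w < f v"
      using that mono by (auto simp: strict_mono_on_leD strict_mono_onD)
    then show ?thesis using that(2,3,4) by (metis le_less_trans less_le_trans order.not_eq_order_implies_strict)
  qed
  have "strict_mono_on (verts P) f"
  proof (rule strict_mono_onI)
    fix u v assume uv: "u \<in> verts P" "v \<in> verts P" "u < v"
    then consider "u \<in> ?V1" "v \<in> ?V1" | "u \<in> ?V2" "v \<in> ?V2" | "u \<in> ?V1" "v \<in> ?V2"
      | "u \<in> ?V2" "v \<in> ?V1" using V(1) by blast
    then show "f u < f v"
    proof cases
      case 1
      then show ?thesis using mono(1) uv by (auto simp: strict_mono_onD)
    next
      case 2
      then show ?thesis using mono(2) uv by (auto simp: strict_mono_onD)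
    next
      case 3
      then show ?thesis
        using exists_shared_vertex_between[OF V(2,1) sep 3 uv(3)] uv(3) glue by blast
    next
      case 4
      have "?V2 \<union> ?V1 = verts P" using V(1) by blast
      moreover have "\<not> (\<exists>u v. (consecutive (verts P) u v \<or> consecutive (verts P) v u) \<and>
          u \<in> ?V2 - ?V1 \<and> v \<in> ?V1 - ?V2)"
        using sep by blast
      ultimately show ?thesis
        using exists_shared_vertex_between[OF V(2) _ _ 4 uv(3)] uv(3) 4 glue by blast
    qed
  qed
  moreover have "f ` verts P \<subseteq> {..<n}"
  proof
    fix x assume "x \<in> f ` verts P"
    then obtain v where "x = f v" "v \<in> ?V1 \<or> v \<in> ?V2" using V(1) by blast
    then show "x \<in> {..<n}" using f1(1) f2(1) fV unfolding emb_def by auto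
  qed
  moreover have "({u, v} \<in> mand P \<longrightarrow> {f u, f v} \<in> E) \<and> ({u, v} \<in> forb P \<longrightarrow> {f u, f v} \<notin> E)" for u v
  proof -
    have *: "\<exists>Q\<in>{P1, P2}. {u, v} \<in> edges Q" if "{u, v} \<in> edges P"
      using is_mergeD(1)[OF m] that by blast
    \<comment> \<open>An edge of \<open>P\<close> reappears on one side, and there with the same
      type: with the other type it would be both mandatory and forbidden in
      \<open>P\<close>.\<close>
    have disj: "mand P \<inter> forb P = {}" using wf unfolding wf_apattern_def wf_pattern_def by blast
    have Q: "({u, v} \<in> mand P \<longrightarrow> {f u, f v} \<in> E) \<and> ({u, v} \<in> forb P \<longrightarrow> {f u, f v} \<notin> E)"
      if "{u, v} \<in> edges Q" "mand Q \<subseteq> mand P" "forb Q \<subseteq> forb P" "\<forall>e\<in>edges Q. e \<subseteq> verts Q" "emb n E Q f"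
      for Q :: "'a apattern"
    proof -
      have uv: "u \<in> verts Q" "v \<in> verts Q" using that(1,4) by auto
      then have "{u, v} \<in> mand Q \<longrightarrow> {f u, f v} \<in> E" "{u, v} \<in> forb Q \<longrightarrow> {f u, f v} \<notin> E"
        using that(5) unfolding emb_def by auto
      then show ?thesis using that(1-3) disj unfolding edges_def by blast
    qed
    have "emb n E P1 f" "emb n E P2 f"
      using f1(1) f2(1) mono fV unfolding emb_def by auto
    have sub: "mand Q \<subseteq> mand P \<and> forb Q \<subseteq> forb P \<and> (\<forall>e\<in>edges Q. e \<subseteq> verts Q)"
      if "Q \<in> {P1, P2}" for Q
      using is_mergeD(3)[OF m] that by blast
    show ?thesis
    proof (cases "{u, v} \<in> edges P")
      case True
      then obtain Q where "Q \<in> {P1, P2}" "{u, v} \<in> edges Q" using * by blast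
      then show ?thesis using Q[of Q] sub[of Q] \<open>emb n E P1 f\<close> \<open>emb n E P2 f\<close> by auto
    next
      case False
      then show ?thesis by (auto simp: edges_def)
    qed
  qed
  ultimately have "emb n E P f" unfolding emb_def by blast
  moreover have "f v = \<sigma> v" if "v \<in> anchors P" for v
  proof -
    have "v \<in> ?V1 \<or> v \<in> ?V2" using that wf V(1) unfolding wf_apattern_def by blast
    then show ?thesis
    proof
      assume "v \<in> ?V1"
      then show ?thesis using that B(2) f1(2) fV(1) \<tau> by (metis IntI subsetD)
    next
      assume "v \<in> ?V2"
      then show ?thesis using that B(3) f2(2) fV(2) \<tau> by (metis IntI subsetD)
    qed
  qed
  ultimately show "tab n E (anchors P) P \<sigma>" unfolding tab_def by blast
qed

lemma merge_anchors:
  assumes "is_merge P P1 P2" "wf_apattern P" "wf_apattern P1" "wf_apattern P2"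
  shows "verts P1 \<inter> verts P2 = anchors P1 \<inter> anchors P2" "anchors P \<subseteq> anchors P1 \<union> anchors P2"
    "anchors P \<inter> verts P1 \<subseteq> anchors P1" "anchors P \<inter> verts P2 \<subseteq> anchors P2"
proof -
  have m: "verts P1 \<union> verts P2 = verts P"
    "\<forall>v\<in>verts P1 \<inter> verts P2. v \<in> anchors P1 \<and> v \<in> anchors P2"
    "\<forall>v\<in>anchors P. \<forall>Q\<in>{P1, P2}. v \<in> verts Q \<longrightarrow> v \<in> anchors Q"
    using is_mergeD[OF assms(1)] by simp_all
  have a: "anchors P \<subseteq> verts P" "anchors P1 \<subseteq> verts P1" "anchors P2 \<subseteq> verts P2"
    using assms unfolding wf_apattern_def by blast+
  show "verts P1 \<inter> verts P2 = anchors P1 \<inter> anchors P2" using m(2) a by blast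
  show "anchors P \<inter> verts P1 \<subseteq> anchors P1" "anchors P \<inter> verts P2 \<subseteq> anchors P2" using m(3) by blast+
  then show "anchors P \<subseteq> anchors P1 \<union> anchors P2" using m(1) a(1) by blast
qed

text \<open>By condition (e) there is a shared vertex between any vertices of the two sides, and by
  (c) it is an anchor of both. So a label without anchors cannot take part in a merge.\<close>

lemma merge_anchors_nonempty:
  assumes m: "is_merge P P1 P2" and wf: "wf_apattern P" "verts P1 \<noteq> {}" "verts P2 \<noteq> {}"
  shows "anchors P1 \<noteq> {} \<and> anchors P2 \<noteq> {}"
proof -
  let ?V1 = "verts P1" and ?V2 = "verts P2"
  have V: "?V1 \<union> ?V2 = verts P" "?V2 \<union> ?V1 = verts P" "finite (verts P)"
    using is_mergeD(2)[OF m] wf unfolding wf_apattern_def wf_pattern_def by auto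
  have sep: "\<not> (\<exists>u v. (consecutive (verts P) u v \<or> consecutive (verts P) v u) \<and>
      u \<in> ?V1 - ?V2 \<and> v \<in> ?V2 - ?V1)"
    by (rule is_mergeD(6)[OF m])
  then have sep': "\<not> (\<exists>u v. (consecutive (verts P) u v \<or> consecutive (verts P) v u) \<and>
      u \<in> ?V2 - ?V1 \<and> v \<in> ?V1 - ?V2)"
    by blast
  obtain u v where uv: "u \<in> ?V1" "v \<in> ?V2" using wf by blast
  have "?V1 \<inter> ?V2 \<noteq> {}"
  proof (cases u v rule: linorder_cases)
    case less
    then show ?thesis using exists_shared_vertex_between[OF V(3,1) sep uv] by blast
  next
    case equal
    then show ?thesis using uv by blast
  next
    case greater
    then show ?thesis using exists_shared_vertex_between[OF V(3,2) sep' uv(2,1)] by blast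
  qed
  then show ?thesis using is_mergeD(4)[OF m] by blast
qed


subsection \<open>Vertex creations\<close>

lemma consecutive_predecessor:
  assumes "finite V" "x \<in> V" "u \<in> V" "u < x"
  obtains y where "consecutive V y x" "\<And>z. z \<in> V \<Longrightarrow> z < x \<Longrightarrow> z \<le> y"
proof -
  let ?S = "{z\<in>V. z < x}"
  have S: "finite ?S" "?S \<noteq> {}" using assms by auto
  show thesis
    using Max_in[OF S] Max_ge[OF S(1)] assms(2)
    by (intro that[of "Max ?S"]) (auto simp: consecutive_def not_less[symmetric])
qed

lemma consecutive_successor:
  assumes "finite V" "x \<in> V" "u \<in> V" "x < u"
  obtains y where "consecutive V x y" "\<And>z. z \<in> V \<Longrightarrow> x < z \<Longrightarrow> y \<le> z"
proof -
  let ?S = "{z\<in>V. x < z}"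
  have S: "finite ?S" "?S \<noteq> {}" using assms by auto
  show thesis
    using Min_in[OF S] Min_le[OF S(1)] assms(2)
    by (intro that[of "Min ?S"]) (auto simp: consecutive_def not_less[symmetric])
qed

text \<open>The new vertex has a predecessor or a successor, and this one must be an anchor.\<close>

lemma creation_anchors_nonempty:
  assumes "is_vertex_creation P P'" "wf_apattern P" "verts P' \<noteq> {}"
  shows "anchors P' \<noteq> {}"
proof -
  obtain x where x: "x \<notin> verts P'" "verts P = insert x (verts P')"
    "\<And>u. consecutive (verts P) u x \<or> consecutive (verts P) x u \<Longrightarrow> u \<in> anchors P'"
    using assms(1) unfolding is_vertex_creation_def by blast
  obtain u where u: "u \<in> verts P'" using assms(3) by blast
  have "finite (verts P)" using assms(2) unfolding wf_apattern_def wf_pattern_def by blast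
  moreover have "x \<noteq> u" using x u by blast
  then have "u < x \<or> x < u" by auto
  ultimately show ?thesis
    using consecutive_predecessor[of "verts P" x u] consecutive_successor[of "verts P" x u] u x(2,3)
    by (metis empty_iff insertCI)
qed

text \<open>The possible positions of a new vertex form the half-open interval from
  \<open>lower\<close> to \<open>upper\<close>. The options are its two neighbours in the pattern;
  \<open>None\<close> stands for the respective end of the graph.\<close>

definition lower :: "'a option \<Rightarrow> ('a \<Rightarrow> nat) \<Rightarrow> nat" where
  "lower a \<sigma> = (case a of None \<Rightarrow> 0 | Some u \<Rightarrow> \<sigma> u + 1)"

definition upper :: "nat \<Rightarrow> 'a option \<Rightarrow> ('a \<Rightarrow> nat) \<Rightarrow> nat" where
  "upper n b \<sigma> = (case b of None \<Rightarrow> n | Some u \<Rightarrow> \<sigma> u)"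

text \<open>The new vertex can be placed iff there is room between the images of its neighbours, which
  are anchors. Otherwise it is free, so the smallest possible position will do.\<close>

lemma tab_creation:
  fixes P P' :: "'a::linorder apattern"
  assumes c: "is_vertex_creation P P'" and wf: "wf_apattern P" "wf_apattern P'"
  obtains x a b where "x \<notin> anchors P'" "anchors P \<subseteq> insert x (anchors P')" "anchors P' \<subseteq> anchors P"
    "set_option a \<subseteq> anchors P'" "set_option b \<subseteq> anchors P'"
    "\<And>n E \<sigma>. tab n E (anchors P) P \<sigma> \<longleftrightarrow> tab n E (anchors P') P' \<sigma> \<and>
      (if x \<in> anchors P then lower a \<sigma> \<le> \<sigma> x \<and> \<sigma> x < upper n b \<sigma> else lower a \<sigma> < upper n b \<sigma>)"
proof -
  obtain x where x: "x \<notin> verts P'" "verts P = insert x (verts P')"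
    "mand P = mand P'" "forb P = forb P'" "anchors P - {x} = anchors P'"
    "\<And>u. consecutive (verts P) u x \<or> consecutive (verts P) x u \<Longrightarrow> u \<in> anchors P'"
    using c unfolding is_vertex_creation_def by blast
  have fin: "finite (verts P)" and xP: "x \<in> verts P"
    using wf(1) x(2) unfolding wf_apattern_def wf_pattern_def by auto
  have A': "anchors P' \<subseteq> verts P'" using wf(2) unfolding wf_apattern_def by blast
  have e: "mand P' \<union> forb P' \<subseteq> pairs (verts P')"
    using wf(2) unfolding wf_apattern_def wf_pattern_def edges_def by blast
  \<comment> \<open>The new vertex is isolated, since the edges of \<open>P'\<close> are pairs of
    vertices of \<open>P'\<close>.\<close>
  have nx: "{x, v} \<notin> mand P' \<union> forb P'" "{v, x} \<notin> mand P' \<union> forb P'" for v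
    using e x(1) unfolding pairs_def by (auto simp: doubleton_eq_iff)
  obtain a where a: "set_option a \<subseteq> anchors P'" "\<And>u. a = Some u \<Longrightarrow> u < x"
    "\<And>v. v \<in> verts P' \<Longrightarrow> v < x \<Longrightarrow> \<exists>u. a = Some u \<and> v \<le> u"
  proof (cases "\<exists>v\<in>verts P'. v < x")
    case True
    then obtain y where "consecutive (verts P) y x" "\<And>z. z \<in> verts P \<Longrightarrow> z < x \<Longrightarrow> z \<le> y"
      using consecutive_predecessor[OF fin xP] x(2) by (metis insertCI)
    then show thesis
      using x(2,6) by (intro that[of "Some y"]) (auto simp: consecutive_def)
  qed (intro that[of None]; auto)
  obtain b where b: "set_option b \<subseteq> anchors P'" "\<And>u. b = Some u \<Longrightarrow> x < u"
    "\<And>v. v \<in> verts P' \<Longrightarrow> x < v \<Longrightarrow> \<exists>u. b = Some u \<and> u \<le> v"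
  proof (cases "\<exists>v\<in>verts P'. x < v")
    case True
    then obtain y where "consecutive (verts P) x y" "\<And>z. z \<in> verts P \<Longrightarrow> x < z \<Longrightarrow> y \<le> z"
      using consecutive_successor[OF fin xP] x(2) by (metis insertCI)
    then show thesis
      using x(2,6) by (intro that[of "Some y"]) (auto simp: consecutive_def)
  qed (intro that[of None]; auto)
  have "tab n E (anchors P) P \<sigma> \<longleftrightarrow> tab n E (anchors P') P' \<sigma> \<and>
      (if x \<in> anchors P then lower a \<sigma> \<le> \<sigma> x \<and> \<sigma> x < upper n b \<sigma> else lower a \<sigma> < upper n b \<sigma>)"
    (is "?L \<longleftrightarrow> ?R") for n E \<sigma>
  proof
    assume ?L
    then obtain f where f: "f ` verts P \<subseteq> {..<n}" "strict_mono_on (verts P) f"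
      and fe: "\<forall>u\<in>verts P. \<forall>v\<in>verts P. ({u, v} \<in> mand P \<longrightarrow> {f u, f v} \<in> E) \<and>
        ({u, v} \<in> forb P \<longrightarrow> {f u, f v} \<notin> E)"
      and fa: "\<forall>v\<in>anchors P. f v = \<sigma> v"
      unfolding tab_def emb_def by blast
    have "emb n E P' f"
      unfolding emb_def using f fe x by (auto intro: monotone_on_subset)
    then have "tab n E (anchors P') P' \<sigma>" unfolding tab_def using fa x(5) by blast
    moreover have "lower a \<sigma> \<le> f x"
    proof (cases a)
      case (Some u)
      then have "u \<in> verts P" "f u = \<sigma> u" "u < x" using a A' fa x by auto
      then show ?thesis using Some strict_mono_onD[OF f(2), of u x] xP by (simp add: lower_def)
    qed (simp add: lower_def)
    moreover have "f x < upper n b \<sigma>"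
    proof (cases b)
      case None
      then show ?thesis using f(1) xP by (auto simp: upper_def)
    next
      case (Some u)
      then have "u \<in> verts P" "f u = \<sigma> u" "x < u" using b A' fa x by auto
      then show ?thesis using Some strict_mono_onD[OF f(2), of x u] xP by (simp add: upper_def)
    qed
    ultimately show ?R using fa by auto
  next
    assume R: ?R
    then obtain f where f: "f ` verts P' \<subseteq> {..<n}" "strict_mono_on (verts P') f"
      and fe: "\<forall>u\<in>verts P'. \<forall>v\<in>verts P'. ({u, v} \<in> mand P' \<longrightarrow> {f u, f v} \<in> E) \<and>
        ({u, v} \<in> forb P' \<longrightarrow> {f u, f v} \<notin> E)"
      and fa: "\<forall>v\<in>anchors P'. f v = \<sigma> v"
      unfolding tab_def emb_def by blast
    define y where "y = (if x \<in> anchors P then \<sigma> x else lower a \<sigma>)"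
    have y: "lower a \<sigma> \<le> y" "y < upper n b \<sigma>" using R by (auto simp: y_def split: if_splits)
    have lo: "f v < y" if v: "v \<in> verts P'" "v < x" for v
    proof -
      obtain u where u: "a = Some u" "v \<le> u" using a(3)[OF v] by blast
      then have "u \<in> verts P'" "f u = \<sigma> u" using a(1) A' fa by auto
      then have "f v \<le> \<sigma> u" using strict_mono_on_leD[OF f(2) v(1) _ u(2)] by simp
      then show ?thesis using y(1) u(1) by (simp add: lower_def)
    qed
    have hi: "y < f v" if v: "v \<in> verts P'" "x < v" for v
    proof -
      obtain u where u: "b = Some u" "u \<le> v" using b(3)[OF v] by blast
      then have u': "u \<in> verts P'" "f u = \<sigma> u" using b(1) A' fa by auto
      then have "\<sigma> u \<le> f v" using strict_mono_on_leD[OF f(2) u'(1) v(1) u(2)] by simp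
      then show ?thesis using y(2) u(1) by (simp add: upper_def)
    qed
    \<comment> \<open>The upper limit is either \<open>n\<close> itself or the image of the
      successor, which is below \<open>n\<close>.\<close>
    have yn: "y < n"
    proof (cases b)
      case (Some u)
      then have u: "u \<in> verts P'" "f u = \<sigma> u" using b(1) A' fa by auto
      then have "f u < n" using f(1) by blast
      then show ?thesis using y(2) Some u(2) by (simp add: upper_def)
    qed (use y(2) in \<open>simp add: upper_def\<close>)
    let ?f = "f(x := y)"
    have "strict_mono_on (verts P) ?f"
    proof (rule strict_mono_onI)
      fix u v assume "u \<in> verts P" "v \<in> verts P" "u < v"
      then show "?f u < ?f v" using lo hi strict_mono_onD[OF f(2)] x(2) by auto
    qed
    moreover have "?f ` verts P \<subseteq> {..<n}" using f(1) yn x(2) by auto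
    moreover have "\<forall>u\<in>verts P. \<forall>v\<in>verts P. ({u, v} \<in> mand P \<longrightarrow> {?f u, ?f v} \<in> E) \<and>
        ({u, v} \<in> forb P \<longrightarrow> {?f u, ?f v} \<notin> E)"
      using fe nx x(2-4) by auto
    ultimately have "emb n E P ?f" unfolding emb_def by blast
    moreover have "\<forall>v\<in>anchors P. ?f v = \<sigma> v" using fa x(5) by (auto simp: y_def)
    ultimately show ?L unfolding tab_def by blast
  qed
  then show thesis
    using x(1,5) A' a(1) b(1) by (intro that[of x a b]) auto
qed


subsection \<open>Edge creations\<close>

text \<open>The Boolean \<open>m\<close> records the type of the edge, so that mandatory and
  forbidden edges are treated by one formula.\<close>

lemma tab_edge_creation:
  fixes Q :: "'a::linorder apattern"
  assumes "is_edge_creation Q"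
  obtains a b m where "a < b" "verts Q = {a, b}"
    "\<And>n E B \<sigma>. B \<subseteq> {a, b} \<Longrightarrow> tab n E B Q \<sigma> \<longleftrightarrow>
      (\<exists>x y. x < y \<and> y < n \<and> ({x, y} \<in> E \<longleftrightarrow> m) \<and> (a \<in> B \<longrightarrow> x = \<sigma> a) \<and> (b \<in> B \<longrightarrow> y = \<sigma> b))"
proof -
  obtain u v where uv: "u \<noteq> v" "verts Q = {u, v}"
    "mand Q = {{u, v}} \<and> forb Q = {} \<or> mand Q = {} \<and> forb Q = {{u, v}}"
    using assms unfolding is_edge_creation_def by blast
  obtain a b where ab: "a < b" "{a, b} = {u, v}"
    using uv(1) by (metis insert_commute neqE)
  define m where "m \<longleftrightarrow> mand Q = {{a, b}}"
  have Q: "verts Q = {a, b}" "mand Q = (if m then {{a, b}} else {})" "forb Q = (if m then {} else {{a, b}})"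
    using uv ab(2) by (auto simp: m_def)
  have emb_iff: "emb n E Q f \<longleftrightarrow> f a < f b \<and> f b < n \<and> ({f a, f b} \<in> E \<longleftrightarrow> m)" for n E f
  proof -
    have "strict_mono_on {a, b} f \<longleftrightarrow> f a < f b"
      using ab(1) by (auto simp: strict_mono_on_def)
    then show ?thesis
      unfolding emb_def Q using ab(1) by (auto simp: doubleton_eq_iff insert_commute)
  qed
  have "tab n E B Q \<sigma> \<longleftrightarrow>
      (\<exists>x y. x < y \<and> y < n \<and> ({x, y} \<in> E \<longleftrightarrow> m) \<and> (a \<in> B \<longrightarrow> x = \<sigma> a) \<and> (b \<in> B \<longrightarrow> y = \<sigma> b))"
    (is "_ \<longleftrightarrow> ?R") if B: "B \<subseteq> {a, b}" for n E B \<sigma>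
  proof
    assume "tab n E B Q \<sigma>"
    then show ?R unfolding tab_def emb_iff using B by blast
  next
    assume ?R
    then obtain x y where "x < y" "y < n" "{x, y} \<in> E \<longleftrightarrow> m" "a \<in> B \<longrightarrow> x = \<sigma> a" "b \<in> B \<longrightarrow> y = \<sigma> b"
      by blast
    then show "tab n E B Q \<sigma>"
      unfolding tab_def emb_iff using B ab(1) by (intro exI[of _ "\<lambda>v. if v = a then x else y"]) auto
  qed
  then show thesis using ab(1) Q(1) by (intro that[of a b m]) auto
qed


subsection \<open>Merge trees\<close>

lemma wf_label: "wf_mtree t \<Longrightarrow> wf_apattern (label t)"
  by (cases t) auto

lemma label_in_labels: "label t \<in> labels t"
  by (cases t) auto

lemma finite_labels: "finite (labels t)"
  by (induction t) auto

lemma verts_label_nonempty: "wf_mtree t \<Longrightarrow> verts (label t) \<noteq> {}"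
  by (induction t) (auto simp: is_edge_creation_def is_vertex_creation_def is_merge_def)

text \<open>Hence one finite set, the vertices of the root, provides the registers for all
  nodes.\<close>

lemma verts_labels_subset: "wf_mtree t \<Longrightarrow> Q \<in> labels t \<Longrightarrow> verts Q \<subseteq> verts (label t)"
proof (induction t)
  case (Merge P t1 t2)
  have "verts (label t1) \<union> verts (label t2) = verts P"
    using Merge.prems is_mergeD(2)[of P "label t1" "label t2"] by simp
  then show ?case using Merge by auto
qed (auto simp: is_vertex_creation_def)

fun leaves :: "'a mtree \<Rightarrow> 'a apattern set" where
  "leaves (Leaf P) = {P}"
| "leaves (Create P t) = leaves t"
| "leaves (Merge P t1 t2) = leaves t1 \<union> leaves t2"

lemma leaves_subset_labels: "leaves t \<subseteq> labels t"
  by (induction t) auto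

lemma leaves_wf: "wf_mtree t \<Longrightarrow> Q \<in> leaves t \<Longrightarrow> wf_apattern Q \<and> is_edge_creation Q"
  by (induction t) auto

text \<open>Whatever is put on top of a label, a creation or a merge, requires it to have an anchor;
  so an unanchored leaf can only be the root. This settles p = 0 and excludes such leaves for p =
  1.\<close>

lemma unanchored_leaf:
  "wf_mtree t \<Longrightarrow> Q \<in> leaves t \<Longrightarrow> anchors Q = {} \<Longrightarrow> t = Leaf Q"
proof (induction t)
  case (Create P t)
  then have "t = Leaf Q" by simp
  then show ?case
    using Create.prems creation_anchors_nonempty[of P "label t"] verts_label_nonempty[of t] by auto
next
  case (Merge P t1 t2)
  then have "t1 = Leaf Q \<or> t2 = Leaf Q" by auto
  moreover have "anchors (label t1) \<noteq> {} \<and> anchors (label t2) \<noteq> {}"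
    using Merge.prems(1) verts_label_nonempty[of t1] verts_label_nonempty[of t2]
    by (intro merge_anchors_nonempty[of P]) simp_all
  ultimately show ?case using Merge.prems(3) by auto
qed simp


section \<open>Computing the tables\<close>

lemma powr_bigo_powr:
  assumes "a \<le> b"
  shows "(\<lambda>n::nat. real n powr a) \<in> O(\<lambda>n. real n powr b)"
proof (rule landau_o.bigI[of 1])
  show "\<forall>\<^sub>F n::nat in at_top. norm (real n powr a) \<le> 1 * norm (real n powr b)"
    using eventually_ge_at_top[of 1] by eventually_elim (use assms in \<open>auto intro: powr_mono\<close>)
qed simp

lemma const_bigo_powr:
  assumes "0 \<le> e"
  shows "(\<lambda>n::nat. c) \<in> O(\<lambda>n. real n powr e)"
proof -
  have "(\<lambda>n::nat. c) \<in> O(\<lambda>n. real n powr 0)"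
  proof (rule landau_o.bigI[of "\<bar>c\<bar> + 1"])
    \<comment> \<open>At n = 0 the power with exponent 0 is 0, so constants can be compared only
      from 1 on.\<close>
    show "\<forall>\<^sub>F n::nat in at_top. norm c \<le> (\<bar>c\<bar> + 1) * norm (real n powr 0)"
      using eventually_ge_at_top[of 1] by eventually_elim auto
  qed simp
  from landau_o.big_trans[OF this powr_bigo_powr[OF assms]] show ?thesis .
qed

context free_registers
begin

lemma loops_time_bigo:
  assumes "(\<lambda>n. real (g n)) \<in> O(\<lambda>n. real n powr e)" "0 \<le> e"
  shows "(\<lambda>n. real (loops_time n j (g n))) \<in> O(\<lambda>n. real n powr (e + real j))"
proof (induction j)
  case 0
  then show ?case using assms by simp
next
  case (Suc j)
  let ?f = "\<lambda>n. real n powr (e + real j)"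
  have "(\<lambda>n. real (loops_time n j (g n)) + 4) \<in> O(?f)"
    using Suc assms(2) by (intro sum_in_bigo const_bigo_powr) auto
  then have "(\<lambda>n. real n * (real (loops_time n j (g n)) + 4)) \<in> O(\<lambda>n. real n powr 1 * ?f n)"
    by (intro landau_o.big.mult) simp_all
  moreover have "real n powr 1 * ?f n = real n powr (e + real (Suc j))" for n
  proof -
    have "real n powr 1 * ?f n = real n powr (1 + (e + real j))" by (simp only: powr_add)
    also have "1 + (e + real j) = e + real (Suc j)" by simp
    finally show ?thesis .
  qed
  ultimately have "(\<lambda>n. real n * (real (loops_time n j (g n)) + 4)) \<in> O(\<lambda>n. real n powr (e + real (Suc j)))"
    by simp
  then have "(\<lambda>n. real n * (real (loops_time n j (g n)) + 4) + 3) \<in> O(\<lambda>n. real n powr (e + real (Suc j)))"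
    using assms(2) by (intro sum_in_bigo const_bigo_powr) auto
  then show ?case by (simp add: algebra_simps)
qed

lemma loops_time_const_bigo:
  assumes "real j \<le> e"
  shows "(\<lambda>n. real (loops_time n j t)) \<in> O(\<lambda>n. real n powr e)"
proof (rule landau_o.big_trans[OF _ powr_bigo_powr[OF assms]])
  show "(\<lambda>n. real (loops_time n j t)) \<in> O(\<lambda>n. real n powr real j)"
    using loops_time_bigo[of "\<lambda>_. t" 0 j] const_bigo_powr[of 0 "real t"] by simp
qed

lemma fill_time_bigo:
  assumes "real j \<le> e" "real j' \<le> e"
  shows "(\<lambda>n. real (fill_time n j j' t)) \<in> O(\<lambda>n. real n powr e)"
  unfolding fill_time_def of_nat_add
  using assms by (intro sum_in_bigo loops_time_const_bigo) auto

end

text \<open>\<open>vr\<close> gives every pattern vertex a register, and \<open>base\<close> states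
  what the preprocessing has left in the arrays from \<open>D\<close> to below \<open>B0\<close>; by
  \<open>base_cong\<close> it stays valid as long as these are not written. It is a parameter
  because the preprocessing yields an adjacency matrix for p \<ge> 2 and neighbour information on
  single vertices for p = 1.\<close>

locale detection = free_registers D
  for D :: nat +
  fixes vr :: "'a::linorder \<Rightarrow> nat" and V :: "'a set" and p k B0 :: nat and \<omega> :: real
    and base :: "nat \<Rightarrow> nat set set \<Rightarrow> (nat \<Rightarrow> nat \<Rightarrow> nat) \<Rightarrow> bool"
    and cm :: com and k0 :: nat and T0 :: "nat \<Rightarrow> nat"
  assumes finite_V: "finite V" and inj_vr: "inj_on vr V" and vr_ge: "v \<in> V \<Longrightarrow> D + 8 \<le> vr v"
    and D: "3 \<le> D" "D \<le> B0"
    and k: "k = (p + 2) * k0 + p + 3"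
    and base_cong: "(\<And>a. D \<le> a \<Longrightarrow> a < B0 \<Longrightarrow> M a = M' a) \<Longrightarrow> base n E M \<Longrightarrow> base n E M'"
    and \<omega>: "2 \<le> \<omega>"
    and cm: "wregs cm \<subseteq> {..<D}" "warrs cm \<subseteq> {..<D}"
    and T0: "(\<lambda>n. real (T0 n)) \<in> O(\<lambda>n. real n powr \<omega>)"
    and multiplies_cm: "multiplies cm k0 T0"
begin

text \<open>The origin of \<open>k\<close>. The part p + 3 makes powers of \<open>n\<close> up to p
  + 2 fit strictly into a word. The part (p + 2) * k0 serves products of dimension n ^ m, since n ^
  m + 2 \<le> 4 * (n + 2) ^ m \<le> (n + 2) ^ (m + 2).\<close>

lemma word_size:
  fixes n :: nat
  assumes "(n + 2) ^ k \<le> 2 ^ w"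
  shows "n < 2 ^ w" "1 < (2::nat) ^ w" "j \<le> p + 2 \<Longrightarrow> n ^ j < 2 ^ w"
    "m \<le> p \<Longrightarrow> (n ^ m + 2) ^ k0 \<le> 2 ^ w"
proof -
  have *: "(n + 2) ^ j \<le> 2 ^ w" if "j \<le> k" for j
    using power_increasing[OF that, of "n + 2"] assms by linarith
  from *[of 1] k show "n < 2 ^ w" "1 < (2::nat) ^ w" by auto
  show "n ^ j < 2 ^ w" if "j \<le> p + 2" for j
  proof -
    have "n ^ j \<le> (n + 2) ^ j" by (rule power_mono) auto
    also have "\<dots> < (n + 2) ^ Suc j" by (rule power_strict_increasing) auto
    also have "\<dots> \<le> 2 ^ w" using that k by (intro *) auto
    finally show ?thesis .
  qed
  show "(n ^ m + 2) ^ k0 \<le> 2 ^ w" if "m \<le> p"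
  proof -
    have "n ^ m + 2 \<le> (n + 2) ^ m + 3 * 1" using power_mono[of n "n + 2" m] by simp
    also have "\<dots> \<le> (n + 2) ^ m + 3 * (n + 2) ^ m" by (intro add_left_mono mult_le_mono2) simp
    also have "\<dots> = (2 * 2) * (n + 2) ^ m" by simp
    also have "\<dots> \<le> ((n + 2) * (n + 2)) * (n + 2) ^ m" by (intro mult_le_mono1 mult_le_mono) auto
    also have "\<dots> = (n + 2) ^ (m + 2)"
      unfolding power_add power2_eq_square by (rule mult.commute)
    finally have "(n ^ m + 2) ^ k0 \<le> ((n + 2) ^ (m + 2)) ^ k0" by (rule power_mono) simp
    also have "\<dots> = (n + 2) ^ ((m + 2) * k0)" by (simp only: power_mult)
    also have "\<dots> \<le> 2 ^ w"
    proof (rule *)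
      have "(m + 2) * k0 \<le> (p + 2) * k0" using that by (intro mult_le_mono1) simp
      then show "(m + 2) * k0 \<le> k" unfolding k by linarith
    qed
    finally show ?thesis .
  qed
qed

definition bound :: "nat \<Rightarrow> real" where
  "bound n = real n powr (\<omega> * real p / 2)"

text \<open>From \<omega> \<ge> 2 one has p \<le> \<omega> * p / 2, so work proportional to n ^ p,
  the largest size of a table, is always affordable.\<close>

lemma bound_ge: "e \<le> real p \<Longrightarrow> (\<lambda>n. real n powr e) \<in> O(bound)"
  unfolding bound_def using mult_right_mono[OF \<omega>, of "real p"]
  by (intro powr_bigo_powr) (simp add: field_simps)

lemma fill_time_bound:
  "j \<le> p \<Longrightarrow> j' \<le> p \<Longrightarrow> (\<lambda>n. real (fill_time n j j' t)) \<in> O(bound)"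
  by (rule landau_o.big_trans[OF fill_time_bigo bound_ge[of "real p"]]) auto

lemma const_bound: "(\<lambda>n. c) \<in> O(bound)"
  by (rule landau_o.big_trans[OF const_bigo_powr bound_ge[of 0]]) auto

text \<open>The result is in array \<open>b\<close>. The parameter \<open>a0\<close> lets the programs of different subtrees use
  disjoint sets of arrays: new arrays are taken from \<open>a0\<close> on.\<close>

definition computes :: "(nat \<Rightarrow> nat set set \<Rightarrow> (nat \<Rightarrow> nat) \<Rightarrow> bool) \<Rightarrow> nat \<Rightarrow> com \<Rightarrow> nat \<Rightarrow> nat \<Rightarrow>
    (nat \<Rightarrow> nat) \<Rightarrow> bool" where
  "computes X a0 c b a1 T \<longleftrightarrow> a0 \<le> a1 \<and> D \<le> b \<and> b < a1 \<and>
     warrs c \<subseteq> {..<D} \<union> {a0..<a1} \<and> rn \<notin> wregs c \<and> (\<lambda>n. real (T n)) \<in> O(bound) \<and>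
     (\<forall>n w E s. (n + 2) ^ k \<le> 2 ^ w \<longrightarrow> word_state w s \<longrightarrow> regs s rn = n \<longrightarrow> ordered_graph n E \<longrightarrow>
        base n E (mem s) \<longrightarrow> runs w c s (T n) (\<lambda>s'. X n E (mem s' b)))"

lemma computesD:
  assumes "computes X a0 c b a1 T"
  shows "a0 \<le> a1" "D \<le> b" "b < a1" "warrs c \<subseteq> {..<D} \<union> {a0..<a1}" "rn \<notin> wregs c"
    "(\<lambda>n. real (T n)) \<in> O(bound)"
    "(n + 2) ^ k \<le> 2 ^ w \<Longrightarrow> word_state w s \<Longrightarrow> regs s rn = n \<Longrightarrow> ordered_graph n E \<Longrightarrow>
        base n E (mem s) \<Longrightarrow> runs w c s (T n) (\<lambda>s'. X n E (mem s' b))"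
  using assms by (simp_all add: computes_def)

definition computable :: "(nat \<Rightarrow> nat set set \<Rightarrow> (nat \<Rightarrow> nat) \<Rightarrow> bool) \<Rightarrow> bool" where
  "computable X \<longleftrightarrow> (\<forall>a0\<ge>B0. \<exists>c b a1 T. computes X a0 c b a1 T)"

text \<open>Tables produced by the preprocessing cost nothing further. For their sake
  \<open>computes\<close> allows any result array from \<open>D\<close> on, not only fresh
  ones.\<close>

lemma computable_base:
  assumes "D \<le> b" "b < B0" "\<And>n E M. ordered_graph n E \<Longrightarrow> base n E M \<Longrightarrow> X n E (M b)"
  shows "computable X"
proof -
  have "computes X a0 Skip b a0 (\<lambda>_. 1)" if "B0 \<le> a0" for a0
    using assms that const_bound[of 1] runs_sl[of Skip] by (auto simp: computes_def)
  then show ?thesis unfolding computable_def by blast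
qed

text \<open>The order of the pattern vertices fixes the order of the digits, so the layout of a
  table depends only on its set of vertices and not on the node that produces it.\<close>

definition rlist :: "'a set \<Rightarrow> nat list" where
  "rlist B = map vr (sorted_list_of_set B)"

lemma rlist:
  assumes "B \<subseteq> V"
  shows "set (rlist B) = vr ` B" "distinct (rlist B)" "length (rlist B) = card B"
proof -
  have "finite B" using assms finite_V by (rule finite_subset)
  then show "set (rlist B) = vr ` B" "distinct (rlist B)" "length (rlist B) = card B"
    using inj_on_subset[OF inj_vr assms] by (auto simp: rlist_def distinct_map)
qed

lemma rlist_scratch: "B \<subseteq> V \<Longrightarrow> v \<in> vr ` B \<Longrightarrow> D + 8 \<le> v"
  using vr_ge by auto

definition holds_table :: "'a set \<Rightarrow> 'a apattern \<Rightarrow> nat \<Rightarrow> nat set set \<Rightarrow> (nat \<Rightarrow> nat) \<Rightarrow> bool" where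
  "holds_table B Q n E m \<longleftrightarrow> (\<forall>\<rho>. (\<forall>v\<in>B. \<rho> (vr v) < n) \<longrightarrow>
     m (idx n \<rho> (rlist B)) = of_bool (tab n E B Q (\<lambda>v. \<rho> (vr v))))"

text \<open>The common scheme of projections, vertex creations and leaves: run through all
  placements of \<open>A\<close>, at most n ^ p many, test each in constant time against one input
  array, and mark its restriction to \<open>B\<close>. The test is a function of the array because
  the array number is known only after the program for the input has been chosen.\<close>

lemma computable_fill:
  assumes X: "computable X"
    and B: "B \<subseteq> A" "A \<subseteq> V" "card A \<le> p"
    and test: "\<And>a. loopfree (test a)" "\<And>a. warrs (test a) = {}"
      "\<And>a. wregs (test a) \<subseteq> {ri, rc, ro, rt, ru}" "\<And>a. cost (test a) = tm"
    and tests: "\<And>a n w E M. (n + 2) ^ k \<le> 2 ^ w \<Longrightarrow> ordered_graph n E \<Longrightarrow> X n E (M a) \<Longrightarrow>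
      tests w n {a} M (vr ` A) (test a) (C n E)"
    and C: "\<And>n E \<rho> \<sigma>. ordered_graph n E \<Longrightarrow> (\<And>v. v \<in> B \<Longrightarrow> \<rho> (vr v) < n) \<Longrightarrow>
      (\<exists>\<tau>\<in>ext n (rlist A) \<sigma>. C n E \<tau> \<and> (\<forall>v\<in>B. \<tau> (vr v) = \<rho> (vr v))) \<longleftrightarrow>
      tab n E B Q (\<lambda>v. \<rho> (vr v))"
  shows "computable (holds_table B Q)"
  unfolding computable_def
proof (intro allI impI)
  fix a0 assume a0: "B0 \<le> a0"
  obtain c b a1 T where "computes X a0 c b a1 T"
    using X a0 unfolding computable_def by blast
  note c = computesD(1-6)[OF this] and run = computesD(7)[OF this]
  have BV: "B \<subseteq> V" using B by blast
  have cB: "card B \<le> p" using card_mono[OF finite_subset[OF B(2) finite_V] B(1)] B(3) by linarith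
  note rA = rlist[OF B(2)] and rB = rlist[OF BV]
  have scr: "(set (rlist A) \<union> set (rlist B)) \<inter> {rn, rl, ro, ri, rc, rt, ru} = {}"
    using rlist_scratch[OF B(2)] rlist_scratch[OF BV] by (fastforce simp: rA rB)
  let ?c = "fill (rlist A) (test b) (rlist B) a1"
  let ?T = "\<lambda>n. T n + fill_time n (card A) (card B) tm"
  have "runs w (Seq c ?c) s (?T n) (\<lambda>s'. holds_table B Q n E (mem s' a1))"
    if n: "(n + 2) ^ k \<le> 2 ^ w" and s: "word_state w s" "regs s rn = n" and E: "ordered_graph n E"
      and base: "base n E (mem s)" for n w E s
  proof (rule runs_SeqI[OF run[OF n s E base] s(1)])
    fix s1
    assume s1: "X n E (mem s1 b)" "word_state w s1" "\<And>r. r \<notin> wregs c \<Longrightarrow> regs s1 r = regs s r"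
    have "runs w ?c s1 (fill_time n (length (rlist A)) (length (rlist B)) (cost (test b)))
      (\<lambda>s'. \<forall>\<rho>. (\<forall>v\<in>set (rlist B). \<rho> v < n) \<longrightarrow> mem s' a1 (idx n \<rho> (rlist B)) =
        of_bool (\<exists>\<tau>\<in>ext n (rlist A) (regs s1). C n E \<tau> \<and> (\<forall>v\<in>set (rlist B). \<tau> v = \<rho> v)))"
    proof (rule runs_fill[where U = "{}" and K = "{b}" and M = "mem s1"])
      show "tests w n {b} (mem s1) (set (rlist A) \<union> {}) (test b) (C n E)"
        using tests[where M = "mem s1" and a = b, OF n E s1(1)] by (simp add: rA)
      show "wregs (test b) \<inter> ({rn} \<union> set (rlist A) \<union> {}) = {}"
        using test(3)[of b] scr by fastforce
      show "n ^ length (rlist B) \<le> 2 ^ w" using word_size(3)[OF n, of "card B"] cB rB by simp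
      show "loopfree (test b)" "warrs (test b) = {}" by (fact test)+
      show "set (rlist B) \<subseteq> set (rlist A)" using B(1) by (auto simp: rA rB)
      show "distinct (rlist A)" "distinct (rlist B)" by (fact rA rB)+
      show "(set (rlist A) \<union> {}) \<inter> {rn, rl, ro, ri, rc} = {}" using scr by blast
      show "a1 \<notin> {b}" using c(3) by simp
      show "n < 2 ^ w" "1 < (2::nat) ^ w" by (fact word_size[OF n])+
      show "word_state w s1" "regs s1 rn = n" using s1(2) s1(3)[OF c(5)] s(2) by auto
    qed simp_all
    then show "runs w ?c s1 (fill_time n (card A) (card B) tm) (\<lambda>s'. holds_table B Q n E (mem s' a1))"
    proof (rule runs_mono)
      fix s'
      assume s': "\<forall>\<rho>. (\<forall>v\<in>set (rlist B). \<rho> v < n) \<longrightarrow> mem s' a1 (idx n \<rho> (rlist B)) =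
        of_bool (\<exists>\<tau>\<in>ext n (rlist A) (regs s1). C n E \<tau> \<and> (\<forall>v\<in>set (rlist B). \<tau> v = \<rho> v))"
      show "holds_table B Q n E (mem s' a1)"
        unfolding holds_table_def
      proof (intro allI impI)
        fix \<rho> assume \<rho>: "\<forall>v\<in>B. \<rho> (vr v) < n"
        have "mem s' a1 (idx n \<rho> (rlist B)) =
            of_bool (\<exists>\<tau>\<in>ext n (rlist A) (regs s1). C n E \<tau> \<and> (\<forall>v\<in>B. \<tau> (vr v) = \<rho> (vr v)))"
          using s' \<rho> by (simp add: rB)
        also have "\<dots> = of_bool (tab n E B Q (\<lambda>v. \<rho> (vr v)))"
          using C[OF E] \<rho> by simp
        finally show "mem s' a1 (idx n \<rho> (rlist B)) = of_bool (tab n E B Q (\<lambda>v. \<rho> (vr v)))" .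
      qed
    qed (simp add: rA rB test)
  qed
  moreover have "warrs (Seq c ?c) \<subseteq> {..<D} \<union> {a0..<a1 + 1}"
    using c by (auto simp: warrs_fill test)
  moreover have "rn \<notin> wregs (Seq c ?c)"
    using c(5) wregs_fill[of "rlist A" "test b" "rlist B" a1] scr test(3)[of b] by fastforce
  moreover have "(\<lambda>n. real (?T n)) \<in> O(bound)"
    unfolding of_nat_add using c(6) cB B(3) by (intro sum_in_bigo fill_time_bound)
  ultimately have "computes (holds_table B Q) a0 (Seq c ?c) a1 (a1 + 1) ?T"
    using c(1-3) unfolding computes_def by auto
  then show "\<exists>c b a1 T. computes (holds_table B Q) a0 c b a1 T" by blast
qed

lemma register_assignment:
  assumes "B \<subseteq> V" "\<And>v. v \<in> B \<Longrightarrow> \<tau> v < n"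
  obtains \<rho> where "\<rho> \<in> ext n (rlist B) \<sigma>" "\<And>v. v \<in> B \<Longrightarrow> \<rho> (vr v) = \<tau> v"
proof
  let ?\<rho> = "\<lambda>r. if r \<in> vr ` B then \<tau> (inv_into V vr r) else \<sigma> r"
  have "inv_into V vr (vr v) = v" if "v \<in> B" for v
    using that assms(1) inj_vr by (simp add: subset_iff)
  then show "?\<rho> \<in> ext n (rlist B) \<sigma>" "\<And>v. v \<in> B \<Longrightarrow> ?\<rho> (vr v) = \<tau> v"
    using assms by (auto simp: ext_def rlist)
qed

lemma tests_table:
  assumes "A \<subseteq> V" "card A \<le> p" "(n + 2) ^ k \<le> 2 ^ w" "holds_table A Q n E (M a)" "vr ` A \<subseteq> U" "ri \<notin> U"
  shows "tests w n {a} M U (lookup a (rlist A)) (\<lambda>\<rho>. tab n E A Q (\<lambda>v. \<rho> (vr v)))"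
proof -
  have t: "tests w n {a} M U (lookup a (rlist A)) (\<lambda>\<rho>. M a (idx n \<rho> (rlist A)) \<noteq> 0)"
    using assms word_size(3)[OF assms(3), of "card A"]
    by (intro tests_lookup) (auto simp: rlist)
  show ?thesis
    unfolding tests_def
  proof (intro allI impI)
    fix \<sigma> s
    assume s: "word_state w s" "regs s rn = n" "\<forall>a\<in>{a}. mem s a = M a" "\<forall>u\<in>U. regs s u = \<sigma> u \<and> \<sigma> u < n"
    then have "(regs (sl w (lookup a (rlist A)) s) rc \<noteq> 0) = (M a (idx n \<sigma> (rlist A)) \<noteq> 0)"
      using t unfolding tests_def by blast
    also have "M a (idx n \<sigma> (rlist A)) = of_bool (tab n E A Q (\<lambda>v. \<sigma> (vr v)))"
      using assms(4)[unfolded holds_table_def, THEN spec[of _ \<sigma>]] assms(5) s(4) by auto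
    also have "(\<dots> \<noteq> 0) = tab n E A Q (\<lambda>v. \<sigma> (vr v))" by simp
    finally show "(regs (sl w (lookup a (rlist A)) s) rc \<noteq> 0) = tab n E A Q (\<lambda>v. \<sigma> (vr v))" .
  qed
qed

lemma computable_forget:
  assumes X: "computable (holds_table A Q)" and A: "B \<subseteq> A" "A \<subseteq> V" "card A \<le> p" "A \<subseteq> verts Q"
  shows "computable (holds_table B Q)"
proof (rule computable_fill[OF X A(1-3), where test = "\<lambda>a. lookup a (rlist A)" and
      C = "\<lambda>n E \<rho>. tab n E A Q (\<lambda>v. \<rho> (vr v))" and tm = "3 + 2 * card A"])
  show "tests w n {a} M (vr ` A) (lookup a (rlist A)) (\<lambda>\<rho>. tab n E A Q (\<lambda>v. \<rho> (vr v)))"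
    if "(n + 2) ^ k \<le> 2 ^ w" "holds_table A Q n E (M a)" for a n w E M
    using that A rlist_scratch[OF A(2)] by (intro tests_table) fastforce+
  show "(\<exists>\<tau>\<in>ext n (rlist A) \<sigma>. tab n E A Q (\<lambda>v. \<tau> (vr v)) \<and> (\<forall>v\<in>B. \<tau> (vr v) = \<rho> (vr v))) \<longleftrightarrow>
      tab n E B Q (\<lambda>v. \<rho> (vr v))" (is "?L \<longleftrightarrow> _") for n E \<rho> \<sigma>
  proof
    assume ?L
    then show "tab n E B Q (\<lambda>v. \<rho> (vr v))" unfolding tab_forget[OF A(1)] by blast
  next
    assume "tab n E B Q (\<lambda>v. \<rho> (vr v))"
    then obtain \<tau> where \<tau>: "tab n E A Q \<tau>" "\<forall>v\<in>B. \<tau> v = \<rho> (vr v)"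
      unfolding tab_forget[OF A(1)] by blast
    \<comment> \<open>The witness has values below \<open>n\<close>, so the loops meet it.\<close>
    obtain \<rho>' where "\<rho>' \<in> ext n (rlist A) \<sigma>" "\<And>v. v \<in> A \<Longrightarrow> \<rho>' (vr v) = \<tau> v"
      using register_assignment[of A \<tau> n \<sigma>] tab_less[OF \<tau>(1) A(4)] A(2) by metis
    then show ?L using \<tau> A(1) tab_cong[of A "\<lambda>v. \<rho>' (vr v)" \<tau> n E Q] by (intro bexI[of _ \<rho>']) auto
  qed
qed (use wregs_lookup rlist[OF A(2)] in auto)

end


context free_registers
begin

section \<open>Gap tests, powers of the number of vertices, slices of tables\<close>

lemma auxiliary_disjoint:
  assumes "W \<subseteq> {rl, ro, ri, rc, rt, ru}" "\<And>v. v \<in> S \<Longrightarrow> v = rn \<or> D + 8 \<le> v"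
  shows "W \<inter> S = {}"
proof (rule equals0I)
  fix r assume "r \<in> W \<inter> S"
  then have "r \<in> {rl, ro, ri, rc, rt, ru}" "r = rn \<or> D + 8 \<le> r" using assms by blast+
  moreover from this(1) have "D < r \<and> r < D + 8" by auto
  ultimately show False by linarith
qed

text \<open>The machine compares only by \<open>Less\<close>, so \<open>lower\<close> \<le> x is
  tested as \<open>lower\<close> < x + 1. The upper limit needs no arithmetic and is read directly
  from a register.\<close>

definition gap_test :: "nat option \<Rightarrow> nat option \<Rightarrow> nat option \<Rightarrow> com" where
  "gap_test xo a b =
     Seq (case a of None \<Rightarrow> Const rt 0 | Some u \<Rightarrow> Seq (Const ro 1) (Op Add rt u ro))
       (let h = (case b of None \<Rightarrow> rn | Some u \<Rightarrow> u) in
        case xo of None \<Rightarrow> Op Less rc rt h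
        | Some x \<Rightarrow> Seq (Seq (Const ro 1) (Op Add ru x ro)) (Seq (Op Less rc rt ru) (If rc (Op Less rc x h) Skip)))"

lemma gap_test_simps [simp]: "loopfree (gap_test xo a b)" "warrs (gap_test xo a b) = {}"
  and wregs_gap_test: "wregs (gap_test xo a b) \<subseteq> {ro, rc, rt, ru}"
  by (auto simp: gap_test_def split: option.splits)

lemma tests_gap:
  assumes "set_option xo \<union> set_option a \<union> set_option b \<subseteq> U" "U \<inter> {rn, ro, rc, rt, ru} = {}"
    and "n < 2 ^ w" "1 < (2 :: nat) ^ w"
  shows "tests w n K M U (gap_test xo a b)
    (\<lambda>\<sigma>. case xo of None \<Rightarrow> lower a \<sigma> < upper n b \<sigma> | Some x \<Rightarrow> lower a \<sigma> \<le> \<sigma> x \<and> \<sigma> x < upper n b \<sigma>)"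
  unfolding tests_def
proof (intro allI impI)
  fix \<sigma> and s :: state
  assume s: "regs s rn = n" "\<forall>u\<in>U. regs s u = \<sigma> u \<and> \<sigma> u < n"
  have *: "regs s u = \<sigma> u \<and> \<sigma> u < n \<and> Suc (\<sigma> u) < 2 ^ w \<and> \<sigma> u < 2 ^ w \<and> u \<noteq> rn \<and> u \<noteq> ro \<and> u \<noteq> rc \<and> u \<noteq> rt \<and> u \<noteq> ru"
    if "u \<in> set_option xo \<union> set_option a \<union> set_option b" for u
  proof -
    have "u \<in> U" using assms(1) that by blast
    then show ?thesis using s(2) assms(2,3) by fastforce
  qed
  have w: "0 < w" using assms(4) by (cases w) auto
  let ?lo = "case a of None \<Rightarrow> Const rt 0 | Some u \<Rightarrow> Seq (Const ro 1) (Op Add rt u ro)"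
  define h where "h = (case b of None \<Rightarrow> rn | Some u \<Rightarrow> u)"
  define s1 where "s1 = sl w ?lo s"
  have lo: "regs s1 rt = lower a \<sigma>"
  proof (cases a)
    case (Some u)
    then show ?thesis using *[of u] w by (simp add: s1_def lower_def)
  qed (simp add: s1_def lower_def)
  have r1: "regs s1 r = regs s r" if "r \<noteq> rt" "r \<noteq> ro" for r
    unfolding s1_def using that by (intro sl_regs) (auto split: option.splits)
  have h: "regs s1 h = upper n b \<sigma>" "h \<noteq> ro" "h \<noteq> ru" "h \<noteq> rc"
    using *[of "the b"] s(1) r1[of h] by (cases b; simp add: upper_def h_def)+
  show "(regs (sl w (gap_test xo a b) s) rc \<noteq> 0) =
    (case xo of None \<Rightarrow> lower a \<sigma> < upper n b \<sigma> | Some x \<Rightarrow> lower a \<sigma> \<le> \<sigma> x \<and> \<sigma> x < upper n b \<sigma>)"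
  proof (cases xo)
    case None
    have "sl w (gap_test xo a b) s = sl w (Op Less rc rt h) s1"
      by (simp add: gap_test_def None s1_def h_def)
    then show ?thesis using None lo h w by simp
  next
    case (Some x)
    have x: "regs s1 x = \<sigma> x" "Suc (\<sigma> x) < 2 ^ w" "x \<noteq> rc" "x \<noteq> ro" "x \<noteq> ru"
      using *[of x] Some r1[of x] by simp_all
    have "sl w (gap_test xo a b) s = sl w (Seq (Seq (Const ro 1) (Op Add ru x ro))
        (Seq (Op Less rc rt ru) (If rc (Op Less rc x h) Skip))) s1"
      by (simp add: gap_test_def Some s1_def h_def Let_def del: sl.simps(6))
    then have "(regs (sl w (gap_test xo a b) s) rc \<noteq> 0) = (lower a \<sigma> < Suc (\<sigma> x) \<and> \<sigma> x < upper n b \<sigma>)"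
      by (simp add: lo h x w h[simplified] x[simplified])
    then show ?thesis by (simp add: Some less_Suc_eq_le)
  qed
qed

text \<open>Register 0 is where the multiplication program expects the dimension of its
  matrices.\<close>

primrec mult_n :: "nat \<Rightarrow> com" where
  "mult_n 0 = Const 0 1"
| "mult_n (Suc m) = Seq (mult_n m) (Op Mul 0 0 rn)"

lemma mult_n_simps [simp]:
  "loopfree (mult_n m)" "wregs (mult_n m) = {0}" "warrs (mult_n m) = {}" "cost (mult_n m) = Suc m"
  by (induction m) auto

lemma sl_mult_n:
  assumes "0 < D" "regs s rn = n" "\<And>j. j \<le> m \<Longrightarrow> n ^ j < 2 ^ w"
  shows "regs (sl w (mult_n m) s) 0 = n ^ m"
  using assms(3)
proof (induction m)
  case 0
  then show ?case using 0[of 0] by (cases w) auto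
next
  case (Suc m)
  have "regs (sl w (mult_n m) s) rn = n"
    using sl_regs[of "mult_n m" rn] assms(1,2) by simp
  moreover have "regs (sl w (mult_n m) s) 0 = n ^ m"
    by (rule Suc.IH) (rule Suc.prems, simp)
  moreover have "n * n ^ m < 2 ^ w" using Suc.prems[of "Suc m"] by simp
  ultimately show ?case by (simp add: mult.commute)
qed

text \<open>Extracts the slice of a table given by the fixed registers \<open>U\<close> and lays it
  out along \<open>L\<close>, with entries 0 and 1. For a list \<open>X @ Z\<close> with halves of
  equal length this produces a square matrix in the format of \<open>holds_matrix\<close>.\<close>

lemma runs_fill_lookup:
  assumes "a \<in> K" "b \<notin> K" "set La \<subseteq> set L \<union> U" "n ^ length La \<le> 2 ^ w" "n ^ length L \<le> 2 ^ w"
    and L: "distinct L" "set L \<inter> U = {}" "(set L \<union> U) \<inter> {rn, rl, ro, ri, rc} = {}"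
    and n: "n < 2 ^ w" "1 < (2 :: nat) ^ w"
    and s: "word_state w s" "regs s rn = n" "\<forall>a\<in>K. mem s a = M a" "\<forall>u\<in>U. regs s u = \<sigma> u \<and> \<sigma> u < n"
  shows "runs w (fill L (lookup a La) L b) s (fill_time n (length L) (length L) (3 + 2 * length La))
    (\<lambda>s'. \<forall>\<rho>. (\<forall>v\<in>set L. \<rho> v < n) \<and> (\<forall>u\<in>U. \<rho> u = \<sigma> u) \<longrightarrow>
       mem s' b (idx n \<rho> L) = of_bool (M a (idx n \<rho> La) \<noteq> 0))"
proof -
  have "runs w (fill L (lookup a La) L b) s (fill_time n (length L) (length L) (cost (lookup a La)))
    (\<lambda>s'. \<forall>\<rho>. (\<forall>v\<in>set L. \<rho> v < n) \<longrightarrow>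
       mem s' b (idx n \<rho> L) =
       of_bool (\<exists>\<tau>\<in>ext n L \<sigma>. M a (idx n \<tau> La) \<noteq> 0 \<and> (\<forall>v\<in>set L. \<tau> v = \<rho> v)))"
    using assms wregs_lookup[of a La]
    by (intro runs_fill[where K = K and M = M] tests_lookup) auto
  then show ?thesis
  proof (rule runs_mono)
    fix s'
    assume s': "\<forall>\<rho>. (\<forall>v\<in>set L. \<rho> v < n) \<longrightarrow>
       mem s' b (idx n \<rho> L) =
       of_bool (\<exists>\<tau>\<in>ext n L \<sigma>. M a (idx n \<tau> La) \<noteq> 0 \<and> (\<forall>v\<in>set L. \<tau> v = \<rho> v))"
    show "\<forall>\<rho>. (\<forall>v\<in>set L. \<rho> v < n) \<and> (\<forall>u\<in>U. \<rho> u = \<sigma> u) \<longrightarrow>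
       mem s' b (idx n \<rho> L) = of_bool (M a (idx n \<rho> La) \<noteq> 0)"
    proof (intro allI impI, elim conjE)
      fix \<rho> assume \<rho>: "\<forall>v\<in>set L. \<rho> v < n" "\<forall>u\<in>U. \<rho> u = \<sigma> u"
      \<comment> \<open>Such an assignment equals \<open>\<rho>\<close> on \<open>L\<close> and on
        \<open>U\<close>, so the existential quantifier of \<open>runs_fill\<close> collapses to a
        single look-up.\<close>
      have *: "idx n \<tau> La = idx n \<rho> La" if "\<tau> \<in> ext n L \<sigma>" "\<forall>v\<in>set L. \<tau> v = \<rho> v" for \<tau>
      proof (rule idx_cong)
        fix v assume "v \<in> set La"
        then have "v \<in> set L \<or> v \<in> U" using assms(3) by blast
        then show "\<tau> v = \<rho> v" using that \<rho>(2) L(2) by (auto simp: ext_def)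
      qed
      let ?\<rho> = "\<lambda>v. if v \<in> set L then \<rho> v else \<sigma> v"
      have \<rho>': "?\<rho> \<in> ext n L \<sigma>" "\<forall>v\<in>set L. ?\<rho> v = \<rho> v" using \<rho>(1) by (auto simp: ext_def)
      have "(\<exists>\<tau>\<in>ext n L \<sigma>. M a (idx n \<tau> La) \<noteq> 0 \<and> (\<forall>v\<in>set L. \<tau> v = \<rho> v)) \<longleftrightarrow> M a (idx n \<rho> La) \<noteq> 0"
      proof
        assume "M a (idx n \<rho> La) \<noteq> 0"
        then have "M a (idx n ?\<rho> La) \<noteq> 0" using *[OF \<rho>'] by simp
        then show "\<exists>\<tau>\<in>ext n L \<sigma>. M a (idx n \<tau> La) \<noteq> 0 \<and> (\<forall>v\<in>set L. \<tau> v = \<rho> v)"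
          using \<rho>' by (intro bexI[of _ ?\<rho>] conjI)
      qed (use * in auto)
      then show "mem s' b (idx n \<rho> L) = of_bool (M a (idx n \<rho> La) \<noteq> 0)"
        using s' \<rho>(1) by simp
    qed
  qed simp
qed

end

context detection
begin

text \<open>Each of the at most n ^ p placements of the anchors costs one comparison with the
  neighbouring anchors and one look-up in the table of the child.\<close>

lemma computable_creation:
  assumes X: "computable (holds_table (anchors P') P')"
    and c: "is_vertex_creation P P'" and wf: "wf_apattern P" "wf_apattern P'"
    and V: "verts P \<subseteq> V" "card (anchors P) \<le> p"
  shows "computable (holds_table (anchors P) P)"
proof -
  obtain x a b where x: "x \<notin> anchors P'" "anchors P \<subseteq> insert x (anchors P')" "anchors P' \<subseteq> anchors P"
    and ab: "set_option a \<subseteq> anchors P'" "set_option b \<subseteq> anchors P'"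
    and iff: "\<And>n E \<sigma>. tab n E (anchors P) P \<sigma> \<longleftrightarrow> tab n E (anchors P') P' \<sigma> \<and>
      (if x \<in> anchors P then lower a \<sigma> \<le> \<sigma> x \<and> \<sigma> x < upper n b \<sigma> else lower a \<sigma> < upper n b \<sigma>)"
    using tab_creation[OF c wf] by metis
  define A A' where "A = anchors P" and "A' = anchors P'"
  note A_defs = A_def[symmetric] A'_def[symmetric]
  note x = x[unfolded A_defs] and ab = ab[unfolded A_defs] and iff = iff[unfolded A_defs]
  have AV: "A \<subseteq> V" and A'V: "A' \<subseteq> V" and Ap: "card A \<le> p"
    using V wf(1) x(3) unfolding A_def wf_apattern_def by blast+
  have A'p: "card A' \<le> p"
    using card_mono[OF finite_subset[OF AV finite_V] x(3)] Ap by linarith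
  define xo where "xo = (if x \<in> A then Some x else None)"
  define cond where "cond n \<sigma> \<longleftrightarrow> (case xo of None \<Rightarrow> lower a \<sigma> < upper n b \<sigma>
    | Some x \<Rightarrow> lower a \<sigma> \<le> \<sigma> x \<and> \<sigma> x < upper n b \<sigma>)" for n and \<sigma> :: "'a \<Rightarrow> nat"
  have tab_iff: "tab n E A P \<sigma> \<longleftrightarrow> cond n \<sigma> \<and> tab n E A' P' \<sigma>" for n E \<sigma>
    unfolding iff by (auto simp: cond_def xo_def)
  have sub: "set_option xo \<union> set_option a \<union> set_option b \<subseteq> A"
    using ab x(3) by (auto simp: xo_def split: if_splits)
  have cond_cong: "cond n \<sigma> = cond n \<tau>" if "\<And>v. v \<in> A \<Longrightarrow> \<sigma> v = \<tau> v" for n \<sigma> \<tau>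
    using that sub by (auto simp: cond_def lower_def upper_def split: option.splits)
  let ?gap = "gap_test (map_option vr xo) (map_option vr a) (map_option vr b)"
  let ?test = "\<lambda>c. test_and ?gap (lookup c (rlist A'))"
  have scr: "vr ` A \<inter> {rn, rl, ro, ri, rc, rt, ru} = {}"
    using rlist_scratch[OF AV] by fastforce
  have "computable (holds_table A P)"
  proof (rule computable_fill[OF X[folded A'_def], where A = A and test = ?test and
        C = "\<lambda>n E \<rho>. cond n (\<lambda>v. \<rho> (vr v)) \<and> tab n E A' P' (\<lambda>v. \<rho> (vr v))" and tm = "cost (?test 0)"])
    show "tests w n {c} M (vr ` A) (?test c)
      (\<lambda>\<rho>. cond n (\<lambda>v. \<rho> (vr v)) \<and> tab n E A' P' (\<lambda>v. \<rho> (vr v)))"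
      if "(n + 2) ^ k \<le> 2 ^ w" "ordered_graph n E" "holds_table A' P' n E (M c)" for c n w E M
    proof (rule tests_and)
      have "tests w n {c} M (vr ` A) ?gap (\<lambda>\<rho>. case map_option vr xo of
          None \<Rightarrow> lower (map_option vr a) \<rho> < upper n (map_option vr b) \<rho>
        | Some x \<Rightarrow> lower (map_option vr a) \<rho> \<le> \<rho> x \<and> \<rho> x < upper n (map_option vr b) \<rho>)"
        using sub scr word_size[OF that(1)] by (intro tests_gap) auto
      moreover have "(case map_option vr xo of
          None \<Rightarrow> lower (map_option vr a) \<rho> < upper n (map_option vr b) \<rho>
        | Some x \<Rightarrow> lower (map_option vr a) \<rho> \<le> \<rho> x \<and> \<rho> x < upper n (map_option vr b) \<rho>) =
        cond n (\<lambda>v. \<rho> (vr v))" for \<rho>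
        by (auto simp: cond_def lower_def upper_def split: option.splits)
      ultimately show "tests w n {c} M (vr ` A) ?gap (\<lambda>\<rho>. cond n (\<lambda>v. \<rho> (vr v)))" by simp
      show "tests w n {c} M (vr ` A) (lookup c (rlist A')) (\<lambda>\<rho>. tab n E A' P' (\<lambda>v. \<rho> (vr v)))"
      proof (rule tests_table[where E = E and Q = P', OF A'V A'p that(1)])
        show "holds_table A' P' n E (M c)" by (fact that(3))
        show "vr ` A' \<subseteq> vr ` A" by (rule image_mono[OF x(3)])
        show "ri \<notin> vr ` A" using scr by (auto simp: disjoint_iff)
      qed
      show "wregs ?gap \<inter> ({rn} \<union> vr ` A) = {}"
      proof (rule auxiliary_disjoint)
        show "wregs ?gap \<subseteq> {rl, ro, ri, rc, rt, ru}" by (rule order_trans[OF wregs_gap_test]) simp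
      qed (use rlist_scratch[OF AV] in blast)
    qed simp_all
    show "wregs (?test c) \<subseteq> {ri, rc, ro, rt, ru}" for c
      using wregs_gap_test[of "map_option vr xo" "map_option vr a" "map_option vr b"]
        wregs_lookup[of c "rlist A'"] by auto
    show "cost (?test c) = cost (?test 0)" for c by (simp add: test_and_def)
    show "(\<exists>\<tau>\<in>ext n (rlist A) \<sigma>. (cond n (\<lambda>v. \<tau> (vr v)) \<and> tab n E A' P' (\<lambda>v. \<tau> (vr v))) \<and>
        (\<forall>v\<in>A. \<tau> (vr v) = \<rho> (vr v))) \<longleftrightarrow> tab n E A P (\<lambda>v. \<rho> (vr v))" (is "?L \<longleftrightarrow> _")
      if "\<And>v. v \<in> A \<Longrightarrow> \<rho> (vr v) < n" for n E \<rho> \<sigma>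
    proof -
      have *: "tab n E A P (\<lambda>v. \<tau> (vr v)) \<longleftrightarrow> tab n E A P (\<lambda>v. \<rho> (vr v))"
        if "\<forall>v\<in>A. \<tau> (vr v) = \<rho> (vr v)" for \<tau>
        using that by (intro tab_cong) auto
      obtain \<rho>' where "\<rho>' \<in> ext n (rlist A) \<sigma>" "\<And>v. v \<in> A \<Longrightarrow> \<rho>' (vr v) = \<rho> (vr v)"
        using register_assignment[OF AV, of "\<lambda>v. \<rho> (vr v)" n \<sigma>] \<open>\<And>v. v \<in> A \<Longrightarrow> \<rho> (vr v) < n\<close> by metis
      then show ?thesis unfolding tab_iff[symmetric] using * by blast
    qed
  qed (use AV Ap in auto)
  then show ?thesis unfolding A_def .
qed


subsection \<open>Merging by matrix multiplication\<close>

text \<open>One square product for fixed values of the remaining registers. Register 0 and arrays 0,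
  1, 2 are the interface of \<open>cm\<close>; the input in arrays 0 and 1 is lost here, but what is
  needed of it has been stored from \<open>D\<close> on. The result array is only marked, never
  cleared, as it may already contain marks of other blocks.\<close>

definition block :: "nat list \<Rightarrow> nat list \<Rightarrow> nat list \<Rightarrow> nat list \<Rightarrow> nat list \<Rightarrow> nat list \<Rightarrow> nat \<Rightarrow> nat \<Rightarrow> nat \<Rightarrow> com" where
  "block X Y Z L1 L2 L3 a1 a2 b =
     Seq (fill (X @ Z) (lookup a1 L1) (X @ Z) 0)
    (Seq (fill (Z @ Y) (lookup a2 L2) (Z @ Y) 1)
    (Seq (mult_n (length Z))
    (Seq cm
      (for_all_set (X @ Y) (lookup 2 (X @ Y)) L3 b 1))))"

definition block_time :: "nat \<Rightarrow> nat \<Rightarrow> nat \<Rightarrow> nat \<Rightarrow> nat \<Rightarrow> nat" where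
  "block_time m l1 l2 l3 n =
     fill_time n (m + m) (m + m) (3 + 2 * l1) + (fill_time n (m + m) (m + m) (3 + 2 * l2) +
     (Suc m + (T0 (n ^ m) + loops_time n (m + m) (3 + 2 * (m + m) + 2 * l3 + 5))))"

lemma wregs_block: "wregs (block X Y Z L1 L2 L3 a1 a2 b) \<subseteq>
    set X \<union> set Y \<union> set Z \<union> {rl, ro, ri, rc} \<union> {..<D}"
  and warrs_block: "warrs (block X Y Z L1 L2 L3 a1 a2 b) \<subseteq> insert b {..<D}"
  using wregs_fill[of "X @ Z" "lookup a1 L1" "X @ Z" 0] wregs_fill[of "Z @ Y" "lookup a2 L2" "Z @ Y" 1]
    wregs_for_all_set[of "X @ Y" "lookup 2 (X @ Y)" L3 b 1] D(1) cm
    wregs_lookup[of a1 L1] wregs_lookup[of a2 L2] wregs_lookup[of 2 "X @ Y"]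
  by (auto simp: block_def warrs_fill warrs_for_all_set)

lemma matrix_prod_nonzero: "matrix_prod N A B i j \<noteq> 0 \<longleftrightarrow> (\<exists>l<N. A i l \<noteq> 0 \<and> B l j \<noteq> 0)"
  by (auto simp: matrix_prod_def)

lemma acc_block:
  assumes n: "(n + 2) ^ k \<le> 2 ^ w"
    and len: "length X = m" "length Y = m" "length Z = m" "2 * m \<le> p"
      "length L1 \<le> p" "length L2 \<le> p" "length L3 \<le> p"
    and dist: "distinct (X @ Y @ Z @ R)" and scr: "\<And>v. v \<in> set (X @ Y @ Z @ R) \<Longrightarrow> D + 8 \<le> v"
    and sub: "set L1 \<subseteq> set X \<union> set Z \<union> set R" "set L2 \<subseteq> set Z \<union> set Y \<union> set R"
      "set L3 \<subseteq> set X \<union> set Y \<union> set R"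
    and arr: "D \<le> a1" "D \<le> a2" "D \<le> b" "b \<noteq> a1" "b \<noteq> a2"
  shows "acc w n {a1, a2} M b 1 (set R) (block X Y Z L1 L2 L3 a1 a2 b)
    (\<lambda>\<sigma>. {idx n \<tau> L3 |\<tau>. \<tau> \<in> ext n (X @ Y) \<sigma> \<and>
       (\<exists>\<tau>'\<in>ext n Z \<tau>. M a1 (idx n \<tau>' L1) \<noteq> 0 \<and> M a2 (idx n \<tau>' L2) \<noteq> 0)})
    (block_time m (length L1) (length L2) (length L3) n)"
  unfolding acc_def
proof (intro allI impI)
  fix \<sigma> s
  assume s: "word_state w s" "regs s rn = n" "\<forall>a\<in>{a1, a2}. mem s a = M a"
    and s\<sigma>: "\<forall>u\<in>set R. regs s u = \<sigma> u \<and> \<sigma> u < n"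
  define N where "N = n ^ m"
  have n': "n < 2 ^ w" "1 < (2::nat) ^ w" "\<And>j. j \<le> p \<Longrightarrow> n ^ j \<le> 2 ^ w"
    using word_size(1,2)[OF n] word_size(3)[OF n] by (auto intro: less_imp_le)
  have big: "(set X \<union> set Y \<union> set Z \<union> set R) \<inter> ({rn, rl, ro, ri, rc} \<union> {..<D}) = {}"
    using scr by fastforce
  have a_ge: "2 < a1" "2 < a2" "2 < b" using arr D by auto
  let ?S = "{idx n \<tau> L3 |\<tau>. \<tau> \<in> ext n (X @ Y) \<sigma> \<and>
       (\<exists>\<tau>'\<in>ext n Z \<tau>. M a1 (idx n \<tau>' L1) \<noteq> 0 \<and> M a2 (idx n \<tau>' L2) \<noteq> 0)}"
  have t1: "runs w (fill (X @ Z) (lookup a1 L1) (X @ Z) 0) s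
      (fill_time n (length (X @ Z)) (length (X @ Z)) (3 + 2 * length L1))
    (\<lambda>s'. \<forall>\<rho>. (\<forall>v\<in>set (X @ Z). \<rho> v < n) \<and> (\<forall>u\<in>set R. \<rho> u = \<sigma> u) \<longrightarrow>
       mem s' 0 (idx n \<rho> (X @ Z)) = of_bool (M a1 (idx n \<rho> L1) \<noteq> 0))"
  proof (rule runs_fill_lookup[where K = "{a1, a2}"])
    show "n ^ length L1 \<le> 2 ^ w" "n ^ length (X @ Z) \<le> 2 ^ w" using len by (auto intro!: n'(3))
    show "(set (X @ Z) \<union> set R) \<inter> {rn, rl, ro, ri, rc} = {}" using big by auto
  qed (use s s\<sigma> n' a_ge dist sub in auto)
  have "runs w (block X Y Z L1 L2 L3 a1 a2 b) s
     (fill_time n (length (X @ Z)) (length (X @ Z)) (3 + 2 * length L1) +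
     (fill_time n (length (Z @ Y)) (length (Z @ Y)) (3 + 2 * length L2) +
     (Suc m + (T0 N + loops_time n (length (X @ Y)) (cost (lookup 2 (X @ Y)) + 2 * length L3 + 5)))))
     (\<lambda>s'. mem s' b = (\<lambda>i. if i \<in> ?S then 1 else mem s b i))"
    unfolding block_def
  proof (rule runs_SeqI[OF t1 s(1)], goal_cases)
    case (1 s1)
    note s1 = 1
    have r1: "regs s1 r = regs s r" if "r \<in> insert rn (set R)" for r
    proof (rule s1(3))
      have "r \<notin> set (X @ Z) \<union> {rl, ro, ri, rc}" using that dist big scr by fastforce
      then show "r \<notin> wregs (fill (X @ Z) (lookup a1 L1) (X @ Z) 0)"
        using wregs_fill[of "X @ Z" "lookup a1 L1" "X @ Z" 0] wregs_lookup[of a1 L1] by blast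
    qed
    have m1: "mem s1 a = mem s a" if "a \<noteq> 0" for a
      using that by (intro s1(4)) (auto simp: warrs_fill)
    have t2: "runs w (fill (Z @ Y) (lookup a2 L2) (Z @ Y) 1) s1
        (fill_time n (length (Z @ Y)) (length (Z @ Y)) (3 + 2 * length L2))
      (\<lambda>s'. \<forall>\<rho>. (\<forall>v\<in>set (Z @ Y). \<rho> v < n) \<and> (\<forall>u\<in>set R. \<rho> u = \<sigma> u) \<longrightarrow>
         mem s' 1 (idx n \<rho> (Z @ Y)) = of_bool (M a2 (idx n \<rho> L2) \<noteq> 0))"
    proof (rule runs_fill_lookup[where K = "{a1, a2}"])
      show "n ^ length L2 \<le> 2 ^ w" "n ^ length (Z @ Y) \<le> 2 ^ w" using len by (auto intro!: n'(3))
      show "(set (Z @ Y) \<union> set R) \<inter> {rn, rl, ro, ri, rc} = {}" using big by auto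
      show "\<forall>u\<in>set R. regs s1 u = \<sigma> u \<and> \<sigma> u < n" "regs s1 rn = n" using r1 s(2) s\<sigma> by auto
      show "\<forall>a\<in>{a1, a2}. mem s1 a = M a" using m1 s(3) a_ge by auto
    qed (use s1(2) n' a_ge dist sub in auto)
    show ?case
    proof (rule runs_SeqI[OF t2 s1(2)], goal_cases)
      case (1 s2)
      note s2 = 1
      have r2: "regs s2 r = regs s r" if "r \<in> insert rn (set R)" for r
      proof -
        have "regs s2 r = regs s1 r"
        proof (rule s2(3))
          have "r \<notin> set (Z @ Y) \<union> {rl, ro, ri, rc}" using that dist big scr by fastforce
          then show "r \<notin> wregs (fill (Z @ Y) (lookup a2 L2) (Z @ Y) 1)"
            using wregs_fill[of "Z @ Y" "lookup a2 L2" "Z @ Y" 1] wregs_lookup[of a2 L2] by blast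
        qed
        then show ?thesis using r1[OF that] by simp
      qed
      have m2: "mem s2 a = mem s1 a" if "a \<noteq> 1" for a
        using that by (intro s2(4)) (auto simp: warrs_fill)
      have t3: "runs w (mult_n (length Z)) s2 (Suc m) (\<lambda>s'. s' = sl w (mult_n m) s2)"
        using runs_sl[of "mult_n m" "\<lambda>s'. s' = sl w (mult_n m) s2" w s2] len by simp
      show ?case
      proof (rule runs_SeqI[OF t3 s2(2)], goal_cases)
        case (1 s3)
        note s3 = 1
        have m3: "mem s3 a = mem s2 a" for a by (rule s3(4)) simp
        have r3: "regs s3 r = regs s r" if "r \<in> insert rn (set R)" for r
        proof -
          have "r \<noteq> 0" using that scr D by force
          then show ?thesis using s3(3)[of r] r2[OF that] by simp
        qed
        have r30: "regs s3 0 = N"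
          unfolding s3(1) N_def using D r2[of rn] s(2) len by (intro sl_mult_n word_size(3)[OF n]) auto
        \<comment> \<open>The zeros outside the matrix make the later bounds on entries hold for all
          indices.\<close>
        define A where "A i j = (if i < N \<and> j < N then mem s3 0 (i * N + j) else 0)" for i j
        define B where "B i j = (if i < N \<and> j < N then mem s3 1 (i * N + j) else 0)" for i j
        have Aval: "A (idx n \<rho> X) (idx n \<rho> Z) = of_bool (M a1 (idx n \<rho> L1) \<noteq> 0)"
          if "\<forall>v\<in>set (X @ Z). \<rho> v < n" "\<forall>u\<in>set R. \<rho> u = \<sigma> u" for \<rho>
        proof -
          have "idx n \<rho> X < N" "idx n \<rho> Z < N"
            using that idx_less[of X \<rho> n] idx_less[of Z \<rho> n] len by (auto simp: N_def)
          then have "A (idx n \<rho> X) (idx n \<rho> Z) = mem s3 0 (idx n \<rho> (X @ Z))"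
            by (simp add: A_def idx_append len N_def)
          also have "\<dots> = of_bool (M a1 (idx n \<rho> L1) \<noteq> 0)"
            using that s1(1) by (simp add: m3 m2)
          finally show ?thesis .
        qed
        have Bval: "B (idx n \<rho> Z) (idx n \<rho> Y) = of_bool (M a2 (idx n \<rho> L2) \<noteq> 0)"
          if "\<forall>v\<in>set (Z @ Y). \<rho> v < n" "\<forall>u\<in>set R. \<rho> u = \<sigma> u" for \<rho>
        proof -
          have "idx n \<rho> Y < N" "idx n \<rho> Z < N"
            using that idx_less[of Y \<rho> n] idx_less[of Z \<rho> n] len by (auto simp: N_def)
          then have "B (idx n \<rho> Z) (idx n \<rho> Y) = mem s3 1 (idx n \<rho> (Z @ Y))"
            by (simp add: B_def idx_append len N_def)
          also have "\<dots> = of_bool (M a2 (idx n \<rho> L2) \<noteq> 0)"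
            using that s2(1) by (simp add: m3)
          finally show ?thesis .
        qed
        \<comment> \<open>The tables speak about assignments and the product about indices. As
          \<open>X\<close>, \<open>Y\<close>, \<open>Z\<close> and \<open>R\<close> are disjoint,
          any three indices are realised by a single assignment with the given values on
          \<open>R\<close>.\<close>
        have ex: "\<exists>\<rho>. (\<forall>v\<in>set X \<union> set Y \<union> set Z. \<rho> v < n) \<and> (\<forall>u\<in>set R. \<rho> u = \<sigma> u) \<and>
            idx n \<rho> X = i \<and> idx n \<rho> Y = j \<and> idx n \<rho> Z = l" if "i < N" "j < N" "l < N" for i j l
        proof -
          have "i < n ^ length X" "j < n ^ length Y" "l < n ^ length Z"
            using that len by (auto simp: N_def)
          moreover have "distinct X" "distinct Y" "distinct Z" using dist by auto
          ultimately have d: "distinct X" "distinct Y" "distinct Z"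
            and lt: "i < n ^ length X" "j < n ^ length Y" "l < n ^ length Z" by blast+
          obtain \<rho>1 where
            \<rho>1: "\<And>v. v \<in> set X \<Longrightarrow> \<rho>1 v < n" "\<And>v. v \<notin> set X \<Longrightarrow> \<rho>1 v = \<sigma> v" "idx n \<rho>1 X = i"
            by (rule idx_surj[OF d(1) lt(1), of \<sigma>]) (rule that)
          obtain \<rho>2 where
            \<rho>2: "\<And>v. v \<in> set Y \<Longrightarrow> \<rho>2 v < n" "\<And>v. v \<notin> set Y \<Longrightarrow> \<rho>2 v = \<rho>1 v" "idx n \<rho>2 Y = j"
            by (rule idx_surj[OF d(2) lt(2), of \<rho>1]) (rule that)
          obtain \<rho>3 where
            \<rho>3: "\<And>v. v \<in> set Z \<Longrightarrow> \<rho>3 v < n" "\<And>v. v \<notin> set Z \<Longrightarrow> \<rho>3 v = \<rho>2 v" "idx n \<rho>3 Z = l"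
            by (rule idx_surj[OF d(3) lt(3), of \<rho>2]) (rule that)
          have "idx n \<rho>3 X = i"
          proof -
            have "idx n \<rho>3 X = idx n \<rho>1 X"
            proof (rule idx_cong)
              fix v assume "v \<in> set X"
              then have "v \<notin> set Y" "v \<notin> set Z" using dist by auto
              then show "\<rho>3 v = \<rho>1 v" using \<rho>2(2) \<rho>3(2) by simp
            qed
            then show ?thesis using \<rho>1(3) by simp
          qed
          moreover have "idx n \<rho>3 Y = j"
          proof -
            have "idx n \<rho>3 Y = idx n \<rho>2 Y"
            proof (rule idx_cong)
              fix v assume "v \<in> set Y"
              then have "v \<notin> set Z" using dist by auto
              then show "\<rho>3 v = \<rho>2 v" using \<rho>3(2) by simp
            qed
            then show ?thesis using \<rho>2(3) by simp
          qed
          moreover have "\<forall>v\<in>set X \<union> set Y \<union> set Z. \<rho>3 v < n"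
            using \<rho>1 \<rho>2 \<rho>3 by (metis UnE)
          moreover have "\<forall>u\<in>set R. \<rho>3 u = \<sigma> u"
          proof
            fix u assume "u \<in> set R"
            then have "u \<notin> set X" "u \<notin> set Y" "u \<notin> set Z" using dist by auto
            then show "\<rho>3 u = \<sigma> u" using \<rho>1(2) \<rho>2(2) \<rho>3(2) by simp
          qed
          ultimately show ?thesis using \<rho>3(3) by blast
        qed
        \<comment> \<open>One of the three indices passed to \<open>ex\<close> is a mere
          filler.\<close>
        have A01: "A i l \<le> 1" "B l j \<le> 1" for i l j
        proof -
          show "A i l \<le> 1"
          proof (cases "i < N \<and> l < N")
            case True
            then show ?thesis using ex[of i l l] Aval by fastforce
          qed (auto simp: A_def)
          show "B l j \<le> 1"
          proof (cases "l < N \<and> j < N")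
            case True
            then show ?thesis using ex[of l j l] Bval by fastforce
          qed (auto simp: B_def)
        qed
        have NW: "N < 2 ^ w" unfolding N_def using len(4) by (intro word_size(3)[OF n]) simp
        \<comment> \<open>An entry counts the summation indices at which both factors are 1; there
          are \<open>N\<close> indices, and \<open>N\<close> fits into a word.\<close>
        have prod_less: "matrix_prod N A B i j < 2 ^ w" for i j
        proof -
          have "matrix_prod N A B i j \<le> (\<Sum>l<N. 1 * 1)"
            unfolding matrix_prod_def using A01 by (intro sum_mono mult_le_mono)
          then show ?thesis using NW by simp
        qed
        have t4: "runs w cm s3 (T0 N) (\<lambda>s'. holds_matrix N (matrix_prod N A B) (mem s' 2))"
        proof (rule multipliesD[OF multiplies_cm _ s3(2) r30])
          show "(N + 2) ^ k0 \<le> 2 ^ w"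
            unfolding N_def using len(4) by (intro word_size(4)[OF n]) simp
          show "\<forall>i<N. \<forall>j<N. A i j < 2 ^ w \<and> B i j < 2 ^ w \<and> matrix_prod N A B i j < 2 ^ w"
            using A01 prod_less n'(2) by (meson le_less_trans)
        qed (auto simp: holds_matrix_def A_def B_def)
        show ?case
        proof (rule runs_SeqI[OF t4 s3(2)], goal_cases)
          case (1 s4)
          note s4 = 1
          have r4: "regs s4 r = regs s r" if "r \<in> insert rn (set R)" for r
          proof -
            have "r \<notin> wregs cm" using that scr cm(1) by force
            then show ?thesis using s4(3) r3[OF that] by simp
          qed
          have mb: "mem s4 b = mem s b"
          proof -
            have "b \<notin> warrs cm" using cm(2) arr(3) by force
            then show ?thesis using s4(4)[of b] m1[of b] m2[of b] m3[of b] a_ge by simp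
          qed
          have "acc w n {2} (mem s4) b 1 (set R) (for_all_set (X @ Y) (lookup 2 (X @ Y)) L3 b 1)
            (\<lambda>\<sigma>. {idx n \<tau> L3 |\<tau>. \<tau> \<in> ext n (X @ Y) \<sigma> \<and> mem s4 2 (idx n \<tau> (X @ Y)) \<noteq> 0})
            (loops_time n (length (X @ Y)) (cost (lookup 2 (X @ Y)) + 2 * length L3 + 5))"
          proof (rule acc_for_all_set)
            show "tests w n {2} (mem s4) (set (X @ Y) \<union> set R) (lookup 2 (X @ Y))
                (\<lambda>\<tau>. mem s4 2 (idx n \<tau> (X @ Y)) \<noteq> 0)"
            proof (rule tests_lookup)
              show "ri \<notin> set (X @ Y) \<union> set R" using big by auto
              show "n ^ length (X @ Y) \<le> 2 ^ w" using len by (intro n'(3)) simp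
            qed simp_all
            show "wregs (lookup 2 (X @ Y)) \<inter> ({rn} \<union> set (X @ Y) \<union> set R) = {}"
            proof (rule auxiliary_disjoint)
              show "wregs (lookup 2 (X @ Y)) \<subseteq> {rl, ro, ri, rc, rt, ru}"
                by (rule order_trans[OF wregs_lookup]) simp
            qed (use scr in auto)
            show "n ^ length L3 \<le> 2 ^ w" using len by (intro n'(3))
          qed (use big dist sub n' a_ge in auto)
          then have r: "runs w (for_all_set (X @ Y) (lookup 2 (X @ Y)) L3 b 1) s4
            (loops_time n (length (X @ Y)) (cost (lookup 2 (X @ Y)) + 2 * length L3 + 5))
            (\<lambda>s'. mem s' b = (\<lambda>i. if i \<in> {idx n \<tau> L3 |\<tau>. \<tau> \<in> ext n (X @ Y) \<sigma> \<and> mem s4 2 (idx n \<tau> (X @ Y)) \<noteq> 0}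
               then 1 else mem s4 b i))"
            using s4(2) r4 s(2) s\<sigma> unfolding acc_def by simp
          \<comment> \<open>A nonzero entry has a summation index at which both factors are nonzero;
            decoding this index gives the placement of \<open>Z\<close>.\<close>
          have "mem s4 2 (idx n \<tau> (X @ Y)) \<noteq> 0 \<longleftrightarrow>
              (\<exists>\<tau>'\<in>ext n Z \<tau>. M a1 (idx n \<tau>' L1) \<noteq> 0 \<and> M a2 (idx n \<tau>' L2) \<noteq> 0)"
            if \<tau>: "\<tau> \<in> ext n (X @ Y) \<sigma>" for \<tau>
          proof -
            have \<tau>n: "\<forall>v\<in>set X \<union> set Y. \<tau> v < n" "\<forall>u\<in>set R. \<tau> u = \<sigma> u"
              using \<tau> dist by (auto simp: ext_def)
            have ij: "idx n \<tau> X < N" "idx n \<tau> Y < N"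
              using \<tau>n idx_less[of X \<tau> n] idx_less[of Y \<tau> n] len by (auto simp: N_def)
            have ab: "A (idx n \<tau> X) (idx n \<tau>' Z) = of_bool (M a1 (idx n \<tau>' L1) \<noteq> 0)"
              "B (idx n \<tau>' Z) (idx n \<tau> Y) = of_bool (M a2 (idx n \<tau>' L2) \<noteq> 0)"
              if "\<tau>' \<in> ext n Z \<tau>" for \<tau>'
            proof -
              have e: "\<tau>' v = \<tau> v" if "v \<in> set X \<union> set Y \<union> set R" for v
                using \<open>\<tau>' \<in> ext n Z \<tau>\<close> that dist by (auto simp: ext_def)
              have "\<forall>v\<in>set (X @ Z). \<tau>' v < n" "\<forall>v\<in>set (Z @ Y). \<tau>' v < n"
                using \<open>\<tau>' \<in> ext n Z \<tau>\<close> \<tau>n(1) e by (auto simp: ext_def)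
              moreover have "\<forall>u\<in>set R. \<tau>' u = \<sigma> u" using e \<tau>n(2) by auto
              moreover have "idx n \<tau>' X = idx n \<tau> X" "idx n \<tau>' Y = idx n \<tau> Y"
                using e by (auto intro!: idx_cong)
              ultimately show "A (idx n \<tau> X) (idx n \<tau>' Z) = of_bool (M a1 (idx n \<tau>' L1) \<noteq> 0)"
                "B (idx n \<tau>' Z) (idx n \<tau> Y) = of_bool (M a2 (idx n \<tau>' L2) \<noteq> 0)"
                using Aval[of \<tau>'] Bval[of \<tau>'] by metis+
            qed
            have e0: "mem s4 2 (idx n \<tau> (X @ Y)) = matrix_prod N A B (idx n \<tau> X) (idx n \<tau> Y)"
              using s4(1) ij by (simp add: holds_matrix_def idx_append len N_def)
            have "mem s4 2 (idx n \<tau> (X @ Y)) \<noteq> 0 \<longleftrightarrow> (\<exists>l<N. A (idx n \<tau> X) l \<noteq> 0 \<and> B l (idx n \<tau> Y) \<noteq> 0)"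
              unfolding e0 by (rule matrix_prod_nonzero)
            also have "\<dots> \<longleftrightarrow> (\<exists>\<tau>'\<in>ext n Z \<tau>. A (idx n \<tau> X) (idx n \<tau>' Z) \<noteq> 0 \<and> B (idx n \<tau>' Z) (idx n \<tau> Y) \<noteq> 0)"
            proof
              assume "\<exists>l<N. A (idx n \<tau> X) l \<noteq> 0 \<and> B l (idx n \<tau> Y) \<noteq> 0"
              then obtain l where l: "l < n ^ length Z" "A (idx n \<tau> X) l \<noteq> 0" "B l (idx n \<tau> Y) \<noteq> 0"
                by (auto simp: N_def len)
              have "distinct Z" using dist by auto
              then obtain \<tau>' where "\<And>v. v \<in> set Z \<Longrightarrow> \<tau>' v < n" "\<And>v. v \<notin> set Z \<Longrightarrow> \<tau>' v = \<tau> v" "idx n \<tau>' Z = l"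
                by (rule idx_surj[OF _ l(1), of \<tau>]) (rule that)
              then show "\<exists>\<tau>'\<in>ext n Z \<tau>. A (idx n \<tau> X) (idx n \<tau>' Z) \<noteq> 0 \<and> B (idx n \<tau>' Z) (idx n \<tau> Y) \<noteq> 0"
                using l by (intro bexI[of _ \<tau>']) (auto simp: ext_def)
            next
              assume "\<exists>\<tau>'\<in>ext n Z \<tau>. A (idx n \<tau> X) (idx n \<tau>' Z) \<noteq> 0 \<and> B (idx n \<tau>' Z) (idx n \<tau> Y) \<noteq> 0"
              then obtain \<tau>' where "\<tau>' \<in> ext n Z \<tau>" "A (idx n \<tau> X) (idx n \<tau>' Z) \<noteq> 0"
                "B (idx n \<tau>' Z) (idx n \<tau> Y) \<noteq> 0" by blast
              moreover from this have "idx n \<tau>' Z < N"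
                using idx_less[of Z \<tau>' n] len by (auto simp: ext_def N_def)
              ultimately show "\<exists>l<N. A (idx n \<tau> X) l \<noteq> 0 \<and> B l (idx n \<tau> Y) \<noteq> 0" by blast
            qed
            also have "\<dots> \<longleftrightarrow> (\<exists>\<tau>'\<in>ext n Z \<tau>. M a1 (idx n \<tau>' L1) \<noteq> 0 \<and> M a2 (idx n \<tau>' L2) \<noteq> 0)"
              using ab by (intro bex_cong) auto
            finally show ?thesis .
          qed
          then have eq: "{idx n \<tau> L3 |\<tau>. \<tau> \<in> ext n (X @ Y) \<sigma> \<and> mem s4 2 (idx n \<tau> (X @ Y)) \<noteq> 0} = ?S"
            by blast
          show ?case using r unfolding eq mb .
        qed
      qed
    qed
  qed
  then show "runs w (block X Y Z L1 L2 L3 a1 a2 b) s (block_time m (length L1) (length L2) (length L3) n)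
     (\<lambda>s'. mem s' b = (\<lambda>i. if i \<in> ?S then 1 else mem s b i))"
    by (simp only: block_time_def len N_def length_append lookup_simps)
qed

end


section \<open>Splitting the dimensions of a merge, and its running time\<close>

lemma ext_append: "\<tau>' \<in> ext n (L @ L') \<sigma> \<longleftrightarrow> (\<exists>\<tau>\<in>ext n L \<sigma>. \<tau>' \<in> ext n L' \<tau>)"
proof
  assume "\<tau>' \<in> ext n (L @ L') \<sigma>"
  then show "\<exists>\<tau>\<in>ext n L \<sigma>. \<tau>' \<in> ext n L' \<tau>"
    by (intro bexI[of _ "\<lambda>v. if v \<in> set L then \<tau>' v else \<sigma> v"]) (auto simp: ext_def)
next
  assume "\<exists>\<tau>\<in>ext n L \<sigma>. \<tau>' \<in> ext n L' \<tau>"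
  then obtain \<tau> where \<tau>: "\<tau> \<in> ext n L \<sigma>" "\<tau>' \<in> ext n L' \<tau>" by blast
  have "\<tau>' v < n" if "v \<in> set L \<union> set L'" for v
  proof (cases "v \<in> set L'")
    case False
    then have "\<tau>' v = \<tau> v" "v \<in> set L" using \<tau>(2) that by (auto simp: ext_def)
    then show ?thesis using \<tau>(1) by (simp add: ext_def)
  qed (use \<tau>(2) in \<open>simp add: ext_def\<close>)
  then show "\<tau>' \<in> ext n (L @ L') \<sigma>" using \<tau> by (simp add: ext_def)
qed

lemma ext_set_eq: "set L = set L' \<Longrightarrow> ext n L \<sigma> = ext n L' \<sigma>"
  by (simp add: ext_def)

text \<open>The two concatenations have the same multiset of elements.\<close>

lemma distinct_split_lists:
  assumes "distinct (X @ Y @ Z @ W)"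
  shows "distinct (take m X @ take m Y @ take m Z @ W @ drop m X @ drop m Y @ drop m Z)"
proof -
  have s: "mset (take m L) + mset (drop m L) = mset L" for L :: "'b list"
    by (metis append_take_drop_id mset_append)
  have "mset (take m X @ take m Y @ take m Z @ W @ drop m X @ drop m Y @ drop m Z) =
      (mset (take m X) + mset (drop m X)) + (mset (take m Y) + mset (drop m Y)) +
      (mset (take m Z) + mset (drop m Z)) + mset W"
    by (simp add: ac_simps)
  also have "\<dots> = mset (X @ Y @ Z @ W)" unfolding s by (simp add: ac_simps)
  finally show ?thesis using assms mset_eq_imp_distinct_iff by blast
qed

context detection
begin

lemma T0_power: "(\<lambda>n. real (T0 (n ^ m))) \<in> O(\<lambda>n. real n powr (\<omega> * real m))"
\<comment> \<open>For m = 0 the dimension is constantly 1 and never passes the threshold of the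
  asymptotic bound. Otherwise n \<le> n ^ m, and it does.\<close>
proof (cases "m = 0")
  case True
  then show ?thesis using const_bigo_powr[of 0 "real (T0 1)"] by simp
next
  case False
  from landau_o.bigE[OF T0] obtain c where c: "c > 0"
    "\<forall>\<^sub>F N in at_top. norm (real (T0 N)) \<le> c * norm (real N powr \<omega>)" .
  then obtain N0 where N0: "\<And>N. N \<ge> N0 \<Longrightarrow> real (T0 N) \<le> c * real N powr \<omega>"
    unfolding eventually_at_top_linorder by auto
  show ?thesis
  proof (rule landau_o.bigI[OF c(1)])
    show "\<forall>\<^sub>F n in at_top. norm (real (T0 (n ^ m))) \<le> c * norm (real n powr (\<omega> * real m))"
      using eventually_ge_at_top[of "max N0 1"]
    proof eventually_elim
      case (elim n)
      have "n ^ 1 \<le> n ^ m" using False elim by (intro power_increasing) auto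
      then have "real (T0 (n ^ m)) \<le> c * real (n ^ m) powr \<omega>" using elim by (intro N0) auto
      also have "real (n ^ m) powr \<omega> = real n powr (\<omega> * real m)"
        using elim by (simp add: powr_realpow[symmetric] powr_powr mult.commute)
      finally show ?case by simp
    qed
  qed
qed

lemma block_time_bigo:
  "(\<lambda>n. real (block_time m l1 l2 l3 n)) \<in> O(\<lambda>n. real n powr (\<omega> * real m))"
proof -
  \<comment> \<open>Writing the two factors and reading the product takes time of order n ^ (2 * m),
    which the multiplication dominates because \<omega> \<ge> 2.\<close>
  have "2 * real m \<le> \<omega> * real m" using \<omega> by (intro mult_right_mono) auto
  then show ?thesis
    unfolding block_time_def of_nat_add
    using \<omega> by (intro sum_in_bigo fill_time_bigo T0_power loops_time_const_bigo const_bigo_powr) auto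
qed

text \<open>Of the three dimensions \<open>x\<close>, \<open>z\<close>, \<open>y\<close> of the product for fixed kept shared anchors, any two
  have a sum of at most \<open>p - l\<close>; the common part \<open>m\<close> is done by fast square products.\<close>

lemma merge_exponent:
  assumes "x + z + l \<le> p" "y + z + l \<le> p" "x + y + l \<le> p" "m = min x (min y z)"
  shows "\<omega> * real m + real (l + (x - m) + (y - m) + (z - m)) \<le> \<omega> * real p / 2"
proof -
  \<comment> \<open>The two larger dimensions together with \<open>l\<close> make up at most
    \<open>p\<close>, and the smallest one is \<open>m\<close>. Moreover 2 * m \<le> x + y.\<close>
  have "l + x + y + z \<le> p + m" "2 * m \<le> p" using assms by linarith+
  then have *: "real l + real x + real y + real z \<le> real p + real m" "2 * real m \<le> real p"
    by (simp_all flip: of_nat_add of_nat_mult)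
  have "m \<le> x" "m \<le> y" "m \<le> z" using assms(4) by auto
  then have "real (l + (x - m) + (y - m) + (z - m)) = real l + real x + real y + real z - 3 * real m"
    by (simp add: of_nat_diff)
  \<comment> \<open>The exponent is at most p + (\<omega> - 2) * m, and m \<le> p / 2.\<close>
  moreover have "(\<omega> - 2) * (2 * real m) \<le> (\<omega> - 2) * real p"
    using * \<omega> by (intro mult_left_mono) auto
  ultimately show ?thesis using * by (simp add: algebra_simps)
qed

lemma computable_merge:
  assumes X1: "computable (holds_table (anchors P1) P1)" and X2: "computable (holds_table (anchors P2) P2)"
    and m: "is_merge P P1 P2" and wf: "wf_apattern P" "wf_apattern P1" "wf_apattern P2"
    and V: "verts P \<subseteq> V"
    and card: "card (anchors P) \<le> p" "card (anchors P1) \<le> p" "card (anchors P2) \<le> p"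
  shows "computable (holds_table (anchors P) P)"
proof -
  define A A1 A2 where "A = anchors P" and "A1 = anchors P1" and "A2 = anchors P2"
  note A_defs = A_def[symmetric] A1_def[symmetric] A2_def[symmetric]
  note ma = merge_anchors[OF m wf, unfolded A_defs]
  have "verts P1 \<subseteq> V" "verts P2 \<subseteq> V" using is_mergeD(2)[OF m] V by blast+
  then have AV: "A \<subseteq> V" "A1 \<subseteq> V" "A2 \<subseteq> V"
    using V wf unfolding A_def A1_def A2_def wf_apattern_def by blast+
  have Averts: "A1 \<subseteq> verts P1" "A2 \<subseteq> verts P2"
    using wf unfolding A1_def A2_def wf_apattern_def by blast+
  \<comment> \<open>What remains of the anchors of a child once its private dropped anchors are
    projected away; otherwise these would enlarge a dimension of the product.\<close>
  define B1 B2 where "B1 = A1 \<inter> (A \<union> A2)" and "B2 = A2 \<inter> (A \<union> A1)"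
  have BA: "B1 \<subseteq> A1" "B2 \<subseteq> A2" by (auto simp: B1_def B2_def)
  then have BV: "B1 \<subseteq> V" "B2 \<subseteq> V" using AV by blast+
  have fin: "finite A" "finite A1" "finite A2" using AV finite_V by (auto intro: finite_subset)
  note card = card[unfolded A_defs]
  have cB: "card B1 \<le> p" "card B2 \<le> p"
    using card_mono[OF fin(2) BA(1)] card_mono[OF fin(3) BA(2)] card by linarith+
  have Y1: "computable (holds_table B1 P1)" and Y2: "computable (holds_table B2 P2)"
    using computable_forget[OF X1[folded A1_def] BA(1) AV(2) card(2) Averts(1)]
      computable_forget[OF X2[folded A2_def] BA(2) AV(3) card(3) Averts(2)] by auto
  have tab_iff: "tab n E A P \<sigma> \<longleftrightarrow>
      (\<exists>\<tau>. (\<forall>v\<in>A. \<tau> v = \<sigma> v) \<and> tab n E B1 P1 \<tau> \<and> tab n E B2 P2 \<tau>)" for n E \<sigma>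
    unfolding A_def
  proof (rule tab_merge[OF m wf(1)])
    show "verts P1 \<inter> verts P2 \<subseteq> B1 \<inter> B2" using ma(1) by (auto simp: B1_def B2_def)
    show "anchors P \<inter> verts P1 \<subseteq> B1" "anchors P \<inter> verts P2 \<subseteq> B2"
      using ma(3,4) unfolding A_def[symmetric] B1_def B2_def by auto
  qed
  \<comment> \<open>In this order: rows, columns, summation index, and the kept shared anchors that
    are fixed outside the product.\<close>
  define X Y Z W where "X = A \<inter> A1 - A2" and "Y = A \<inter> A2 - A1" and "Z = A1 \<inter> A2 - A" and "W = A \<inter> A1 \<inter> A2"
  note XYZW = X_def Y_def Z_def W_def
  have sets: "B1 = X \<union> W \<union> Z" "B2 = Y \<union> W \<union> Z" "A = X \<union> Y \<union> W"
    using ma(2) by (auto simp: B1_def B2_def XYZW)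
  have sV: "X \<subseteq> V" "Y \<subseteq> V" "Z \<subseteq> V" "W \<subseteq> V" using AV by (auto simp: XYZW)
  have sfin: "finite X" "finite Y" "finite Z" "finite W" using sV finite_V by (auto intro: finite_subset)
  have disj: "X \<inter> Y = {}" "X \<inter> Z = {}" "X \<inter> W = {}" "Y \<inter> Z = {}" "Y \<inter> W = {}" "Z \<inter> W = {}"
    by (auto simp: XYZW)
  \<comment> \<open>These three sums, each at most \<open>p\<close>, are the hypotheses of
    \<open>merge_exponent\<close>.\<close>
  have cards: "card B1 = card X + card Z + card W" "card B2 = card Y + card Z + card W"
    "card A = card X + card Y + card W"
  proof -
    have c3: "card (S1 \<union> S2 \<union> S3) = card S1 + card S2 + card S3"
      if "finite S1" "finite S2" "finite S3" "S1 \<inter> S2 = {}" "S1 \<inter> S3 = {}" "S2 \<inter> S3 = {}"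
      for S1 S2 S3 :: "'a set"
      using that by (simp add: card_Un_disjoint Int_Un_distrib2)
    show "card B1 = card X + card Z + card W" "card B2 = card Y + card Z + card W"
      "card A = card X + card Y + card W"
      unfolding sets using disj sfin by (subst c3; simp add: Int_commute)+
  qed
  define q where "q = min (card X) (min (card Y) (card Z))"
  define lX lY lZ where "lX = take q (rlist X)" and "lY = take q (rlist Y)" and "lZ = take q (rlist Z)"
  \<comment> \<open>Besides the kept shared anchors, the loops enumerate what the three lists have
    beyond the common length \<open>q\<close>.\<close>
  define R where "R = rlist W @ drop q (rlist X) @ drop q (rlist Y) @ drop q (rlist Z)"
  have disj_vr: "vr ` S \<inter> vr ` S' = {}" if "S \<inter> S' = {}" "S \<subseteq> V" "S' \<subseteq> V" for S S'
    using that inj_vr by (metis image_empty inj_on_image_Int)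
  have "distinct (rlist X @ rlist Y @ rlist Z @ rlist W)"
    using disj_vr[OF disj(1)] disj_vr[OF disj(2)] disj_vr[OF disj(3)] disj_vr[OF disj(4)]
      disj_vr[OF disj(5)] disj_vr[OF disj(6)] sV
    by (simp add: rlist Int_Un_distrib)
  then have dist: "distinct (lX @ lY @ lZ @ R)"
    unfolding lX_def lY_def lZ_def R_def by (rule distinct_split_lists)
  have td: "set (take q L) \<union> set (drop q L) = set L" for L :: "nat list"
    by (metis append_take_drop_id set_append)
  have sR: "set R = vr ` W \<union> set (drop q (rlist X)) \<union> set (drop q (rlist Y)) \<union> set (drop q (rlist Z))"
    using sV by (auto simp: R_def rlist)
  have tX: "set lX \<union> set (drop q (rlist X)) = vr ` X"
    unfolding lX_def td by (rule rlist(1)[OF sV(1)])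
  have tY: "set lY \<union> set (drop q (rlist Y)) = vr ` Y"
    unfolding lY_def td by (rule rlist(1)[OF sV(2)])
  have tZ: "set lZ \<union> set (drop q (rlist Z)) = vr ` Z"
    unfolding lZ_def td by (rule rlist(1)[OF sV(3)])
  have sL: "set lX \<union> set R \<supseteq> vr ` X" "set lY \<union> set R \<supseteq> vr ` Y" "set lZ \<union> set R \<supseteq> vr ` Z" "set R \<supseteq> vr ` W"
    "set lX \<subseteq> vr ` X" "set lY \<subseteq> vr ` Y" "set lZ \<subseteq> vr ` Z"
    unfolding sR tX[symmetric] tY[symmetric] tZ[symmetric] by auto
  define U where "U = X \<union> Y \<union> Z \<union> W"
  have UV: "U \<subseteq> V" using sV by (auto simp: U_def)
  \<comment> \<open>Loops, rows, columns and summation index together range over all placements of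
    \<open>U\<close>.\<close>
  have sU: "set (R @ (lX @ lY) @ lZ) = set (rlist U)"
    unfolding rlist(1)[OF UV] unfolding U_def image_Un tX[symmetric] tY[symmetric] tZ[symmetric] set_append sR
    by blast
  have BU: "B1 \<subseteq> U" "B2 \<subseteq> U" "A \<subseteq> U" unfolding sets U_def by blast+
  let ?L1 = "rlist B1" and ?L2 = "rlist B2" and ?L3 = "rlist A"
  note rB1 = rlist[OF BV(1)] and rB2 = rlist[OF BV(2)] and rA = rlist[OF AV(1)]
  have len: "length lX = q" "length lY = q" "length lZ = q" "2 * q \<le> p"
  proof -
    have q: "q \<le> card X" "q \<le> card Y" "q \<le> card Z" by (simp_all add: q_def)
    then show "length lX = q" "length lY = q" "length lZ = q"
      by (simp_all add: lX_def lY_def lZ_def rlist(3)[OF sV(1)] rlist(3)[OF sV(2)] rlist(3)[OF sV(3)])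
    show "2 * q \<le> p" using q card(1) cards(3) by linarith
  qed
  have lenR: "length R = card W + (card X - q) + (card Y - q) + (card Z - q)"
    using rlist(3) sV by (simp add: R_def)
  have sub: "set ?L1 \<subseteq> set lX \<union> set lZ \<union> set R" "set ?L2 \<subseteq> set lZ \<union> set lY \<union> set R"
    "set ?L3 \<subseteq> set lX \<union> set lY \<union> set R"
    unfolding rB1(1) rB2(1) rA(1) unfolding sets image_Un using sL(1-4) by auto
  have L3Z: "set ?L3 \<inter> set lZ = {}"
  proof -
    have "A \<inter> Z = {}" by (auto simp: Z_def)
    then show ?thesis using disj_vr[OF _ AV(1) sV(3)] sL(7) unfolding rA by blast
  qed
  have ge: "D + 8 \<le> v" if "v \<in> set (lX @ lY @ lZ @ R)" for v
  proof -
    have "v \<in> vr ` U" using that sU unfolding rlist(1)[OF UV] by auto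
    then show ?thesis by (rule rlist_scratch[OF UV])
  qed
  have geA: "D + 8 \<le> v" if "v \<in> set ?L3" for v
    using that rlist_scratch[OF AV(1)] unfolding rA by blast
  have "computable (holds_table A P)"
    unfolding computable_def
  proof (intro allI impI)
    fix a0 assume a0: "B0 \<le> a0"
    obtain c1 b1 a1 T1 where "computes (holds_table B1 P1) a0 c1 b1 a1 T1"
      using Y1 a0 unfolding computable_def by blast
    note c1 = computesD(1-6)[OF this] and run1 = computesD(7)[OF this]
    have "B0 \<le> a1" using a0 c1(1) by simp
    then obtain c2 b2 a2 T2 where "computes (holds_table B2 P2) a1 c2 b2 a2 T2"
      using Y2 unfolding computable_def by blast
    note c2 = computesD(1-6)[OF this] and run2 = computesD(7)[OF this]
    \<comment> \<open>Cleared once, outside the loops: \<open>R\<close> can contain dropped anchors,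
      and then several blocks contribute to the same cell.\<close>
    let ?clear = "for_all_set ?L3 (Const rc 1) ?L3 a2 0"
    let ?block = "block lX lY lZ ?L1 ?L2 ?L3 b1 b2 a2"
    let ?main = "loops R ?block"
    let ?c = "Seq c1 (Seq c2 (Seq ?clear ?main))"
    let ?Tc = "\<lambda>n. loops_time n (card A) (1 + 2 * card A + 5)"
    let ?Tm = "\<lambda>n. loops_time n (length R) (block_time q (card B1) (card B2) (card A) n)"
    let ?T = "\<lambda>n. T1 n + (T2 n + (?Tc n + ?Tm n))"
    have rn_clear: "rn \<notin> wregs ?clear"
      using wregs_for_all_set[of ?L3 "Const rc 1" ?L3 a2 0] geA[of rn] by auto
    have rn_block: "rn \<notin> wregs ?block" and R_block: "set R \<inter> wregs ?block = {}"
    proof -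
      have *: "wregs ?block \<subseteq> set lX \<union> set lY \<union> set lZ \<union> {rl, ro, ri, rc} \<union> {..<D}"
        by (rule wregs_block)
      then show "rn \<notin> wregs ?block" using ge[of rn] by auto
      show "set R \<inter> wregs ?block = {}"
      proof (rule equals0I)
        fix v assume v: "v \<in> set R \<inter> wregs ?block"
        then have "v \<notin> {rl, ro, ri, rc} \<union> {..<D}" using ge[of v] by auto
        moreover have "v \<notin> set lX \<union> set lY \<union> set lZ" using v dist by auto
        ultimately show False using * v by blast
      qed
    qed
    have "runs w ?c s (?T n) (\<lambda>s'. holds_table A P n E (mem s' a2))"
      if n: "(n + 2) ^ k \<le> 2 ^ w" and s: "word_state w s" "regs s rn = n" and E: "ordered_graph n E"
        and base: "base n E (mem s)" for n w E s
    proof (rule runs_SeqI[OF run1[OF n s E base] s(1)], goal_cases)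
      case (1 s1)
      note s1 = 1
      have base1: "base n E (mem s1)"
      proof (rule base_cong[OF _ base])
        fix a assume "D \<le> a" "a < B0"
        then have "a \<notin> warrs c1" using c1(4) a0 by fastforce
        then show "mem s a = mem s1 a" using s1(4) by simp
      qed
      have r1: "regs s1 rn = n" using s1(3)[OF c1(5)] s(2) by simp
      show ?case
      proof (rule runs_SeqI[OF run2[OF n s1(2) r1 E base1] s1(2)], goal_cases)
        case (1 s2)
        note s2 = 1
        \<comment> \<open>The second program writes only below \<open>D\<close> and from
          \<open>a1\<close> on, whereas D \<le> b1 < a1.\<close>
        have "b1 \<notin> warrs c2" using c1(2,3) c2(4) by fastforce
        then have h1: "holds_table B1 P1 n E (mem s2 b1)" using s1(1) s2(4) by simp
        have r2: "regs s2 rn = n" using s2(3)[OF c2(5)] r1 by simp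
        have n': "n < 2 ^ w" "1 < (2::nat) ^ w" by (fact word_size[OF n])+
        have clear: "acc w n {b1, b2} (mem s2) a2 0 {} ?clear
          (\<lambda>\<sigma>. {idx n \<tau> ?L3 |\<tau>. \<tau> \<in> ext n ?L3 \<sigma> \<and> True})
          (loops_time n (length ?L3) (cost (Const rc 1) + 2 * length ?L3 + 5))"
        proof (rule acc_for_all_set)
          show "n ^ length ?L3 \<le> 2 ^ w"
            using word_size(3)[OF n, of "card A"] card(1) rA by simp
          show "wregs (Const rc 1) \<inter> ({rn} \<union> set ?L3 \<union> {}) = {}"
            by (rule auxiliary_disjoint) (use geA in auto)
          have "v \<notin> {rn, rl, ro, ri}" if "v \<in> set ?L3" for v using geA[OF that] by auto
          then show "(set ?L3 \<union> {}) \<inter> {rn, rl, ro, ri} = {}" by auto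
          have "0 < w" using n'(2) by (cases w) auto
          then show "tests w n {b1, b2} (mem s2) (set ?L3 \<union> {}) (Const rc 1) (\<lambda>_. True)"
            by (simp add: tests_def)
        qed (use n' rA(2) c1(3) c2(1,3) in auto)
        have main: "acc w n {b1, b2} (mem s2) a2 1 {} ?main
          (\<lambda>\<sigma>. \<Union>\<tau>\<in>ext n R \<sigma>. {idx n \<tau>1 ?L3 |\<tau>1. \<tau>1 \<in> ext n (lX @ lY) \<tau> \<and>
             (\<exists>\<tau>'\<in>ext n lZ \<tau>1. mem s2 b1 (idx n \<tau>' ?L1) \<noteq> 0 \<and> mem s2 b2 (idx n \<tau>' ?L2) \<noteq> 0)})
          (loops_time n (length R) (block_time q (length ?L1) (length ?L2) (length ?L3) n))"
        proof (rule acc_loops)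
          show "acc w n {b1, b2} (mem s2) a2 1 (set R \<union> {}) ?block
            (\<lambda>\<tau>. {idx n \<tau>1 ?L3 |\<tau>1. \<tau>1 \<in> ext n (lX @ lY) \<tau> \<and>
               (\<exists>\<tau>'\<in>ext n lZ \<tau>1. mem s2 b1 (idx n \<tau>' ?L1) \<noteq> 0 \<and> mem s2 b2 (idx n \<tau>' ?L2) \<noteq> 0)})
            (block_time q (length ?L1) (length ?L2) (length ?L3) n)"
            unfolding Un_empty_right
          proof (rule acc_block[OF n])
            show "length ?L1 \<le> p" "length ?L2 \<le> p" "length ?L3 \<le> p"
              using rB1 rB2 rA cB card by simp_all
            show "a2 \<noteq> b1" "a2 \<noteq> b2" "D \<le> a2" using c1 c2 by simp_all
          qed (fact len dist ge sub c1(2) c2(2))+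
          show "(set R \<union> {}) \<inter> ({rn, rl, ro} \<union> wregs ?block) = {}"
          proof -
            have "v \<notin> {rn, rl, ro}" if "v \<in> set R" for v using ge[of v] that by auto
            then show ?thesis using R_block by blast
          qed
          show "{b1, b2} \<inter> warrs ?block = {}"
          proof -
            have "b1 \<notin> insert a2 {..<D}" "b2 \<notin> insert a2 {..<D}" using c1(2,3) c2(1-3) by auto
            then show ?thesis using warrs_block[of lX lY lZ ?L1 ?L2 ?L3 b1 b2 a2] by blast
          qed
          show "distinct R" using dist by simp
          show "n < 2 ^ w" "1 < (2::nat) ^ w" by (fact n')+
        qed (use rn_block in simp_all)
        have t: "loops_time n (length ?L3) (cost (Const rc 1) + 2 * length ?L3 + 5) = ?Tc n"
          "loops_time n (length R) (block_time q (length ?L1) (length ?L2) (length ?L3) n) = ?Tm n"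
          using rA rB1 rB2 by simp_all
        have "\<forall>a\<in>{b1, b2}. mem s2 a = mem s2 a" "\<forall>u\<in>{}. regs s2 u = regs s2 u \<and> regs s2 u < n" by simp_all
        then have runclear: "runs w ?clear s2 (?Tc n)
          (\<lambda>s'. mem s' a2 = (\<lambda>i. if i \<in> {idx n \<tau> ?L3 |\<tau>. \<tau> \<in> ext n ?L3 (regs s2) \<and> True} then 0 else mem s2 a2 i))"
          using clear s2(2) r2 unfolding acc_def t by blast
        show ?case
        proof (rule runs_SeqI[OF runclear s2(2)], goal_cases)
          case (1 s3)
          note s3 = 1
          have r3: "regs s3 rn = n" using s3(3)[OF rn_clear] r2 by simp
          have "a \<notin> warrs ?clear" if "a \<in> {b1, b2}" for a
            using that c1(3) c2(1,3) by (auto simp: warrs_for_all_set)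
          then have "\<forall>a\<in>{b1, b2}. mem s3 a = mem s2 a" using s3(4) by blast
          moreover have "\<forall>u\<in>{}. regs s3 u = regs s3 u \<and> regs s3 u < n" by simp
          ultimately have "runs w ?main s3 (?Tm n)
            (\<lambda>s'. mem s' a2 = (\<lambda>i. if i \<in> (\<Union>\<tau>\<in>ext n R (regs s3). {idx n \<tau>1 ?L3 |\<tau>1. \<tau>1 \<in> ext n (lX @ lY) \<tau> \<and>
             (\<exists>\<tau>'\<in>ext n lZ \<tau>1. mem s2 b1 (idx n \<tau>' ?L1) \<noteq> 0 \<and> mem s2 b2 (idx n \<tau>' ?L2) \<noteq> 0)})
               then 1 else mem s3 a2 i))"
            using main s3(2) r3 unfolding acc_def t by blast
          then show ?case
          proof (rule runs_mono[OF _ order_refl])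
            fix s4
            assume s4: "mem s4 a2 = (\<lambda>i. if i \<in> (\<Union>\<tau>\<in>ext n R (regs s3). {idx n \<tau>1 ?L3 |\<tau>1. \<tau>1 \<in> ext n (lX @ lY) \<tau> \<and>
             (\<exists>\<tau>'\<in>ext n lZ \<tau>1. mem s2 b1 (idx n \<tau>' ?L1) \<noteq> 0 \<and> mem s2 b2 (idx n \<tau>' ?L2) \<noteq> 0)})
               then 1 else mem s3 a2 i)" (is "_ = (\<lambda>i. if i \<in> ?S then 1 else _)")
            have S_iff: "i \<in> ?S \<longleftrightarrow> (\<exists>\<tau>'\<in>ext n (rlist U) (regs s3). i = idx n \<tau>' ?L3 \<and>
                mem s2 b1 (idx n \<tau>' ?L1) \<noteq> 0 \<and> mem s2 b2 (idx n \<tau>' ?L2) \<noteq> 0)" for i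
            proof -
              \<comment> \<open>The summation variables are no anchors of \<open>P\<close>, so the
                cell can be computed before or after choosing them.\<close>
              have L3: "idx n \<tau>' ?L3 = idx n \<tau>1 ?L3" if "\<tau>' \<in> ext n lZ \<tau>1" for \<tau>' \<tau>1
              proof (rule idx_cong)
                fix v assume "v \<in> set ?L3"
                then have "v \<notin> set lZ" using L3Z by blast
                then show "\<tau>' v = \<tau>1 v" using that by (simp add: ext_def)
              qed
              have "i \<in> ?S \<longleftrightarrow> (\<exists>\<tau>\<in>ext n R (regs s3). \<exists>\<tau>1\<in>ext n (lX @ lY) \<tau>. \<exists>\<tau>'\<in>ext n lZ \<tau>1.
                  i = idx n \<tau>1 ?L3 \<and> mem s2 b1 (idx n \<tau>' ?L1) \<noteq> 0 \<and> mem s2 b2 (idx n \<tau>' ?L2) \<noteq> 0)"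
                by blast
              also have "\<dots> \<longleftrightarrow> (\<exists>\<tau>\<in>ext n R (regs s3). \<exists>\<tau>1\<in>ext n (lX @ lY) \<tau>. \<exists>\<tau>'\<in>ext n lZ \<tau>1.
                  i = idx n \<tau>' ?L3 \<and> mem s2 b1 (idx n \<tau>' ?L1) \<noteq> 0 \<and> mem s2 b2 (idx n \<tau>' ?L2) \<noteq> 0)"
                using L3 by (intro bex_cong refl) simp
              also have "\<dots> \<longleftrightarrow> (\<exists>\<tau>'\<in>ext n (R @ (lX @ lY) @ lZ) (regs s3).
                  i = idx n \<tau>' ?L3 \<and> mem s2 b1 (idx n \<tau>' ?L1) \<noteq> 0 \<and> mem s2 b2 (idx n \<tau>' ?L2) \<noteq> 0)"
                unfolding Bex_def ext_append by blast
              finally show ?thesis unfolding ext_set_eq[OF sU] .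
            qed
            show "holds_table A P n E (mem s4 a2)"
              unfolding holds_table_def
            proof (intro allI impI)
              fix \<rho> assume \<rho>: "\<forall>v\<in>A. \<rho> (vr v) < n"
              have "idx n \<rho> ?L3 \<in> {idx n \<tau> ?L3 |\<tau>. \<tau> \<in> ext n ?L3 (regs s2) \<and> True}"
              proof -
                let ?\<tau> = "\<lambda>v. if v \<in> set ?L3 then \<rho> v else regs s2 v"
                have "?\<tau> \<in> ext n ?L3 (regs s2)" using \<rho> by (auto simp: ext_def rA)
                moreover have "idx n \<rho> ?L3 = idx n ?\<tau> ?L3" by (rule idx_cong) simp
                ultimately show ?thesis by blast
              qed
              then have z: "mem s3 a2 (idx n \<rho> ?L3) = 0" unfolding s3(1) by simp
              have "idx n \<rho> ?L3 \<in> ?S \<longleftrightarrow> tab n E A P (\<lambda>v. \<rho> (vr v))" (is "?L \<longleftrightarrow> ?Rt")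
              proof
                assume ?L
                then obtain \<tau> where \<tau>: "\<tau> \<in> ext n (rlist U) (regs s3)" "idx n \<rho> ?L3 = idx n \<tau> ?L3"
                  "mem s2 b1 (idx n \<tau> ?L1) \<noteq> 0" "mem s2 b2 (idx n \<tau> ?L2) \<noteq> 0"
                  unfolding S_iff by blast
                have \<tau>n: "\<tau> (vr v) < n" if "v \<in> U" for v
                  using \<tau>(1) that unfolding ext_def rlist(1)[OF UV] by blast
                have "\<rho> v = \<tau> v" if "v \<in> set ?L3" for v
                proof (rule idx_inject[OF \<tau>(2) _ _ that])
                  show "\<rho> v < n" if "v \<in> set ?L3" for v using that \<rho> unfolding rA by auto
                  show "\<tau> v < n" if "v \<in> set ?L3" for v using that \<tau>n BU(3) unfolding rA by auto
                qed
                then have "\<forall>v\<in>A. \<tau> (vr v) = \<rho> (vr v)" unfolding rA by auto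
                moreover have "tab n E B1 P1 (\<lambda>v. \<tau> (vr v))"
                  using h1[unfolded holds_table_def, THEN spec[of _ \<tau>]] \<tau>(3) \<tau>n BU(1)
                  by (simp add: subset_iff)
                moreover have "tab n E B2 P2 (\<lambda>v. \<tau> (vr v))"
                  using s2(1)[unfolded holds_table_def, THEN spec[of _ \<tau>]] \<tau>(4) \<tau>n BU(2)
                  by (simp add: subset_iff)
                ultimately show ?Rt unfolding tab_iff by (intro exI[of _ "\<lambda>v. \<tau> (vr v)"]) simp
              next
                assume ?Rt
                then obtain \<tau> where \<tau>: "\<forall>v\<in>A. \<tau> v = \<rho> (vr v)" "tab n E B1 P1 \<tau>" "tab n E B2 P2 \<tau>"
                  unfolding tab_iff by blast
                have "B1 \<subseteq> verts P1" "B2 \<subseteq> verts P2" "U = B1 \<union> B2"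
                  using BA Averts unfolding U_def sets by blast+
                then have "\<tau> v < n" if "v \<in> U" for v
                  using that tab_less[OF \<tau>(2)] tab_less[OF \<tau>(3)] by blast
                then obtain \<rho>' where \<rho>': "\<rho>' \<in> ext n (rlist U) (regs s3)" "\<And>v. v \<in> U \<Longrightarrow> \<rho>' (vr v) = \<tau> v"
                  by (rule register_assignment[OF UV]) (assumption, rule that)
                have \<rho>n: "\<rho>' (vr v) < n" if "v \<in> U" for v
                  using \<rho>'(1) that unfolding ext_def rlist(1)[OF UV] by blast
                have "idx n \<rho> ?L3 = idx n \<rho>' ?L3"
                  using \<tau>(1) \<rho>'(2) BU(3) by (intro idx_cong) (auto simp: rA subset_iff)
                moreover have "tab n E B1 P1 (\<lambda>v. \<rho>' (vr v))" "tab n E B2 P2 (\<lambda>v. \<rho>' (vr v))"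
                  using \<tau>(2,3) \<rho>'(2) BU(1,2) tab_cong[of B1 "\<lambda>v. \<rho>' (vr v)" \<tau>]
                    tab_cong[of B2 "\<lambda>v. \<rho>' (vr v)" \<tau>] by (auto simp: subset_iff)
                then have "mem s2 b1 (idx n \<rho>' ?L1) \<noteq> 0" "mem s2 b2 (idx n \<rho>' ?L2) \<noteq> 0"
                  using h1[unfolded holds_table_def, THEN spec[of _ \<rho>']]
                    s2(1)[unfolded holds_table_def, THEN spec[of _ \<rho>']] \<rho>n BU(1,2)
                  by (simp_all add: subset_iff)
                ultimately show ?L unfolding S_iff using \<rho>'(1) by blast
              qed
              then show "mem s4 a2 (idx n \<rho> ?L3) = of_bool (tab n E A P (\<lambda>v. \<rho> (vr v)))"
                unfolding s4 using z by simp
            qed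
          qed
        qed
      qed
    qed
    moreover have "warrs ?c \<subseteq> {..<D} \<union> {a0..<a2 + 1}"
    proof -
      have "warrs ?main \<subseteq> insert a2 {..<D}" unfolding warrs_loops by (rule warrs_block)
      then show ?thesis using c1 c2 by (fastforce simp: warrs_for_all_set)
    qed
    moreover have "rn \<notin> wregs ?c"
    proof -
      have "rn \<notin> wregs ?main" using wregs_loops[of R ?block] rn_block ge[of rn] by auto
      then show ?thesis using c1(5) c2(5) rn_clear by simp
    qed
    moreover have "(\<lambda>n. real (?T n)) \<in> O(bound)"
    proof -
      have "(\<lambda>n. real (?Tm n)) \<in> O(\<lambda>n. real n powr (\<omega> * real q + real (length R)))"
        using \<omega> by (intro loops_time_bigo block_time_bigo) auto
      moreover have "\<omega> * real q + real (length R) \<le> \<omega> * real p / 2"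
        unfolding lenR using cards card(1) cB by (intro merge_exponent) (auto simp: q_def)
      ultimately have "(\<lambda>n. real (?Tm n)) \<in> O(bound)"
        unfolding bound_def using landau_o.big_trans powr_bigo_powr by blast
      moreover have "(\<lambda>n. real (?Tc n)) \<in> O(bound)"
        using card(1)
        by (intro landau_o.big_trans[OF loops_time_const_bigo bound_ge[of "real p"]]) auto
      ultimately show ?thesis
        unfolding of_nat_add using c1(6) c2(6) by (intro sum_in_bigo)
    qed
    ultimately have "computes (holds_table A P) a0 ?c a2 (a2 + 1) ?T"
      using c1(1,2) c2(1-3) unfolding computes_def by auto
    then show "\<exists>c b a1 T. computes (holds_table A P) a0 c b a1 T" by blast
  qed
  then show ?thesis unfolding A_def .
qed

text \<open>The leaves enter as a hypothesis because they are the only nodes treated differently for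
  p = 1 and for p \<ge> 2.\<close>

lemma computable_tree:
  assumes "wf_mtree t" "verts (label t) \<subseteq> V"
    and "\<And>Q. Q \<in> leaves t \<Longrightarrow> computable (holds_table (anchors Q) Q)"
    and "\<And>Q. Q \<in> labels t \<Longrightarrow> card (anchors Q) \<le> p"
  shows "computable (holds_table (anchors (label t)) (label t))"
  using assms
proof (induction t)
  case (Leaf P)
  then show ?case by simp
next
  case (Create P t)
  have "verts (label t) \<subseteq> verts P"
    using verts_labels_subset[OF Create.prems(1), of "label t"] label_in_labels[of t] by simp
  moreover from this have "computable (holds_table (anchors (label t)) (label t))"
    using Create.prems by (intro Create.IH) auto
  ultimately show ?case
    using Create.prems wf_label[of t] by (auto intro: computable_creation)
next
  case (Merge P t1 t2)
  have "verts (label t1) \<subseteq> verts P" "verts (label t2) \<subseteq> verts P"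
    using verts_labels_subset[OF Merge.prems(1), of "label t1"] label_in_labels[of t1]
      verts_labels_subset[OF Merge.prems(1), of "label t2"] label_in_labels[of t2] by simp_all
  then have "computable (holds_table (anchors (label t1)) (label t1))"
    "computable (holds_table (anchors (label t2)) (label t2))"
    using Merge.prems(1,2) by (simp_all add: Merge.IH Merge.prems(3,4))
  then have "computable (holds_table (anchors P) P)"
  proof (rule computable_merge)
    show "is_merge P (label t1) (label t2)" "wf_apattern P" "wf_apattern (label t1)"
      "wf_apattern (label t2)" "verts P \<subseteq> V"
      using Merge.prems(1,2) wf_label[of t1] wf_label[of t2] by simp_all
    show "card (anchors P) \<le> p" "card (anchors (label t1)) \<le> p" "card (anchors (label t2)) \<le> p"
      by (simp_all add: label_in_labels Merge.prems(4))
  qed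
  then show ?case by simp
qed

end


section \<open>Leaves of the merge tree\<close>

lemma contains_pattern_truncate:
  "contains_pattern n E (pattern.truncate Q) = contains_pattern n E Q"
  by (simp add: contains_pattern_def pattern.truncate_def)

context free_registers
begin

lemma tests_cong:
  assumes "tests w n K M U c C" "\<And>\<sigma>. (\<And>u. u \<in> U \<Longrightarrow> \<sigma> u < n) \<Longrightarrow> C \<sigma> = C' \<sigma>"
  shows "tests w n K M U c C'"
  using assms unfolding tests_def by simp

definition test_not :: "com \<Rightarrow> com" where
  "test_not c = Seq c (Seq (Const ro 0) (Op Eq rc rc ro))"

lemma test_not_simps [simp]:
  "loopfree (test_not c) = loopfree c" "warrs (test_not c) = warrs c" "wregs (test_not c) = wregs c \<union> {ro, rc}"
  by (auto simp: test_not_def)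

lemma tests_not:
  assumes "tests w n K M U c C" "1 < (2 :: nat) ^ w"
  shows "tests w n K M U (test_not c) (\<lambda>\<sigma>. \<not> C \<sigma>)"
proof -
  have "0 < w" using assms(2) by (cases w) auto
  then have *: "(regs (sl w (test_not c) s) rc \<noteq> 0) = (regs (sl w c s) rc = 0)" for s
    by (simp add: test_not_def)
  show ?thesis using assms(1) unfolding tests_def * by blast
qed

end

definition holds_edge_matrix :: "nat \<Rightarrow> nat set set \<Rightarrow> (nat \<Rightarrow> nat) \<Rightarrow> bool" where
  "holds_edge_matrix n E m \<longleftrightarrow> (\<forall>i<n. \<forall>j<n. m (i * n + j) = of_bool ({i, j} \<in> E))"

text \<open>The four arrays are the tables of the four kinds of edges with one anchor: the other
  endpoint lies to the left or to the right, and the edge is mandatory or forbidden.\<close>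

definition holds_sides :: "nat \<Rightarrow> nat \<Rightarrow> nat set set \<Rightarrow> (nat \<Rightarrow> nat \<Rightarrow> nat) \<Rightarrow> bool" where
  "holds_sides b n E M \<longleftrightarrow> (\<forall>v<n. M b v = of_bool (\<exists>u<v. {u, v} \<in> E) \<and>
     M (b + 1) v = of_bool (\<exists>u<v. {u, v} \<notin> E) \<and>
     M (b + 2) v = of_bool (\<exists>u. v < u \<and> u < n \<and> {u, v} \<in> E) \<and>
     M (b + 3) v = of_bool (\<exists>u. v < u \<and> u < n \<and> {u, v} \<notin> E))"

context detection
begin

text \<open>Both endpoints are enumerated even if not both are anchors; with p \<ge> 2 this is
  within the bound.\<close>

lemma computable_leaf_edge_matrix:
  assumes X: "computable holds_edge_matrix"
    and Q: "is_edge_creation Q" "wf_apattern Q" "verts Q \<subseteq> V" and p: "2 \<le> p"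
  shows "computable (holds_table (anchors Q) Q)"
proof -
  obtain a b m where ab: "a < b" "verts Q = {a, b}" and
    tab_iff: "\<And>n E B \<sigma>. B \<subseteq> {a, b} \<Longrightarrow> tab n E B Q \<sigma> \<longleftrightarrow>
      (\<exists>x y. x < y \<and> y < n \<and> ({x, y} \<in> E \<longleftrightarrow> m) \<and> (a \<in> B \<longrightarrow> x = \<sigma> a) \<and> (b \<in> B \<longrightarrow> y = \<sigma> b))"
    by (rule tab_edge_creation[OF Q(1)]) (rule that)
  define A B where "A = {a, b}" and "B = anchors Q"
  have BA: "B \<subseteq> A" using Q(2) ab(2) unfolding wf_apattern_def A_def B_def by simp
  have AV: "A \<subseteq> V" using Q(3) ab(2) by (simp add: A_def)
  have ab': "vr a \<in> vr ` A" "vr b \<in> vr ` A" by (auto simp: A_def)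
  have ge: "D + 8 \<le> v" if "v \<in> vr ` A" for v by (rule rlist_scratch[OF AV that])
  let ?l = "\<lambda>c. lookup c [vr a, vr b]"
  let ?test = "\<lambda>c. test_and (Op Less rc (vr a) (vr b)) (if m then ?l c else test_not (?l c))"
  let ?C = "\<lambda>n E \<tau>. \<tau> (vr a) < \<tau> (vr b) \<and> ({\<tau> (vr a), \<tau> (vr b)} \<in> E \<longleftrightarrow> m)"
  have "computable (holds_table B Q)"
  proof (rule computable_fill[OF X BA AV, where test = ?test and C = ?C and tm = "cost (?test 0)"])
    show "card A \<le> p" using p ab(1) by (simp add: A_def)
    show "wregs (?test c) \<subseteq> {ri, rc, ro, rt, ru}" for c
      using wregs_lookup[of c "[vr a, vr b]"] by auto
    show "cost (?test c) = cost (?test 0)" for c by (simp add: test_and_def test_not_def)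
    show "tests w n {c} M (vr ` A) (?test c) (?C n E)"
      if n: "(n + 2) ^ k \<le> 2 ^ w" and M: "holds_edge_matrix n E (M c)"
      for c n w E and M :: "nat \<Rightarrow> nat \<Rightarrow> nat"
    proof (rule tests_and)
      have w: "0 < w" using word_size(2)[OF n] by (cases w) auto
      show "tests w n {c} M (vr ` A) (Op Less rc (vr a) (vr b)) (\<lambda>\<tau>. \<tau> (vr a) < \<tau> (vr b))"
        unfolding tests_def
      proof (intro allI impI)
        fix \<sigma> and s :: state
        assume "\<forall>u\<in>vr ` A. regs s u = \<sigma> u \<and> \<sigma> u < n"
        then have "regs s (vr a) = \<sigma> (vr a)" "regs s (vr b) = \<sigma> (vr b)" using ab' by blast+
        then show "(regs (sl w (Op Less rc (vr a) (vr b)) s) rc \<noteq> 0) = (\<sigma> (vr a) < \<sigma> (vr b))"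
          using w by simp
      qed
      show "wregs (Op Less rc (vr a) (vr b)) \<inter> ({rn} \<union> vr ` A) = {}"
        by (rule auxiliary_disjoint) (use ge in auto)
      have "tests w n {c} M (vr ` A) (?l c) (\<lambda>\<tau>. M c (idx n \<tau> [vr a, vr b]) \<noteq> 0)"
      proof (rule tests_lookup)
        show "set [vr a, vr b] \<subseteq> vr ` A" using ab' by simp
        show "ri \<notin> vr ` A" using ge[of ri] by auto
        show "n ^ length [vr a, vr b] \<le> 2 ^ w" using word_size(3)[OF n, of 2] p by (simp add: power2_eq_square)
      qed simp
      then have l: "tests w n {c} M (vr ` A) (?l c) (\<lambda>\<tau>. {\<tau> (vr a), \<tau> (vr b)} \<in> E)"
        by (rule tests_cong) (use M ab' in \<open>simp add: holds_edge_matrix_def\<close>)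
      then show "tests w n {c} M (vr ` A) (if m then ?l c else test_not (?l c))
          (\<lambda>\<tau>. {\<tau> (vr a), \<tau> (vr b)} \<in> E \<longleftrightarrow> m)"
        using tests_not[OF l word_size(2)[OF n]] by (cases m) simp_all
    qed simp_all
    show "(\<exists>\<tau>\<in>ext n (rlist A) \<sigma>. ?C n E \<tau> \<and> (\<forall>v\<in>B. \<tau> (vr v) = \<rho> (vr v))) \<longleftrightarrow>
        tab n E B Q (\<lambda>v. \<rho> (vr v))" (is "?L \<longleftrightarrow> ?R") for n E \<rho> \<sigma>
    proof
      assume ?L
      then obtain \<tau> where \<tau>: "\<tau> \<in> ext n (rlist A) \<sigma>" "?C n E \<tau>" "\<forall>v\<in>B. \<tau> (vr v) = \<rho> (vr v)" by blast
      have "\<tau> (vr b) < n" using \<tau>(1) ab' unfolding ext_def rlist(1)[OF AV] by blast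
      then show ?R
        unfolding tab_iff[OF BA[unfolded A_def]] using \<tau>(2,3)
        by (intro exI[of _ "\<tau> (vr a)"] exI[of _ "\<tau> (vr b)"]) auto
    next
      assume ?R
      then obtain x y where xy: "x < y" "y < n" "{x, y} \<in> E \<longleftrightarrow> m"
        "a \<in> B \<longrightarrow> x = \<rho> (vr a)" "b \<in> B \<longrightarrow> y = \<rho> (vr b)"
        unfolding tab_iff[OF BA[unfolded A_def]] by blast
      let ?f = "\<lambda>v. if v = a then x else y"
      have "?f v < n" if "v \<in> A" for v using xy by auto
      then obtain \<tau> where \<tau>: "\<tau> \<in> ext n (rlist A) \<sigma>" "\<And>v. v \<in> A \<Longrightarrow> \<tau> (vr v) = ?f v"
        by (rule register_assignment[OF AV]) (assumption, rule that)
      have "\<tau> (vr a) = x" "\<tau> (vr b) = y" using \<tau>(2)[of a] \<tau>(2)[of b] ab(1) by (auto simp: A_def)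
      moreover have "\<forall>v\<in>B. \<tau> (vr v) = \<rho> (vr v)"
        using BA xy(4,5) calculation by (auto simp: A_def)
      ultimately show ?L using \<tau>(1) xy by (intro bexI[of _ \<tau>]) auto
    qed
  qed simp_all
  then show ?thesis unfolding B_def .
qed

text \<open>The preprocessing has already computed the table: the anchor is the smaller or the
  larger endpoint, which together with the type \<open>m\<close> selects one of the four
  arrays.\<close>

lemma computable_leaf_endpoint:
  assumes b0: "D \<le> b0" "b0 + 4 \<le> B0"
    and base: "\<And>n E M. ordered_graph n E \<Longrightarrow> base n E M \<Longrightarrow> holds_sides b0 n E M"
    and Q: "is_edge_creation Q" "wf_apattern Q" "card (anchors Q) = 1"
  shows "computable (holds_table (anchors Q) Q)"
proof -
  obtain a b m where ab: "a < b" "verts Q = {a, b}" and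
    tab_iff: "\<And>n E B \<sigma>. B \<subseteq> {a, b} \<Longrightarrow> tab n E B Q \<sigma> \<longleftrightarrow>
      (\<exists>x y. x < y \<and> y < n \<and> ({x, y} \<in> E \<longleftrightarrow> m) \<and> (a \<in> B \<longrightarrow> x = \<sigma> a) \<and> (b \<in> B \<longrightarrow> y = \<sigma> b))"
    by (rule tab_edge_creation[OF Q(1)]) (rule that)
  have "anchors Q \<subseteq> {a, b}" using Q(2) ab(2) unfolding wf_apattern_def by simp
  moreover obtain c where "anchors Q = {c}" using Q(3) by (rule card_1_singletonE)
  ultimately consider "anchors Q = {a}" | "anchors Q = {b}" by blast
  then show ?thesis
  proof cases
    case 1
    have "tab n E {a} Q \<sigma> \<longleftrightarrow> (\<exists>u. \<sigma> a < u \<and> u < n \<and> ({u, \<sigma> a} \<in> E \<longleftrightarrow> m))" for n E \<sigma>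
      using tab_iff[of "{a}" n E \<sigma>] ab(1) by (auto simp: insert_commute)
    then have "holds_table {a} Q n E (M (b0 + (if m then 2 else 3)))"
      if "ordered_graph n E" "base n E M" for n E M
      using base[OF that] by (auto simp: holds_table_def rlist_def holds_sides_def)
    then show ?thesis unfolding 1 using b0
      by (intro computable_base[of "b0 + (if m then 2 else 3)"]) auto
  next
    case 2
    have "tab n E {b} Q \<sigma> \<longleftrightarrow> (\<exists>u<\<sigma> b. ({u, \<sigma> b} \<in> E \<longleftrightarrow> m))" if "\<sigma> b < n" for n E \<sigma>
      using tab_iff[of "{b}" n E \<sigma>] ab(1) that by auto
    then have "holds_table {b} Q n E (M (b0 + (if m then 0 else 1)))"
      if "ordered_graph n E" "base n E M" for n E M
      using base[OF that] by (auto simp: holds_table_def rlist_def holds_sides_def)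
    then show ?thesis unfolding 2 using b0
      by (intro computable_base[of "b0 + (if m then 0 else 1)"]) auto
  qed
qed

text \<open>Once all anchors are forgotten, the table is the single cell 0, and its content is the
  answer. The preprocessing \<open>ci\<close> must establish \<open>base\<close> within the
  bound.\<close>

lemma detection_solvable:
  assumes X: "computable (holds_table (anchors Q) Q)"
    and A: "anchors Q \<subseteq> V" "card (anchors Q) \<le> p" "anchors Q \<subseteq> verts Q"
    and init: "(\<lambda>n. real (Ti n)) \<in> O(bound)"
      "\<And>n w E s. (n + 2) ^ k \<le> 2 ^ w \<Longrightarrow> word_state w s \<Longrightarrow> ordered_graph n E \<Longrightarrow>
        holds_adjacency_lists n E s \<Longrightarrow>
        runs w ci s (Ti n) (\<lambda>s'. regs s' rn = n \<and> base n E (mem s'))"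
  shows "pattern_detection_in_time (pattern.truncate Q) bound"
proof -
  have "computable (holds_table {} Q)"
    by (rule computable_forget[OF X _ A]) simp
  then obtain c b a1 T where "computes (holds_table {} Q) B0 c b a1 T"
    unfolding computable_def by blast
  note c = computesD(6)[OF this] and run = computesD(7)[OF this]
  let ?out = "Seq (Const 0 0) (Load 0 b 0)"
  have main: "runs w (Seq ci (Seq c ?out)) s (Ti n + (T n + 2))
      (\<lambda>s'. regs s' 0 = (if contains_pattern n E Q then 1 else 0))"
    if n: "(n + 2) ^ k \<le> 2 ^ w" and s: "word_state w s" and E: "ordered_graph n E"
      and adj: "holds_adjacency_lists n E s" for n w E s
  proof (rule runs_SeqI[OF init(2)[OF n s E adj] s], goal_cases)
    case (1 s1)
    then have "runs w c s1 (T n) (\<lambda>s'. holds_table {} Q n E (mem s' b))"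
      using run[OF n _ _ E] by blast
    then show ?case
    proof (rule runs_SeqI[OF _ 1(2)])
      fix s2 :: state
      assume "holds_table {} Q n E (mem s2 b)"
      then have "mem s2 b 0 = of_bool (tab n E {} Q (\<lambda>_. 0))"
        by (simp add: holds_table_def rlist_def tab_def)
      also have "tab n E {} Q (\<lambda>_. 0) \<longleftrightarrow> contains_pattern n E Q"
        by (simp add: tab_def contains_pattern_iff_emb)
      finally have "regs (sl w ?out s2) 0 = (if contains_pattern n E Q then 1 else 0)"
        by simp
      then have "runs w ?out s2 (cost ?out) (\<lambda>s'. regs s' 0 = (if contains_pattern n E Q then 1 else 0))"
        by (intro runs_sl) simp_all
      then show "runs w ?out s2 2 (\<lambda>s'. regs s' 0 = (if contains_pattern n E Q then 1 else 0))"
        by (rule runs_mono) simp_all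
    qed
  qed
  have "(\<lambda>n. real (Ti n + (T n + 2))) \<in> O(bound)"
    unfolding of_nat_add using init(1) c by (intro sum_in_bigo const_bound)
  then show ?thesis
    unfolding pattern_detection_in_time_def contains_pattern_truncate solvable_in_time_def
    using main unfolding runs_def
    by (intro exI[of _ "Seq ci (Seq c ?out)"] exI[of _ k] exI[of _ "\<lambda>n. Ti n + (T n + 2)"]) auto
qed

end


section \<open>Reading the adjacency lists\<close>

lemma strict_sorted_nth_less:
  fixes N :: "nat set"
  assumes "i < j" "j < card N"
  shows "sorted_list_of_set N ! i < sorted_list_of_set N ! j"
  using assms strict_sorted_list_of_set[of N] by (simp add: sorted_wrt_nth_less)

lemma sorted_list_nth_le_iff:
  fixes N :: "nat set"
  assumes "i < card N" "j < card N"
  shows "sorted_list_of_set N ! i \<le> sorted_list_of_set N ! j \<longleftrightarrow> i \<le> j"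
  using strict_sorted_nth_less[of i j N] strict_sorted_nth_less[of j i N] assms
  by (cases i j rule: linorder_cases) auto

lemma sorted_list_inj_on:
  fixes N :: "nat set"
  assumes "I \<subseteq> {..<card N}"
  shows "inj_on ((!) (sorted_list_of_set N)) I"
  using assms by (intro inj_onI) (auto simp: subset_iff nth_eq_iff_index_eq)

context
  fixes N :: "nat set" and n :: nat and L
  assumes N: "N \<subseteq> {..<n}"
  defines "L \<equiv> sorted_list_of_set N"
begin

lemma finite_N: "finite N"
  using N by (rule finite_subset) simp

lemma nth_in_N: "i < card N \<Longrightarrow> L ! i \<in> N"
  using nth_mem[of i L] by (simp add: L_def finite_N)

lemma in_N_nthE:
  assumes "u \<in> N"
  obtains i where "i < card N" "L ! i = u"
  using assms in_set_conv_nth[of u L] by (auto simp: L_def finite_N)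

text \<open>In a sorted list a single entry is decisive: the first one for smaller neighbours and
  the last one for larger neighbours.\<close>

lemma left_neighbour_iff: "(\<exists>u<v. u \<in> N) \<longleftrightarrow> 0 < card N \<and> L ! 0 < v"
proof
  assume "\<exists>u<v. u \<in> N"
  then obtain i where i: "i < card N" "L ! i < v" by (metis in_N_nthE)
  then have "L ! 0 \<le> L ! i" unfolding L_def by (subst sorted_list_nth_le_iff) auto
  then show "0 < card N \<and> L ! 0 < v" using i by linarith
next
  assume "0 < card N \<and> L ! 0 < v"
  then show "\<exists>u<v. u \<in> N" using nth_in_N by blast
qed

lemma right_neighbour_iff: "(\<exists>u. v < u \<and> u < n \<and> u \<in> N) \<longleftrightarrow> 0 < card N \<and> v < L ! (card N - 1)"
proof
  assume "\<exists>u. v < u \<and> u < n \<and> u \<in> N"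
  then obtain i where i: "i < card N" "v < L ! i" by (metis in_N_nthE)
  then have "L ! i \<le> L ! (card N - 1)" unfolding L_def by (subst sorted_list_nth_le_iff) auto
  then show "0 < card N \<and> v < L ! (card N - 1)" using i by linarith
next
  assume *: "0 < card N \<and> v < L ! (card N - 1)"
  then have "L ! (card N - 1) \<in> N" by (intro nth_in_N) simp
  then show "\<exists>u. v < u \<and> u < n \<and> u \<in> N" using * N by blast
qed

text \<open>In a strictly increasing list of naturals entry i is at least i, and equality at
  position v - 1 forces the first v entries to be 0, ..., v - 1. So one probe decides whether all
  smaller vertices are neighbours.\<close>

lemma left_non_neighbour_iff:
  "(\<exists>u<v. u \<notin> N) \<longleftrightarrow> v \<noteq> 0 \<and> (card N < v \<or> v - 1 < L ! (v - 1))"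
proof -
  have "{..<v} \<subseteq> N \<longleftrightarrow> (v \<noteq> 0 \<longrightarrow> v \<le> card N \<and> L ! (v - 1) \<le> v - 1)"
  proof (intro iffI impI)
    assume sub: "{..<v} \<subseteq> N" and v: "v \<noteq> 0"
    have le: "v \<le> card N" using card_mono[OF finite_N sub] by simp
    moreover have "L ! (v - 1) \<le> v - 1"
    proof (rule ccontr)
      assume big: "\<not> L ! (v - 1) \<le> v - 1"
      \<comment> \<open>Pigeonhole: v values would sit at v - 1 positions.\<close>
      have "{..<v} \<subseteq> (!) L ` {..<v - 1}"
      proof
        fix u assume u: "u \<in> {..<v}"
        then obtain i where i: "i < card N" "L ! i = u"
          using sub in_N_nthE by blast
        then have "\<not> L ! (v - 1) \<le> L ! i" using big u by auto
        then have "i < v - 1"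
          unfolding L_def using i le v by (subst (asm) sorted_list_nth_le_iff) auto
        then show "u \<in> (!) L ` {..<v - 1}" using i by blast
      qed
      then have "v \<le> v - 1"
        by (metis card_lessThan card_mono card_image_le finite_imageI finite_lessThan le_trans)
      then show False using v by simp
    qed
    ultimately show "v \<le> card N \<and> L ! (v - 1) \<le> v - 1" ..
  next
    assume "v \<noteq> 0 \<longrightarrow> v \<le> card N \<and> L ! (v - 1) \<le> v - 1"
    then have "v = 0 \<or> v \<le> card N \<and> L ! (v - 1) \<le> v - 1" by blast
    then show "{..<v} \<subseteq> N"
    proof
      assume v: "v \<le> card N \<and> L ! (v - 1) \<le> v - 1"
      have "(!) L ` {..<v} \<subseteq> {..<v}"
      proof clarsimp
        fix i assume "i < v"
        then have "L ! i \<le> L ! (v - 1)"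
          unfolding L_def using v by (subst sorted_list_nth_le_iff) auto
        then show "L ! i < v" using v \<open>i < v\<close> by linarith
      qed
      moreover have "card ((!) L ` {..<v}) = v"
        unfolding L_def using v by (subst card_image) (auto intro!: sorted_list_inj_on)
      ultimately have "(!) L ` {..<v} = {..<v}" by (intro card_subset_eq) auto
      moreover have "(!) L ` {..<v} \<subseteq> N"
        using v by (auto intro!: nth_in_N)
      ultimately show ?thesis by simp
    qed simp
  qed
  then show ?thesis by (auto simp: subset_iff not_le)
qed

text \<open>There are \<open>c\<close> vertices to the right of \<open>v\<close>. They are all
  neighbours iff the c-th entry from the end exists and exceeds \<open>v\<close>, for then the last
  \<open>c\<close> entries are \<open>c\<close> distinct vertices between \<open>v\<close> and
  \<open>n\<close>.\<close>

lemma right_non_neighbour_iff: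
  assumes "c = n - (v + 1)"
  shows "(\<exists>u. v < u \<and> u < n \<and> u \<notin> N) \<longleftrightarrow> v + 1 < n \<and> (card N < c \<or> L ! (card N - c) < v + 1)"
proof -
  have cc: "card {v<..<n} = c" using assms by simp
  have "{v<..<n} \<subseteq> N \<longleftrightarrow> (c \<noteq> 0 \<longrightarrow> c \<le> card N \<and> v < L ! (card N - c))"
  proof (intro iffI impI)
    assume sub: "{v<..<n} \<subseteq> N" and c: "c \<noteq> 0"
    have le: "c \<le> card N" using card_mono[OF finite_N sub] cc by simp
    moreover have "v < L ! (card N - c)"
    proof (rule ccontr)
      assume small: "\<not> v < L ! (card N - c)"
      \<comment> \<open>Again by pigeonhole: \<open>c\<close> values would sit at c - 1
        positions.\<close>
      have "{v<..<n} \<subseteq> (!) L ` {card N - c<..<card N}"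
      proof
        fix u assume u: "u \<in> {v<..<n}"
        then obtain i where i: "i < card N" "L ! i = u"
          using sub in_N_nthE by blast
        then have "\<not> L ! i \<le> L ! (card N - c)" using small u by auto
        then have "card N - c < i"
          unfolding L_def using i le c by (subst (asm) sorted_list_nth_le_iff) auto
        then show "u \<in> (!) L ` {card N - c<..<card N}" using i by auto
      qed
      then have "card {v<..<n} \<le> card ((!) L ` {card N - c<..<card N})" by (intro card_mono) auto
      also have "\<dots> \<le> card {card N - c<..<card N}" by (rule card_image_le) simp
      finally show False using cc c le by simp
    qed
    ultimately show "c \<le> card N \<and> v < L ! (card N - c)" ..
  next
    assume "c \<noteq> 0 \<longrightarrow> c \<le> card N \<and> v < L ! (card N - c)"
    then have "c = 0 \<or> c \<le> card N \<and> v < L ! (card N - c)" by blast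
    then show "{v<..<n} \<subseteq> N"
    proof
      assume "c = 0"
      then show ?thesis using cc by auto
    next
      assume v: "c \<le> card N \<and> v < L ! (card N - c)"
      let ?I = "{card N - c..<card N}"
      have I: "(!) L ` ?I \<subseteq> N"
        by (auto intro!: nth_in_N)
      have "(!) L ` ?I \<subseteq> {v<..<n}"
      proof
        fix u assume "u \<in> (!) L ` ?I"
        then obtain i where i: "card N - c \<le> i" "i < card N" "u = L ! i" by auto
        then have "L ! (card N - c) \<le> u"
          unfolding i(3) L_def by (subst sorted_list_nth_le_iff) auto
        moreover have "u < n" using \<open>u \<in> (!) L ` ?I\<close> I N by blast
        ultimately show "u \<in> {v<..<n}" using v by auto
      qed
      moreover have "card ((!) L ` ?I) = c"
        unfolding L_def using v by (subst card_image) (auto intro!: sorted_list_inj_on)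
      ultimately have "(!) L ` ?I = {v<..<n}" using cc by (intro card_subset_eq) auto
      then show ?thesis using I by simp
    qed
  qed
  moreover have "c = 0 \<longleftrightarrow> \<not> v + 1 < n" using assms by auto
  ultimately show ?thesis by (auto simp: subset_iff not_le not_less less_Suc_eq_le)
qed

end

lemma ordered_graph_neighbours:
  assumes "ordered_graph n E"
  shows "neighbours E v \<subseteq> {..<n} - {v}" "finite (neighbours E v)" "card (neighbours E v) \<le> n - 1"
    "{u, v} \<in> E \<longleftrightarrow> u \<in> neighbours E v" "v < n \<Longrightarrow> card (neighbours E v) < n"
proof -
  show *: "neighbours E v \<subseteq> {..<n} - {v}"
    using assms by (auto simp: ordered_graph_def neighbours_def pairs_def doubleton_eq_iff dest!: subsetD)
  then show "finite (neighbours E v)" by (rule finite_subset) simp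
  show c: "card (neighbours E v) \<le> n - 1"
  proof (cases "v < n")
    case True
    then show ?thesis using card_mono[OF _ *] by simp
  next
    case False
    have "neighbours E v = {}"
      using assms False by (auto simp: ordered_graph_def neighbours_def pairs_def doubleton_eq_iff dest!: subsetD)
    then show ?thesis by simp
  qed
  then show "v < n \<Longrightarrow> card (neighbours E v) < n" by linarith
  show "{u, v} \<in> E \<longleftrightarrow> u \<in> neighbours E v" by (simp add: neighbours_def)
qed

lemma list_start_Suc: "list_start E (Suc i) = list_start E i + card (neighbours E i)"
  by (simp add: list_start_def)

lemma list_start_le: "ordered_graph n E \<Longrightarrow> list_start E i \<le> i * n"
  using sum_bounded_above[of "{..<i}" "\<lambda>v. card (neighbours E v)" n]
    le_trans[OF ordered_graph_neighbours(3)] by (force simp: list_start_def)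


section \<open>Addresses in the adjacency lists\<close>

definition input_arrays :: "nat \<Rightarrow> nat set set \<Rightarrow> (nat \<Rightarrow> nat \<Rightarrow> nat) \<Rightarrow> bool" where
  "input_arrays n E M \<longleftrightarrow> ordered_graph n E \<and> (\<forall>i\<le>n. M 0 i = list_start E i) \<and>
     (\<forall>v<n. \<forall>j<card (neighbours E v).
        M 1 (list_start E v + j) = sorted_list_of_set (neighbours E v) ! j)"

text \<open>Starting positions are at most n * n, and the surplus 4 * n + 4 of (n + 2) ^ 2 leaves
  room for adding an offset of up to \<open>n\<close>.\<close>

lemma list_start_bounds:
  assumes "ordered_graph n E" "(n + 2) ^ 2 \<le> (2::nat) ^ w" "i \<le> n"
  shows "list_start E i + n < 2 ^ w" "list_start E i < 2 ^ w" "n + 1 < 2 ^ w" "n * n < 2 ^ w" "0 < w"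
proof -
  have "list_start E i \<le> n * n"
    using list_start_le[OF assms(1), of i] mult_le_mono1[OF assms(3), of n] by linarith
  moreover have "(n + 2) ^ 2 = n * n + 4 * n + 4" by (simp add: power2_eq_square algebra_simps)
  ultimately show "list_start E i + n < 2 ^ w" "list_start E i < 2 ^ w" "n + 1 < 2 ^ w" "n * n < 2 ^ w"
    using assms(2) by linarith+
  then show "0 < w" by (cases w) auto
qed

lemma sub_mod: "y \<le> x \<Longrightarrow> x < 2 ^ w \<Longrightarrow> (x + (2 ^ w - y)) mod 2 ^ w = x - (y::nat)"
proof -
  assume "y \<le> x" "x < 2 ^ w"
  then have "x + (2 ^ w - y) = (x - y) + 2 ^ w" by simp
  then have "(x + (2 ^ w - y)) mod 2 ^ w = (x - y) mod 2 ^ w" by (simp only: mod_add_self2)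
  then show ?thesis using \<open>x < 2 ^ w\<close> by simp
qed

context free_registers
begin

text \<open>The total length stored at index \<open>n\<close> serves as the end of the last list.
  The 1 that remains in \<open>ro\<close> is reused by the programs that follow, as the mark to be
  stored or as the number to be added or subtracted.\<close>

definition limits :: "nat \<Rightarrow> com" where
  "limits v = Seq (Load rt 0 v) (Seq (Const ro 1) (Seq (Op Add ru v ro) (Load ru 0 ru)))"

lemma limits_simps [simp]:
  "loopfree (limits v)" "warrs (limits v) = {}" "wregs (limits v) = {rt, ro, ru}" "cost (limits v) = 4"
  by (auto simp: limits_def)

lemma sl_limits:
  assumes "input_arrays n E M" "(n + 2) ^ 2 \<le> (2::nat) ^ w" "mem s 0 = M 0" "regs s v = i" "i < n"
    and "v \<notin> {rt, ro, ru}"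
  shows "sl w (limits v) s =
    s\<lparr>regs := (regs s)(rt := list_start E i, ro := 1, ru := list_start E i + card (neighbours E i))\<rparr>"
proof -
  have "ordered_graph n E" using assms(1) by (simp add: input_arrays_def)
  note b = list_start_bounds[OF this assms(2), of 0]
  have "M 0 i = list_start E i" "M 0 (Suc i) = list_start E i + card (neighbours E i)"
    using assms(1,5) by (auto simp: input_arrays_def list_start_Suc)
  moreover have "Suc i < 2 ^ w" using b(3) assms(5) by linarith
  ultimately show ?thesis
    using b(5) assms(6) by (simp add: limits_def assms(3,4))
qed

definition copy_n :: com where
  "copy_n = Seq (Const ro 0) (Op Add rn 0 ro)"

lemma runs_copy_n:
  assumes "0 < D" "word_state w s" "regs s 0 = n"
  shows "runs w copy_n s 2 (\<lambda>s'. regs s' rn = n \<and> mem s' = mem s)"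
proof -
  have "n < 2 ^ w" using assms(2,3) by (auto simp: word_state_def)
  then have "runs w copy_n s (cost copy_n) (\<lambda>s'. regs s' rn = n \<and> mem s' = mem s)"
    using assms(1,3) by (intro runs_sl) (auto simp: copy_n_def)
  then show ?thesis by (simp add: copy_n_def numeral_2_eq_2)
qed


subsection \<open>The adjacency matrix\<close>

abbreviation vx where "vx \<equiv> D + 8"
abbreviation vy where "vy \<equiv> D + 9"

text \<open>\<open>vy\<close> is a position in the list of \<open>vx\<close>, not a vertex;
  positions beyond the end of the list are skipped. So n * n rounds of constant cost build the
  matrix.\<close>

definition mark_neighbour :: com where
  "mark_neighbour = Seq (limits vx) (Seq (Op Add rt rt vy) (Seq (Op Less rc rt ru)
     (If rc (Seq (Load rt 1 rt) (Seq (Op Mul ri vx rn) (Seq (Op Add ri ri rt) (Store D ri ro)))) Skip)))"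

lemma mark_neighbour_simps [simp]:
  "loopfree mark_neighbour" "warrs mark_neighbour = {D}" "wregs mark_neighbour = {rt, ro, ru, rc, ri}"
  by (auto simp: mark_neighbour_def)

lemma acc_mark_neighbour:
  assumes M: "input_arrays n E M" and w: "(n + 2) ^ 2 \<le> (2::nat) ^ w"
  shows "acc w n {0, 1} M D 1 {vx, vy} mark_neighbour
    (\<lambda>\<sigma>. if \<sigma> vy < card (neighbours E (\<sigma> vx))
       then {\<sigma> vx * n + sorted_list_of_set (neighbours E (\<sigma> vx)) ! \<sigma> vy} else {}) (cost mark_neighbour)"
proof (rule acc_sl)
  fix \<sigma> and s :: state
  assume s: "regs s rn = n" "\<forall>a\<in>{0, 1}. mem s a = M a" "\<forall>u\<in>{vx, vy}. regs s u = \<sigma> u \<and> \<sigma> u < n"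
  define i j where "i = \<sigma> vx" and "j = \<sigma> vy"
  let ?N = "neighbours E i"
  let ?u = "sorted_list_of_set ?N ! j"
  have E: "ordered_graph n E" using M by (simp add: input_arrays_def)
  have ij: "regs s vx = i" "regs s vy = j" "i < n" "j < n" using s(3) by (auto simp: i_def j_def)
  note b = list_start_bounds[OF E w less_imp_le[OF ij(3)]]
  have lim: "sl w (limits vx) s = s\<lparr>regs := (regs s)(rt := list_start E i, ro := 1, ru := list_start E i + card ?N)\<rparr>"
    using s(2) ij by (intro sl_limits[OF M w]) auto
  have sum: "list_start E i + j < 2 ^ w" using b(1) ij(4) by linarith
  show "mem (sl w mark_neighbour s) D =
      (\<lambda>c. if c \<in> (if \<sigma> vy < card (neighbours E (\<sigma> vx))
       then {\<sigma> vx * n + sorted_list_of_set (neighbours E (\<sigma> vx)) ! \<sigma> vy} else {}) then 1 else mem s D c)"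
    unfolding i_def[symmetric] j_def[symmetric]
  proof (cases "j < card ?N")
    case True
    have u: "mem s 1 (list_start E i + j) = ?u"
      using M s(2) ij(3) True by (simp add: input_arrays_def)
    have "?u \<in> ?N"
      using nth_in_N[of ?N n j] ordered_graph_neighbours(1)[OF E, of i] True by blast
    then have "?u < n" using ordered_graph_neighbours(1)[OF E, of i] by blast
    then have "i * n + ?u < (i + 1) * n" by simp
    also have "\<dots> \<le> n * n" using ij(3) by (intro mult_le_mono1) simp
    finally have "i * n + ?u < 2 ^ w" using b(4) by linarith
    moreover from this have "i * n < 2 ^ w" by linarith
    ultimately have "mem (sl w mark_neighbour s) D = (mem s D)(i * n + ?u := 1)"
      using True b(5) by (simp add: mark_neighbour_def lim ij s(1) sum u[simplified])
    then show "mem (sl w mark_neighbour s) D =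
        (\<lambda>c. if c \<in> (if j < card ?N then {i * n + ?u} else {}) then 1 else mem s D c)"
      using True by auto
  next
    case False
    have "mem (sl w mark_neighbour s) D = mem s D"
      using False by (simp add: mark_neighbour_def lim ij s(1) sum)
    then show "mem (sl w mark_neighbour s) D =
        (\<lambda>c. if c \<in> (if j < card ?N then {i * n + ?u} else {}) then 1 else mem s D c)"
      using False by auto
  qed
qed simp_all

definition matrix_program :: com where
  "matrix_program = Seq copy_n (Seq (for_all_set [vx, vy] (Const rc 1) [vx, vy] D 0)
     (loops [vx, vy] mark_neighbour))"

lemma runs_matrix_program:
  assumes D: "3 \<le> D" and w: "(n + 2) ^ 2 \<le> (2::nat) ^ w" and s: "word_state w s"
    and E: "ordered_graph n E" and adj: "holds_adjacency_lists n E s"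
  shows "runs w matrix_program s (2 + (loops_time n 2 10 + loops_time n 2 (cost mark_neighbour)))
    (\<lambda>s'. regs s' rn = n \<and> holds_edge_matrix n E (mem s' D))"
proof -
  note b = list_start_bounds[OF E w order_refl]
  have n: "n < 2 ^ w" "1 < (2::nat) ^ w" using b(3,5) by (auto intro: one_less_power)
  have M: "input_arrays n E (mem s)"
    using adj E by (simp add: input_arrays_def holds_adjacency_lists_def)
  have r0: "regs s 0 = n" using adj by (simp add: holds_adjacency_lists_def)
  have clear: "acc w n {0, 1} (mem s) D 0 {} (for_all_set [vx, vy] (Const rc 1) [vx, vy] D 0)
      (\<lambda>\<sigma>. {idx n \<tau> [vx, vy] |\<tau>. \<tau> \<in> ext n [vx, vy] \<sigma> \<and> True})
      (loops_time n (length [vx, vy]) (cost (Const rc 1) + 2 * length [vx, vy] + 5))"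
    using D b n by (intro acc_for_all_set) (auto simp: tests_def)
  have mark: "acc w n {0, 1} (mem s) D 1 {} (loops [vx, vy] mark_neighbour)
      (\<lambda>\<sigma>. \<Union>\<tau>\<in>ext n [vx, vy] \<sigma>. if \<tau> vy < card (neighbours E (\<tau> vx))
       then {\<tau> vx * n + sorted_list_of_set (neighbours E (\<tau> vx)) ! \<tau> vy} else {})
      (loops_time n (length [vx, vy]) (cost mark_neighbour))"
    using D n acc_mark_neighbour[OF M w] by (intro acc_loops) auto
  have "runs w matrix_program s
      (2 + (loops_time n (length [vx, vy]) (cost (Const rc 1) + 2 * length [vx, vy] + 5) +
        loops_time n (length [vx, vy]) (cost mark_neighbour)))
    (\<lambda>s'. regs s' rn = n \<and> (\<forall>i<n. \<forall>j<n. mem s' D (i * n + j) = of_bool ({i, j} \<in> E)))"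
    unfolding matrix_program_def
  proof (rule runs_SeqI[OF runs_copy_n[OF _ s r0] s], goal_cases)
    case (2 s1)
    then have s1: "regs s1 rn = n" "mem s1 = mem s" "word_state w s1" by auto
    have "runs w (for_all_set [vx, vy] (Const rc 1) [vx, vy] D 0) s1
        (loops_time n (length [vx, vy]) (cost (Const rc 1) + 2 * length [vx, vy] + 5))
        (\<lambda>s'. mem s' D = (\<lambda>i. if i \<in> {idx n \<tau> [vx, vy] |\<tau>. \<tau> \<in> ext n [vx, vy] (regs s1) \<and> True} then 0 else mem s1 D i))"
      using clear s1 unfolding acc_def by auto
    then show ?case
    proof (rule runs_SeqI[OF _ s1(3)], goal_cases)
      case (1 s2)
      note s2 = 1
      have "rn \<notin> set [vx, vy] \<union> {rl, ro, ri} \<union> wregs (Const rc 1)" by simp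
      then have r2: "regs s2 rn = n"
        using s2(3)[of rn] wregs_for_all_set[of "[vx, vy]" "Const rc 1" "[vx, vy]" D 0] s1(1) by blast
      have "mem s2 a = mem s1 a" if "a \<noteq> D" for a
        using that by (intro s2(4)) (simp add: warrs_for_all_set)
      then have "\<forall>a\<in>{0, 1}. mem s2 a = mem s a" using D s1(2) by auto
      then have run: "runs w (loops [vx, vy] mark_neighbour) s2
        (loops_time n (length [vx, vy]) (cost mark_neighbour))
        (\<lambda>s'. mem s' D = (\<lambda>i. if i \<in> (\<Union>\<tau>\<in>ext n [vx, vy] (regs s2). if \<tau> vy < card (neighbours E (\<tau> vx))
            then {\<tau> vx * n + sorted_list_of_set (neighbours E (\<tau> vx)) ! \<tau> vy} else {}) then 1 else mem s2 D i))"
        using mark s2(2) r2 unfolding acc_def by auto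
      show ?case
      proof (rule runs_frame[OF run s2(2)], intro conjI allI impI, goal_cases)
        case (1 s3)
        have "rn \<notin> set [vx, vy] \<union> {rl, ro} \<union> wregs mark_neighbour" by simp
        then show ?case
          using 1(3)[of rn] wregs_loops[of "[vx, vy]" mark_neighbour] r2 by blast
      next
        case (2 s3 i j)
        let ?N = "neighbours E i"
        have N: "neighbours E v \<subseteq> {..<n}" for v
          using ordered_graph_neighbours(1)[OF E, of v] by blast
        have z: "mem s2 D (i * n + j) = 0"
        proof -
          let ?\<tau> = "(regs s1)(vx := i, vy := j)"
          have "?\<tau> \<in> ext n [vx, vy] (regs s1)" using 2(5,6) by (auto simp: ext_def)
          then have "idx n ?\<tau> [vx, vy] \<in> {idx n \<tau> [vx, vy] |\<tau>. \<tau> \<in> ext n [vx, vy] (regs s1) \<and> True}"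
            by blast
          then have "mem s2 D (idx n ?\<tau> [vx, vy]) = 0" unfolding s2(1) by (rule if_P)
          then show ?thesis by simp
        qed
        have "i * n + j \<in> (\<Union>\<tau>\<in>ext n [vx, vy] (regs s2). if \<tau> vy < card (neighbours E (\<tau> vx))
            then {\<tau> vx * n + sorted_list_of_set (neighbours E (\<tau> vx)) ! \<tau> vy} else {}) \<longleftrightarrow> {i, j} \<in> E"
          (is "?L \<longleftrightarrow> _")
        proof
          assume ?L
          then obtain \<tau> where \<tau>: "\<tau> vy < card (neighbours E (\<tau> vx))"
            "i * n + j = \<tau> vx * n + sorted_list_of_set (neighbours E (\<tau> vx)) ! \<tau> vy"
            by (auto split: if_splits)
          have u: "sorted_list_of_set (neighbours E (\<tau> vx)) ! \<tau> vy \<in> neighbours E (\<tau> vx)"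
            by (rule nth_in_N[OF N \<tau>(1)])
          then have "sorted_list_of_set (neighbours E (\<tau> vx)) ! \<tau> vy < n" using N by blast
          from digits_inject[OF \<tau>(2) 2(6) this] u have "j \<in> neighbours E i" by simp
          then show "{i, j} \<in> E" by (simp add: neighbours_def insert_commute)
        next
          assume "{i, j} \<in> E"
          then have "j \<in> ?N" by (simp add: neighbours_def insert_commute)
          then obtain l where l: "l < card ?N" "sorted_list_of_set ?N ! l = j"
            by (rule in_N_nthE[OF N])
          \<comment> \<open>A list has fewer than \<open>n\<close> entries, so the loop over
            positions reaches all of them.\<close>
          have "l < n" using l(1) ordered_graph_neighbours(5)[OF E 2(5)] by linarith
          then have "(regs s2)(vx := i, vy := l) \<in> ext n [vx, vy] (regs s2)"
            using 2(5) by (auto simp: ext_def)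
          then show ?L using l by (intro UN_I[of "(regs s2)(vx := i, vy := l)"]) auto
        qed
        then show ?case unfolding 2(1) using z by simp
      qed
    qed
  qed (use D in simp)
  then show ?thesis by (rule runs_mono) (simp_all add: numeral_2_eq_2 holds_edge_matrix_def)
qed


subsection \<open>Constant-time tests for neighbours on one side\<close>

definition left_test :: com where
  "left_test = Seq (limits vx) (Seq (Op Less rc rt ru) (If rc (Seq (Load rt 1 rt) (Op Less rc rt vx)) Skip))"

text \<open>The end of the list lies before start + v iff the vertex has fewer than v neighbours;
  then \<open>rc\<close> is already 1. Otherwise entry v - 1 is probed. The zero put into
  \<open>rc\<close> beforehand is the answer for v = 0.\<close>

definition left_non_test :: com where
  "left_non_test = Seq (limits vx) (Seq (Const rc 0)
     (If vx (Seq (Op Add rt rt vx) (Seq (Op Less rc ru rt)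
       (If rc Skip (Seq (Op Sub rt rt ro) (Seq (Load rt 1 rt) (Seq (Op Sub ri vx ro) (Op Less rc ri rt))))))) Skip))"

definition right_test :: com where
  "right_test = Seq (limits vx) (Seq (Op Less rc rt ru)
     (If rc (Seq (Op Sub ru ru ro) (Seq (Load ru 1 ru) (Op Less rc vx ru))) Skip))"

text \<open>First \<open>ri\<close> is v + 1, for the question whether any vertex lies to the right,
  then the number c of such vertices, used to count back from the end of the list, and finally v + 1
  again for the comparison with the probed entry.\<close>

definition right_non_test :: com where
  "right_non_test = Seq (limits vx) (Seq (Op Add ri vx ro) (Seq (Op Less rc ri rn)
     (If rc (Seq (Op Sub ri rn ri) (Seq (Op Add rt rt ri) (Seq (Op Less rc ru rt)
       (If rc Skip (Seq (Op Sub ru ru ri) (Seq (Load ru 1 ru) (Seq (Op Add ri vx ro) (Op Less rc ru ri)))))))) Skip)))"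

lemmas side_test_defs = left_test_def left_non_test_def right_test_def right_non_test_def

context
  fixes n w :: nat and E M
  assumes M: "input_arrays n E M" and w: "(n + 2) ^ 2 \<le> (2::nat) ^ w"
begin

lemma tests_sides:
  "tests w n {0, 1} M {vx} left_test (\<lambda>\<sigma>. \<exists>u<\<sigma> vx. {u, \<sigma> vx} \<in> E)"
  "tests w n {0, 1} M {vx} left_non_test (\<lambda>\<sigma>. \<exists>u<\<sigma> vx. {u, \<sigma> vx} \<notin> E)"
  "tests w n {0, 1} M {vx} right_test (\<lambda>\<sigma>. \<exists>u. \<sigma> vx < u \<and> u < n \<and> {u, \<sigma> vx} \<in> E)"
  "tests w n {0, 1} M {vx} right_non_test (\<lambda>\<sigma>. \<exists>u. \<sigma> vx < u \<and> u < n \<and> {u, \<sigma> vx} \<notin> E)"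
proof -
  have E: "ordered_graph n E" using M by (simp add: input_arrays_def)
  have *: "(regs (sl w left_test s) rc \<noteq> 0) = (\<exists>u<v. {u, v} \<in> E) \<and>
      (regs (sl w left_non_test s) rc \<noteq> 0) = (\<exists>u<v. {u, v} \<notin> E) \<and>
      (regs (sl w right_test s) rc \<noteq> 0) = (\<exists>u. v < u \<and> u < n \<and> {u, v} \<in> E) \<and>
      (regs (sl w right_non_test s) rc \<noteq> 0) = (\<exists>u. v < u \<and> u < n \<and> {u, v} \<notin> E)"
    if s: "regs s rn = n" "mem s 0 = M 0" "mem s 1 = M 1" "regs s vx = v" "v < n" for s :: state and v
  proof -
    let ?N = "neighbours E v"
    let ?L = "sorted_list_of_set ?N"
    define st d where "st = list_start E v" and "d = card ?N"
    have lim: "sl w (limits vx) s = s\<lparr>regs := (regs s)(rt := st, ro := 1, ru := st + d)\<rparr>"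
      unfolding st_def d_def using s by (intro sl_limits[OF M w]) auto
    have L: "M 1 (st + j) = ?L ! j" if "j < d" for j
      using M s(5) that by (simp add: input_arrays_def st_def d_def)
    note m1 = s(3)[simplified] and L1 = L[simplified]
    have N: "?N \<subseteq> {..<n}" using ordered_graph_neighbours(1)[OF E, of v] by blast
    have edge: "{u, v} \<in> E \<longleftrightarrow> u \<in> ?N" for u by (rule ordered_graph_neighbours(4)[OF E])
    have d: "d < n" unfolding d_def by (rule ordered_graph_neighbours(5)[OF E s(5)])
    note b = list_start_bounds[OF E w less_imp_le[OF s(5)], folded st_def]
    have lt: "st + d < 2 ^ w" "st + v < 2 ^ w" "st < 2 ^ w" "v < 2 ^ w" "n < 2 ^ w" "Suc v < 2 ^ w"
      using b d s(5) by linarith+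
    have "(regs (sl w left_test s) rc \<noteq> 0) \<longleftrightarrow> 0 < d \<and> M 1 st < v"
      using b(5) by (simp add: left_test_def lim s(4) m1)
    also have "\<dots> \<longleftrightarrow> (\<exists>u<v. u \<in> ?N)"
      unfolding left_neighbour_iff[OF N] using L[of 0] by (auto simp: d_def)
    finally have 1: "(regs (sl w left_test s) rc \<noteq> 0) = (\<exists>u<v. {u, v} \<in> E)" unfolding edge .
    have "(regs (sl w right_test s) rc \<noteq> 0) \<longleftrightarrow> 0 < d \<and> v < M 1 (st + d - 1)"
      using b(5) sub_mod[of 1 "st + d" w] lt(1) by (cases "d = 0") (simp_all add: right_test_def lim s(4) m1)
    also have "\<dots> \<longleftrightarrow> (\<exists>u. v < u \<and> u < n \<and> u \<in> ?N)"
      unfolding right_neighbour_iff[OF N] using L[of "d - 1"] by (cases "d = 0") (auto simp: d_def)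
    finally have 2: "(regs (sl w right_test s) rc \<noteq> 0) = (\<exists>u. v < u \<and> u < n \<and> {u, v} \<in> E)" unfolding edge .
    have "(regs (sl w left_non_test s) rc \<noteq> 0) \<longleftrightarrow> v \<noteq> 0 \<and> (d < v \<or> v - 1 < M 1 (st + v - 1))"
      using b(5) sub_mod[of 1 "st + v" w] sub_mod[of 1 v w] lt
      by (cases "v = 0"; cases "d < v") (simp_all add: left_non_test_def lim s(4) m1)
    also have "\<dots> \<longleftrightarrow> (\<exists>u<v. u \<notin> ?N)"
      unfolding left_non_neighbour_iff[OF N] using L[of "v - 1"]
      by (cases "v = 0"; cases "d < v") (auto simp: d_def)
    finally have 3: "(regs (sl w left_non_test s) rc \<noteq> 0) = (\<exists>u<v. {u, v} \<notin> E)" unfolding edge .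
    define c where "c = n - (v + 1)"
    have c: "st + c < 2 ^ w" using b(1) by (simp add: c_def)
    have cm: "(n + (2 ^ w - Suc v)) mod 2 ^ w = c"
      using sub_mod[of "v + 1" n w] s(5) lt(5) by (simp add: c_def)
    have "(regs (sl w right_non_test s) rc \<noteq> 0) \<longleftrightarrow> v + 1 < n \<and> (d < c \<or> M 1 (st + d - c) < v + 1)"
    proof (cases "v + 1 < n")
      case True
      show ?thesis
      proof (cases "d < c")
        case True
        then show ?thesis
          using \<open>v + 1 < n\<close> b(5) by (simp add: right_non_test_def lim s(1,4) m1 lt cm c)
      next
        case False
        then have "(st + d + (2 ^ w - c)) mod 2 ^ w = st + d - c" using lt(1) by (intro sub_mod) auto
        then show ?thesis
          using False \<open>v + 1 < n\<close> b(5) by (simp add: right_non_test_def lim s(1,4) m1 lt cm c)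
      qed
    next
      case False
      then show ?thesis by (simp add: right_non_test_def lim s(1,4) m1 lt)
    qed
    also have "\<dots> \<longleftrightarrow> (\<exists>u. v < u \<and> u < n \<and> u \<notin> ?N)"
    proof -
      have "st + d - c = st + (d - c)" if "\<not> d < c" using that by simp
      then show ?thesis
        unfolding right_non_neighbour_iff[OF N c_def] using L[of "d - c"]
        by (cases "v + 1 < n"; cases "d < c") (auto simp: d_def c_def)
    qed
    finally have 4: "(regs (sl w right_non_test s) rc \<noteq> 0) = (\<exists>u. v < u \<and> u < n \<and> {u, v} \<notin> E)" unfolding edge .
    show ?thesis using 1 2 3 4 by blast
  qed
  show "tests w n {0, 1} M {vx} left_test (\<lambda>\<sigma>. \<exists>u<\<sigma> vx. {u, \<sigma> vx} \<in> E)"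
    "tests w n {0, 1} M {vx} left_non_test (\<lambda>\<sigma>. \<exists>u<\<sigma> vx. {u, \<sigma> vx} \<notin> E)"
    "tests w n {0, 1} M {vx} right_test (\<lambda>\<sigma>. \<exists>u. \<sigma> vx < u \<and> u < n \<and> {u, \<sigma> vx} \<in> E)"
    "tests w n {0, 1} M {vx} right_non_test (\<lambda>\<sigma>. \<exists>u. \<sigma> vx < u \<and> u < n \<and> {u, \<sigma> vx} \<notin> E)"
    unfolding tests_def using * by simp_all
qed

lemma runs_fill_side:
  assumes D: "3 \<le> D" "D \<le> b" and test: "tests w n {0, 1} M {vx} test (\<lambda>\<sigma>. C (\<sigma> vx))"
    "loopfree test" "warrs test = {}" "wregs test \<subseteq> {rt, ro, ru, rc, ri}"
    and s: "word_state w s" "regs s rn = n" "\<forall>a\<in>{0, 1}. mem s a = M a"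
  shows "runs w (fill [vx] test [vx] b) s (fill_time n 1 1 (cost test))
    (\<lambda>s'. regs s' rn = n \<and> (\<forall>a. a \<noteq> b \<longrightarrow> mem s' a = mem s a) \<and> word_state w s' \<and>
      (\<forall>v<n. mem s' b v = of_bool (C v)))"
proof -
  have E: "ordered_graph n E" using M by (simp add: input_arrays_def)
  note bd = list_start_bounds[OF E w order_refl]
  have "runs w (fill [vx] test [vx] b) s (fill_time n (length [vx]) (length [vx]) (cost test))
    (\<lambda>s'. \<forall>\<rho>. (\<forall>v\<in>set [vx]. \<rho> v < n) \<longrightarrow> mem s' b (idx n \<rho> [vx]) =
       of_bool (\<exists>\<tau>\<in>ext n [vx] (regs s). C (\<tau> vx) \<and> (\<forall>v\<in>set [vx]. \<tau> v = \<rho> v)))"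
  proof (rule runs_fill[where U = "{}" and K = "{0, 1}" and M = M])
    show "tests w n {0, 1} M (set [vx] \<union> {}) test (\<lambda>\<sigma>. C (\<sigma> vx))" using test(1) by simp
    show "wregs test \<inter> ({rn} \<union> set [vx] \<union> {}) = {}"
      by (rule auxiliary_disjoint) (use test(4) in auto)
    show "n < 2 ^ w" "1 < (2::nat) ^ w" "n ^ length [vx] \<le> 2 ^ w"
      using bd(3,5) by (auto intro: one_less_power)
    show "b \<notin> {0, 1}" using D by auto
  qed (use test s in auto)
  then have "runs w (fill [vx] test [vx] b) s (fill_time n 1 1 (cost test))
    (\<lambda>s'. \<forall>\<rho>. (\<forall>v\<in>set [vx]. \<rho> v < n) \<longrightarrow> mem s' b (idx n \<rho> [vx]) =
       of_bool (\<exists>\<tau>\<in>ext n [vx] (regs s). C (\<tau> vx) \<and> (\<forall>v\<in>set [vx]. \<tau> v = \<rho> v)))"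
    by simp
  then show ?thesis
  proof (rule runs_frame[OF _ s(1)], goal_cases)
    case (1 s')
    have "rn \<notin> {rt, ro, ru, rc, ri}" "rn \<notin> set [vx] \<union> set [vx] \<union> {rl, ro, ri, rc}" by simp_all
    then have "rn \<notin> wregs (fill [vx] test [vx] b)"
      using wregs_fill[of "[vx]" test "[vx]" b] test(4) by blast
    then have "regs s' rn = n" using 1(3) s(2) by simp
    moreover have "\<forall>a. a \<noteq> b \<longrightarrow> mem s' a = mem s a"
      using 1(4) by (simp add: warrs_fill test(3))
    moreover have "mem s' b v = of_bool (C v)" if v: "v < n" for v
    proof -
      have "(regs s)(vx := v) \<in> ext n [vx] (regs s)" using v by (simp add: ext_def)
      then have "(\<exists>\<tau>\<in>ext n [vx] (regs s). C (\<tau> vx) \<and> (\<forall>u\<in>set [vx]. \<tau> u = v)) \<longleftrightarrow> C v"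
        by (auto intro!: bexI[of _ "(regs s)(vx := v)"])
      then show ?thesis using 1(1)[THEN spec[of _ "\<lambda>_. v"]] v by simp
    qed
    ultimately show ?case using 1(2) by blast
  qed
qed

end

definition sides_program :: com where
  "sides_program = Seq copy_n (Seq (fill [vx] left_test [vx] D) (Seq (fill [vx] left_non_test [vx] (D + 1))
     (Seq (fill [vx] right_test [vx] (D + 2)) (fill [vx] right_non_test [vx] (D + 3)))))"

lemma runs_sides_program:
  assumes D: "3 \<le> D" and w: "(n + 2) ^ 2 \<le> (2::nat) ^ w" and s: "word_state w s"
    and E: "ordered_graph n E" and adj: "holds_adjacency_lists n E s"
  shows "runs w sides_program s (2 + (fill_time n 1 1 (cost left_test) + (fill_time n 1 1 (cost left_non_test) +
      (fill_time n 1 1 (cost right_test) + fill_time n 1 1 (cost right_non_test)))))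
    (\<lambda>s'. regs s' rn = n \<and> holds_sides D n E (mem s'))"
proof -
  have M: "input_arrays n E (mem s)"
    using adj E by (simp add: input_arrays_def holds_adjacency_lists_def)
  have r0: "regs s 0 = n" using adj by (simp add: holds_adjacency_lists_def)
  have lf: "loopfree left_test" "loopfree left_non_test" "loopfree right_test" "loopfree right_non_test"
    and wa: "warrs left_test = {}" "warrs left_non_test = {}" "warrs right_test = {}" "warrs right_non_test = {}"
    and wr: "wregs left_test \<subseteq> {rt, ro, ru, rc, ri}" "wregs left_non_test \<subseteq> {rt, ro, ru, rc, ri}"
      "wregs right_test \<subseteq> {rt, ro, ru, rc, ri}" "wregs right_non_test \<subseteq> {rt, ro, ru, rc, ri}"
    by (simp_all add: side_test_defs)
  note fs = runs_fill_side[OF M w D]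
  note ts = tests_sides[OF M w]
  show ?thesis
    unfolding sides_program_def
  proof (rule runs_SeqI[OF runs_copy_n[OF _ s r0] s], goal_cases)
    case (2 s1)
    then have s1: "regs s1 rn = n" "mem s1 = mem s" "word_state w s1" by auto
    show ?case
    proof (rule runs_SeqI[OF fs[OF _ ts(1) lf(1) wa(1) wr(1) s1(3,1), of D] s1(3)], goal_cases)
      case (3 s2)
      then have s2: "regs s2 rn = n" "\<And>a. a \<noteq> D \<Longrightarrow> mem s2 a = mem s a" "word_state w s2"
        "\<forall>v<n. mem s2 D v = of_bool (\<exists>u<v. {u, v} \<in> E)" using s1(2) by auto
      have k2: "\<forall>a\<in>{0, 1}. mem s2 a = mem s a" using s2(2) D by auto
      show ?case
      proof (rule runs_SeqI[OF fs[OF _ ts(2) lf(2) wa(2) wr(2) s2(3,1) k2, of "D + 1"] s2(3)], goal_cases)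
        case (2 s3)
        then have s3: "regs s3 rn = n" "\<And>a. a \<noteq> D + 1 \<Longrightarrow> mem s3 a = mem s2 a" "word_state w s3"
          "\<forall>v<n. mem s3 (D + 1) v = of_bool (\<exists>u<v. {u, v} \<notin> E)" by auto
        have k3: "\<forall>a\<in>{0, 1}. mem s3 a = mem s a" using s3(2) k2 D by auto
        show ?case
        proof (rule runs_SeqI[OF fs[OF _ ts(3) lf(3) wa(3) wr(3) s3(3,1) k3, of "D + 2"] s3(3)], goal_cases)
          case (2 s4)
          then have s4: "regs s4 rn = n" "\<And>a. a \<noteq> D + 2 \<Longrightarrow> mem s4 a = mem s3 a" "word_state w s4"
            "\<forall>v<n. mem s4 (D + 2) v = of_bool (\<exists>u. v < u \<and> u < n \<and> {u, v} \<in> E)" by auto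
          have k4: "\<forall>a\<in>{0, 1}. mem s4 a = mem s a" using s4(2) k3 D by auto
          show ?case
          proof (rule runs_mono[OF fs[OF _ ts(4) lf(4) wa(4) wr(4) s4(3,1) k4, of "D + 3"] order_refl], goal_cases)
            case (2 s5)
            then have "mem s5 D = mem s2 D" "mem s5 (D + 1) = mem s3 (D + 1)" "mem s5 (D + 2) = mem s4 (D + 2)"
              using s4(2) s3(2) by simp_all
            then show ?case using 2 s2(4) s3(4) s4(4) by (simp add: holds_sides_def)
          qed simp
        qed simp
      qed simp
    qed (use s1 in simp_all)
  qed (use D in simp)
qed

end


section \<open>A single unanchored edge\<close>

lemma list_start_mandatory:
  assumes "ordered_graph n E"
  shows "(\<exists>x y. x < y \<and> y < n \<and> {x, y} \<in> E) \<longleftrightarrow> list_start E n \<noteq> 0"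
proof
  assume "\<exists>x y. x < y \<and> y < n \<and> {x, y} \<in> E"
  then obtain x y where xy: "x < y" "y < n" "{x, y} \<in> E" by blast
  then have "neighbours E y \<noteq> {}" by (auto simp: neighbours_def)
  then have "card (neighbours E y) \<noteq> 0" using ordered_graph_neighbours(2)[OF assms] by simp
  then show "list_start E n \<noteq> 0" using xy(2) by (auto simp: list_start_def)
next
  assume "list_start E n \<noteq> 0"
  then obtain v where v: "v < n" "card (neighbours E v) \<noteq> 0"
    by (auto simp: list_start_def)
  then obtain u where u: "u \<in> neighbours E v" by fastforce
  then have "u < n" "u \<noteq> v" "{u, v} \<in> E" "{v, u} \<in> E"
    using ordered_graph_neighbours(1)[OF assms, of v] by (auto simp: neighbours_def insert_commute)
  then show "\<exists>x y. x < y \<and> y < n \<and> {x, y} \<in> E" using v(1) by (metis linorder_neqE_nat)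
qed

text \<open>Each of the \<open>n\<close> lists has at most n - 1 entries, so the total length n * n
  - n is attained exactly by the complete graph.\<close>

lemma list_start_forbidden:
  assumes "ordered_graph n E"
  shows "(\<exists>x y. x < y \<and> y < n \<and> {x, y} \<notin> E) \<longleftrightarrow> list_start E n < n * n - n"
proof -
  have nn: "n * n - n = (\<Sum>v<n. n - 1)" by (simp add: diff_mult_distrib2)
  have le: "card (neighbours E v) \<le> n - 1" for v by (rule ordered_graph_neighbours(3)[OF assms])
  show ?thesis
  proof
    assume "\<exists>x y. x < y \<and> y < n \<and> {x, y} \<notin> E"
    then obtain x y where xy: "x < y" "y < n" "{x, y} \<notin> E" by blast
    then have "neighbours E y \<subseteq> {..<n} - {y} - {x}"
      using ordered_graph_neighbours(1)[OF assms, of y] by (auto simp: neighbours_def)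
    then have "card (neighbours E y) \<le> card ({..<n} - {y} - {x})" by (intro card_mono) auto
    also have "\<dots> = n - 1 - 1" using xy by simp
    finally have "card (neighbours E y) < n - 1" using xy by linarith
    then show "list_start E n < n * n - n"
      unfolding list_start_def nn using le xy(2) by (intro sum_strict_mono_ex1) auto
  next
    assume less: "list_start E n < n * n - n"
    show "\<exists>x y. x < y \<and> y < n \<and> {x, y} \<notin> E"
    proof (rule ccontr)
      assume "\<not> (\<exists>x y. x < y \<and> y < n \<and> {x, y} \<notin> E)"
      then have all: "{x, y} \<in> E" if "x < n" "y < n" "x \<noteq> y" for x y
        using that by (metis insert_commute linorder_neqE_nat)
      have "n - 1 \<le> card (neighbours E v)" if "v < n" for v
      proof -
        have "{..<n} - {v} \<subseteq> neighbours E v" using all that by (auto simp: neighbours_def)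
        from card_mono[OF ordered_graph_neighbours(2)[OF assms] this] that show ?thesis by simp
      qed
      then have "(\<Sum>v<n. n - 1) \<le> list_start E n"
        unfolding list_start_def by (intro sum_mono) auto
      then show False using less nn by simp
    qed
  qed
qed

text \<open>Exponent 0 is the bound for p = 0. The program reads a single cell, the total length of
  the lists, and compares it with 0 or with n * n - n.\<close>

lemma unanchored_edge_solvable:
  assumes Q: "is_edge_creation Q"
  shows "pattern_detection_in_time (pattern.truncate Q) (\<lambda>n. real n powr 0)"
proof -
  obtain a b m where
    tab_iff: "\<And>n E B \<sigma>. B \<subseteq> {a, b} \<Longrightarrow> tab n E B Q \<sigma> \<longleftrightarrow>
      (\<exists>x y. x < y \<and> y < n \<and> ({x, y} \<in> E \<longleftrightarrow> m) \<and> (a \<in> B \<longrightarrow> x = \<sigma> a) \<and> (b \<in> B \<longrightarrow> y = \<sigma> b))"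
    by (rule tab_edge_creation[OF Q]) (rule that)
  have iff: "contains_pattern n E Q \<longleftrightarrow> (\<exists>x y. x < y \<and> y < n \<and> ({x, y} \<in> E \<longleftrightarrow> m))" for n E
    using tab_iff[of "{}" n E undefined] unfolding contains_pattern_iff_emb by (simp add: tab_def)
  let ?c = "Seq (Load 1 0 0) (if m then Seq (Const 2 0) (Op Less 0 2 1)
    else Seq (Op Mul 2 0 0) (Seq (Op Sub 2 2 0) (Op Less 0 1 2)))"
  have "\<exists>t s'. exec w ?c s t s' \<and> t \<le> 4 \<and> regs s' 0 = (if contains_pattern n E Q then 1 else 0)"
    if n: "(n + 2) ^ 2 \<le> (2::nat) ^ w" and E: "ordered_graph n E" and adj: "holds_adjacency_lists n E s"
    for n w E s
  proof -
    note b = list_start_bounds[OF E n order_refl]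
    have r: "regs s 0 = n" "mem s 0 n = list_start E n" using adj by (auto simp: holds_adjacency_lists_def)
    have "regs (sl w ?c s) 0 = (if contains_pattern n E Q then 1 else 0)"
    proof (cases m)
      case True
      then have "regs (sl w ?c s) 0 = (if list_start E n \<noteq> 0 then 1 else 0)"
        using r b(5) by simp
      then show ?thesis using True list_start_mandatory[OF E] unfolding iff by simp
    next
      case False
      have "n \<le> n * n" by simp
      then have "(n * n + (2 ^ w - n)) mod 2 ^ w = n * n - n" using b(4) by (rule sub_mod)
      then have "regs (sl w ?c s) 0 = (if list_start E n < n * n - n then 1 else 0)"
        using r b(4,5) False by simp
      then show ?thesis using False list_start_forbidden[OF E] unfolding iff by simp
    qed
    moreover have "loopfree ?c" by simp
    then obtain t where "exec w ?c s t (sl w ?c s)" "t \<le> cost ?c"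
      using exec_sl by blast
    moreover have "cost ?c \<le> 4" by simp
    ultimately show ?thesis by (meson le_trans)
  qed
  then show ?thesis
    unfolding pattern_detection_in_time_def contains_pattern_truncate solvable_in_time_def
    using const_bigo_powr[of 0 "real 4"]
    by (intro exI[of _ ?c] exI[of _ 2] exI[of _ "\<lambda>_. 4"]) auto
qed

section \<open>Detection along a merge tree\<close>

text \<open>The two cases differ only in the preprocessing and in the leaves. For p = 1 the last
  hypothesis gives every leaf exactly one anchor.\<close>

lemma pattern_detection_merge_tree:
  fixes t :: "'a::linorder mtree"
  assumes mm: "matrix_mult_in_time (\<lambda>n. real n powr \<omega>)"
    and t: "wf_mtree t" "\<And>Q. Q \<in> labels t \<Longrightarrow> card (anchors Q) \<le> p" and p: "1 \<le> p"
    and leaves: "\<And>Q. Q \<in> leaves t \<Longrightarrow> anchors Q \<noteq> {} \<or> 2 \<le> p"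
  shows "pattern_detection_in_time (pattern.truncate (label t)) (\<lambda>n. real n powr (\<omega> * real p / 2))"
proof -
  have \<omega>: "2 \<le> \<omega>" by (rule matrix_mult_exponent_ge_2[OF mm])
  obtain cm k0 T0 where T0: "(\<lambda>n. real (T0 n)) \<in> O(\<lambda>n. real n powr \<omega>)"
    and cm: "multiplies cm k0 T0"
    by (rule matrix_mult_program[OF mm])
  \<comment> \<open>\<open>D\<close> is to exceed all registers and arrays of the multiplication
    program as well as its interface arrays 0, 1 and 2.\<close>
  have "finite (wregs cm \<union> warrs cm \<union> {..<3})" using finite_wregs finite_warrs by auto
  then obtain D where D0: "\<forall>r \<in> wregs cm \<union> warrs cm \<union> {..<3}. r < D"
    unfolding finite_nat_set_iff_bounded by blast
  then have "2 < D" by simp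
  then have D: "3 \<le> D" "wregs cm \<subseteq> {..<D}" "warrs cm \<subseteq> {..<D}" using D0 by auto
  define V where "V = verts (label t)"
  have V: "finite V" using wf_label[OF t(1)] by (simp add: V_def wf_apattern_def wf_pattern_def)
  obtain g :: "'a \<Rightarrow> nat" where g: "inj_on g V" using finite_imp_inj_to_nat_seg[OF V] by blast
  \<comment> \<open>The offset skips the number of vertices and the auxiliary registers.\<close>
  define vr where "vr v = D + 8 + g v" for v
  have vr: "inj_on vr V" using g by (auto simp: inj_on_def vr_def)
  define k where "k = (p + 2) * k0 + p + 3"
  have k2: "(n + 2) ^ 2 \<le> (2::nat) ^ w" if "(n + 2) ^ k \<le> 2 ^ w" for n w
  proof -
    have "(n + 2) ^ 2 \<le> (n + 2) ^ k" by (intro power_increasing) (auto simp: k_def)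
    then show ?thesis using that by linarith
  qed
  have lab: "label t \<in> labels t" by (rule label_in_labels)
  have anc: "anchors (label t) \<subseteq> verts (label t)"
    using wf_label[OF t(1)] by (simp add: wf_apattern_def)
  have leaf: "is_edge_creation Q" "wf_apattern Q" "verts Q \<subseteq> V" "card (anchors Q) \<le> p" if "Q \<in> leaves t" for Q
    using leaves_wf[OF t(1) that] leaves_subset_labels[of t] verts_labels_subset[OF t(1), of Q] t(2)[of Q] that
    by (auto simp: V_def)
  show ?thesis
  proof (cases "2 \<le> p")
    case True
    \<comment> \<open>The adjacency matrix occupies array \<open>D\<close>, so new arrays start at D
      + 1.\<close>
    interpret detection D vr V p k "D + 1" \<omega>
      "\<lambda>n E M. holds_edge_matrix n E (M D)" cm k0 T0
      by unfold_locales (use V vr D \<omega> T0 cm in \<open>auto simp: vr_def k_def holds_edge_matrix_def\<close>)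
    have X: "computable holds_edge_matrix"
      by (rule computable_base[of D]) simp_all
    have "computable (holds_table (anchors (label t)) (label t))"
      using t V_def computable_leaf_edge_matrix[OF X leaf(1-3) True] by (intro computable_tree) auto
    then have "pattern_detection_in_time (pattern.truncate (label t)) bound"
    proof (rule detection_solvable)
      show "anchors (label t) \<subseteq> V" "anchors (label t) \<subseteq> verts (label t)" using anc by (auto simp: V_def)
      show "card (anchors (label t)) \<le> p" by (rule t(2)[OF lab])
      have "(\<lambda>n. real (loops_time n 2 x)) \<in> O(bound)" for x
        using True by (intro landau_o.big_trans[OF loops_time_const_bigo bound_ge[of "real p"]]) auto
      then show "(\<lambda>n. real (2 + (loops_time n 2 10 + loops_time n 2 (cost mark_neighbour)))) \<in> O(bound)"
        unfolding of_nat_add by (intro sum_in_bigo const_bound)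
      show "runs w matrix_program s (2 + (loops_time n 2 10 + loops_time n 2 (cost mark_neighbour)))
          (\<lambda>s'. regs s' rn = n \<and> holds_edge_matrix n E (mem s' D))"
        if "(n + 2) ^ k \<le> 2 ^ w" "word_state w s" "ordered_graph n E" "holds_adjacency_lists n E s" for n w E s
        using runs_matrix_program[OF D(1) k2[OF that(1)] that(2-4)] .
    qed
    then show ?thesis by (simp add: bound_def[abs_def])
  next
    case False
    then have p1: "p = 1" using p by simp
    \<comment> \<open>Here four arrays from \<open>D\<close> on hold the one-anchor tables, and new
      arrays start at D + 4.\<close>
    interpret detection D vr V p k "D + 4" \<omega>
      "holds_sides D" cm k0 T0
      by unfold_locales (use V vr D \<omega> T0 cm in \<open>auto simp: vr_def k_def holds_sides_def\<close>)
    have "computable (holds_table (anchors Q) Q)" if Q: "Q \<in> leaves t" for Q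
    proof (rule computable_leaf_endpoint[OF order_refl order_refl _ leaf(1,2)[OF Q]])
      have "finite (anchors Q)"
        using leaf(2)[OF Q] by (auto simp: wf_apattern_def wf_pattern_def intro: finite_subset)
      then show "card (anchors Q) = 1"
        using leaves[OF Q] False leaf(4)[OF Q] p1 by (simp add: le_Suc_eq)
    qed blast
    then have "computable (holds_table (anchors (label t)) (label t))"
      using t V_def by (intro computable_tree) auto
    then have "pattern_detection_in_time (pattern.truncate (label t)) bound"
    proof (rule detection_solvable)
      show "anchors (label t) \<subseteq> V" "anchors (label t) \<subseteq> verts (label t)" using anc by (auto simp: V_def)
      show "card (anchors (label t)) \<le> p" by (rule t(2)[OF lab])
      show "(\<lambda>n. real (2 + (fill_time n 1 1 (cost left_test) + (fill_time n 1 1 (cost left_non_test) +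
        (fill_time n 1 1 (cost right_test) + fill_time n 1 1 (cost right_non_test)))))) \<in> O(bound)"
        unfolding of_nat_add using p by (intro sum_in_bigo const_bound fill_time_bound)
      show "runs w sides_program s (2 + (fill_time n 1 1 (cost left_test) + (fill_time n 1 1 (cost left_non_test) +
          (fill_time n 1 1 (cost right_test) + fill_time n 1 1 (cost right_non_test)))))
        (\<lambda>s'. regs s' rn = n \<and> holds_sides D n E (mem s'))"
        if "(n + 2) ^ k \<le> 2 ^ w" "word_state w s" "ordered_graph n E" "holds_adjacency_lists n E s" for n w E s
        using runs_sides_program[OF D(1) k2[OF that(1)] that(2-4)] .
    qed
    then show ?thesis by (simp add: bound_def[abs_def])
  qed
qed

theorem theorem5:
  fixes \<omega> :: real and P :: "'a::linorder pattern" and p :: nat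
  assumes "matrix_mult_in_time (\<lambda>n. real n powr \<omega>)"
    and "wf_pattern P"
    and "has_merge_width P p"
  shows "pattern_detection_in_time P (\<lambda>n. real n powr (\<omega> * real p / 2))"
proof -
  obtain t where t: "wf_mtree t" "pattern.truncate (label t) = P" "width t = p"
    using assms(3) unfolding has_merge_width_def merge_tree_for_def by blast
  have card: "card (anchors Q) \<le> p" if "Q \<in> labels t" for Q
    unfolding t(3)[symmetric] width_def using that finite_labels[of t] by (intro Max_ge) auto
  have "pattern_detection_in_time (pattern.truncate (label t)) (\<lambda>n. real n powr (\<omega> * real p / 2))"
  proof (cases "p = 0")
    case True
    \<comment> \<open>Any leaf will do: at width 0 it has no anchors and is therefore the whole
      tree.\<close>
    obtain Q where Q: "Q \<in> leaves t" by (induction t) auto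
    have "card (anchors Q) = 0" using card[of Q] leaves_subset_labels[of t] Q True by auto
    moreover have "finite (anchors Q)"
      using leaves_wf[OF t(1) Q] by (auto simp: wf_apattern_def wf_pattern_def intro: finite_subset)
    ultimately have "t = Leaf Q" using unanchored_leaf[OF t(1) Q] by simp
    then have "is_edge_creation (label t)" using leaves_wf[OF t(1) Q] by simp
    from unanchored_edge_solvable[OF this] True show ?thesis by simp
  next
    case False
    show ?thesis
    proof (rule pattern_detection_merge_tree[OF assms(1) t(1) card])
      show "1 \<le> p" using False by simp
      fix Q assume Q: "Q \<in> leaves t"
      show "anchors Q \<noteq> {} \<or> 2 \<le> p"
      proof (rule ccontr)
        assume "\<not> (anchors Q \<noteq> {} \<or> 2 \<le> p)"
        \<comment> \<open>Such a leaf would be the whole tree, whose width would then be 0 and not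
          1.\<close>
        then have e: "anchors Q = {}" "p = 1" using False by auto
        then have "t = Leaf Q" using unanchored_leaf[OF t(1) Q] by simp
        then show False using t(3) e by (simp add: width_def)
      qed
    qed
  qed
  then show ?thesis unfolding t(2) .
qed


end
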